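(* Let $\dim X<\infty$, $\mathbf X=l^p(\mathbb Z^N,X)$ and $A\in\mathcal L(\mathbf X,\mathcal P)$. Then $$\mu(A)=B(A)=S(A).$$
   Context: Let $N\in\mathbb N$, $p\in\{0\}\cup[1,\infty]$, and let $X\ne\{0\}$ be a complex Banach space (here finite-dimensional). $\mathbf X=l^p(\mathbb Z^N,X)$ is the space of sequences $x=(x_i)_{i\in\mathbb Z^N}$, $x_i\in X$, with the usual $p$-norm for $1\le p\le\infty$; $l^0(\mathbb Z^N,X)$ denotes the closure in $l^\infty(\mathbb Z^N,X)$ of the finitely supported sequences. $P_n:=\chi_{\{-n,\dots,n\}^N}I$ (multiplication by the characteristic function), $Q_n:=I-P_n$ ($n\in\mathbb N$), $\mathcal P:=(P_n)$. $\mathcal K(\mathbf X,\mathcal P):=\{K\in\mathcal L(\mathbf X):\|Q_nK\|+\|KQ_n\|\to0\}$ and $\mathcal L(\mathbf X,\mathcal P):=\{A\in\mathcal L(\mathbf X):AK,KA\in\mathcal K(\mathbf X,\mathcal P)\ \forall K\in\mathcal K(\mathbf X,\mathcal P)\}$. Lower norm: $\nu(B):=\inf\{\|Bx\|:\|x\|=1\}$. $\tilde\mu(A):=\lim_{m\to\infty}\nu(A|_{\mathrm{im}\,Q_m})$, $\tilde\mu(A^* ):=\lim_{m\to\infty}\nu(A^*|_{\mathrm{im}\,Q_m^*})$ on the dual space $\mathbf X^*$ (limits exist by monotonicity), $\mu(A):=\min\{\tilde\mu(A),\tilde\mu(A^* )\}$. For $A\in\mathcal L(\mathbf X)$ and $m\in\mathbb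 N$ let $B_m(A):=\sup\{\nu(A|_V):\dim \mathbf X/V<m\}$ (over subspaces $V\subset\mathbf X$), with $B_m(A^* )$ defined analogously on $\mathbf X^*$; $s_m^r(A):=\inf\{\|A-F\|:F\in\mathcal L(\mathbf X),\ \dim\ker F\ge m\}$; $s_m^l(A):=\inf\{\|A-F\|:F\in\mathcal L(\mathbf X),\ \dim\mathrm{coker}\,F\ge m\}$ with $\mathrm{coker}\,F=\mathbf X/\mathrm{im}\,F$. Then $B(A):=\lim_{m\to\infty}\min\{B_m(A),B_m(A^* )\}$ and $S(A):=\lim_{m\to\infty}\min\{s_m^r(A),s_m^l(A)\}$; these limits exist by monotonicity. *)

theory Defs
  imports "HOL-Analysis.Analysis" "HOL-Library.Function_Algebras" "HOL-Library.Extended_Nat"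
begin

section \<open>Complex vector spaces\<close>

class complex_vector = ab_group_add +
  fixes scaleC :: "complex \<Rightarrow> 'a \<Rightarrow> 'a"  (infixr \<open>*\<^sub>C\<close> 75)
  assumes scaleC_add_right: "a *\<^sub>C (x + y) = a *\<^sub>C x + a *\<^sub>C y"
    and scaleC_add_left: "(a + b) *\<^sub>C x = a *\<^sub>C x + b *\<^sub>C x"
    and scaleC_scaleC: "a *\<^sub>C b *\<^sub>C x = (a * b) *\<^sub>C x"
    and scaleC_one: "1 *\<^sub>C x = x"

text \<open>A complex normed space is in particular a real one; the norm, the metric and the topology
  (hence completeness, class \<open>banach\<close>) are those of the library.\<close>

class complex_normed_vector = complex_vector + real_normed_vector +
  assumes scaleR_scaleC: "r *\<^sub>R x = of_real r *\<^sub>C x"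
    and norm_scaleC: "norm (a *\<^sub>C x) = cmod a * norm x"

global_interpretation complex_vector: vector_space "scaleC :: complex \<Rightarrow> 'a \<Rightarrow> 'a::complex_vector"
  by unfold_locales (simp_all add: scaleC_add_right scaleC_add_left scaleC_scaleC scaleC_one)

instantiation complex :: complex_normed_vector
begin

definition "scaleC_complex = ((*) :: complex \<Rightarrow> complex \<Rightarrow> complex)"

instance
  by standard
    (simp_all add: scaleC_complex_def algebra_simps norm_mult scaleR_conv_of_real)

end

instantiation "fun" :: (type, complex_vector) complex_vector
begin

definition "scaleC_fun a f = (\<lambda>x. a *\<^sub>C f x)"

instance
  by standard
    (simp_all add: scaleC_fun_def fun_eq_iff scaleC_add_right scaleC_add_left
      scaleC_scaleC scaleC_one)

end

text \<open>The dimension of \<open>U / W\<close>: a family in \<open>U\<close> has linearly independent cosets modulo \<open>W\<close> iff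
  only its trivial linear combination lies in \<open>W\<close>. The value is \<open>\<infinity>\<close> in the infinite-dimensional case,
  and \<open>W = {0}\<close> gives the dimension of \<open>U\<close> itself.\<close>

definition independent_mod :: "'a::complex_vector set \<Rightarrow> 'a set \<Rightarrow> bool" where
  "independent_mod W B \<longleftrightarrow>
     finite B \<and> (\<forall>c. (\<Sum>b\<in>B. c b *\<^sub>C b) \<in> W \<longrightarrow> (\<forall>b\<in>B. c b = 0))"

definition quotient_dim :: "'a::complex_vector set \<Rightarrow> 'a set \<Rightarrow> enat" where
  "quotient_dim U W = (SUP B\<in>{B. B \<subseteq> U \<and> independent_mod W B}. enat (card B))"

abbreviation subspace_dim :: "'a::complex_vector set \<Rightarrow> enat" where
  "subspace_dim U \<equiv> quotient_dim U {0}"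


section \<open>Normed spaces with explicit carrier\<close>

text \<open>The exponent of a sequence space is a term, so the space cannot be a type. A normed space is
  given by a linear subspace of an ambient complex vector space and a norm on that subspace.\<close>

record 'a nspace =
  carrier_of :: "'a set"
  norm_of :: "'a \<Rightarrow> real"

text \<open>Bounded operators are set to 0 outside the carrier, so that each one is represented by
  exactly one function.\<close>

definition bounded_ops ::
  "'a::complex_vector nspace \<Rightarrow> 'b::complex_vector nspace \<Rightarrow> ('a \<Rightarrow> 'b) set" where
  "bounded_ops S T = {f.
     (\<forall>x\<in>carrier_of S. f x \<in> carrier_of T) \<and>
     (\<forall>x\<in>carrier_of S. \<forall>y\<in>carrier_of S. f (x + y) = f x + f y) \<and>
     (\<forall>a. \<forall>x\<in>carrier_of S. f (a *\<^sub>C x) = a *\<^sub>C f x) \<and>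
     (\<exists>C. \<forall>x\<in>carrier_of S. norm_of T (f x) \<le> C * norm_of S x) \<and>
     (\<forall>x. x \<notin> carrier_of S \<longrightarrow> f x = 0)}"

definition op_norm :: "'a nspace \<Rightarrow> 'b nspace \<Rightarrow> ('a \<Rightarrow> 'b) \<Rightarrow> real" where
  "op_norm S T f = (SUP x\<in>{x \<in> carrier_of S. norm_of S x \<le> 1}. norm_of T (f x))"

definition scalars :: "complex nspace" where
  "scalars = \<lparr>carrier_of = UNIV, norm_of = cmod\<rparr>"

definition dual :: "'a::complex_vector nspace \<Rightarrow> ('a \<Rightarrow> complex) nspace" where
  "dual S = \<lparr>carrier_of = bounded_ops S scalars, norm_of = op_norm S scalars\<rparr>"

definition adjoint_op ::
  "'a nspace \<Rightarrow> ('a \<Rightarrow> 'a) \<Rightarrow> ('a \<Rightarrow> complex) \<Rightarrow> ('a \<Rightarrow> complex)" where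
  "adjoint_op S A g = (\<lambda>x. if x \<in> carrier_of S then g (A x) else 0)"

text \<open>The lower norm of the restriction of \<open>A\<close> to the subspace \<open>V\<close>.\<close>

definition lower_norm :: "'a nspace \<Rightarrow> ('a \<Rightarrow> 'a) \<Rightarrow> 'a set \<Rightarrow> real" where
  "lower_norm S A V = (INF x\<in>{x \<in> V. norm_of S x = 1}. norm_of S (A x))"


section \<open>Bernstein and approximation numbers\<close>

definition bernstein_number ::
  "'a::complex_vector nspace \<Rightarrow> ('a \<Rightarrow> 'a) \<Rightarrow> nat \<Rightarrow> real" where
  "bernstein_number S A m =
     (SUP V\<in>{V. complex_vector.subspace V \<and> V \<subseteq> carrier_of S
                 \<and> quotient_dim (carrier_of S) V < enat m}. lower_norm S A V)"

definition right_approx_number ::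
  "'a::complex_vector nspace \<Rightarrow> ('a \<Rightarrow> 'a) \<Rightarrow> nat \<Rightarrow> real" where
  "right_approx_number S A m =
     (INF F\<in>{F \<in> bounded_ops S S. subspace_dim {x \<in> carrier_of S. F x = 0} \<ge> enat m}.
        op_norm S S (A - F))"

definition left_approx_number ::
  "'a::complex_vector nspace \<Rightarrow> ('a \<Rightarrow> 'a) \<Rightarrow> nat \<Rightarrow> real" where
  "left_approx_number S A m =
     (INF F\<in>{F \<in> bounded_ops S S. quotient_dim (carrier_of S) (F ` carrier_of S) \<ge> enat m}.
        op_norm S S (A - F))"

definition B_limit :: "'a::complex_vector nspace \<Rightarrow> ('a \<Rightarrow> 'a) \<Rightarrow> real" where
  "B_limit S A =
     lim (\<lambda>m. min (bernstein_number S A m) (bernstein_number (dual S) (adjoint_op S A) m))"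

definition S_limit :: "'a::complex_vector nspace \<Rightarrow> ('a \<Rightarrow> 'a) \<Rightarrow> real" where
  "S_limit S A = lim (\<lambda>m. min (right_approx_number S A m) (left_approx_number S A m))"


section \<open>Sequence spaces over the integer lattice\<close>

type_synonym ('x, 'n) lattice_seq = "int ^ 'n \<Rightarrow> 'x"

definition bounded_seqs :: "('x::real_normed_vector, 'n::finite) lattice_seq set" where
  "bounded_seqs = {x. bdd_above (range (\<lambda>i. norm (x i)))}"

definition sup_norm :: "('x::real_normed_vector, 'n::finite) lattice_seq \<Rightarrow> real" where
  "sup_norm x = (SUP i. norm (x i))"

text \<open>The exponent \<open>0\<close> stands for the sup-norm closure of the finitely supported sequences.\<close>

definition lp :: "ereal \<Rightarrow> ('x::real_normed_vector, 'n::finite) lattice_seq nspace" where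
  "lp p =
     (if p = 0 then
        \<lparr>carrier_of = {x \<in> bounded_seqs.
            \<forall>e>0. \<exists>y. finite {i. y i \<noteq> 0} \<and> sup_norm (x - y) < e},
         norm_of = sup_norm\<rparr>
      else if p = \<infinity> then
        \<lparr>carrier_of = bounded_seqs, norm_of = sup_norm\<rparr>
      else
        \<lparr>carrier_of = {x. (\<lambda>i. norm (x i) powr real_of_ereal p) summable_on UNIV},
         norm_of = (\<lambda>x. (\<Sum>\<^sub>\<infinity>i. norm (x i) powr real_of_ereal p) powr (1 / real_of_ereal p))\<rparr>)"

definition P_proj :: "nat \<Rightarrow> ('x::zero, 'n::finite) lattice_seq \<Rightarrow> ('x, 'n) lattice_seq" where
  "P_proj n x = (\<lambda>i. if \<forall>k. - int n \<le> i $ k \<and> i $ k \<le> int n then x i else 0)"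

definition Q_proj :: "nat \<Rightarrow> ('x::ab_group_add, 'n::finite) lattice_seq \<Rightarrow> ('x, 'n) lattice_seq"
  where "Q_proj n x = x - P_proj n x"

definition P_compact_ops ::
  "('x::complex_vector, 'n::finite) lattice_seq nspace
     \<Rightarrow> (('x, 'n) lattice_seq \<Rightarrow> ('x, 'n) lattice_seq) set" where
  "P_compact_ops S = {K \<in> bounded_ops S S.
     (\<lambda>n. op_norm S S (Q_proj n \<circ> K) + op_norm S S (K \<circ> Q_proj n)) \<longlonglongrightarrow> 0}"

definition LP_ops ::
  "('x::complex_vector, 'n::finite) lattice_seq nspace
     \<Rightarrow> (('x, 'n) lattice_seq \<Rightarrow> ('x, 'n) lattice_seq) set" where
  "LP_ops S = {A \<in> bounded_ops S S.
     \<forall>K\<in>P_compact_ops S. A \<circ> K \<in> P_compact_ops S \<and> K \<circ> A \<in> P_compact_ops S}"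

definition mu_tilde ::
  "('x::complex_vector, 'n::finite) lattice_seq nspace
     \<Rightarrow> (('x, 'n) lattice_seq \<Rightarrow> ('x, 'n) lattice_seq) \<Rightarrow> real" where
  "mu_tilde S A = lim (\<lambda>m. lower_norm S A (Q_proj m ` carrier_of S))"

definition mu_tilde_dual ::
  "('x::complex_vector, 'n::finite) lattice_seq nspace
     \<Rightarrow> (('x, 'n) lattice_seq \<Rightarrow> ('x, 'n) lattice_seq) \<Rightarrow> real" where
  "mu_tilde_dual S A =
     lim (\<lambda>m. lower_norm (dual S) (adjoint_op S A)
                (adjoint_op S (Q_proj m) ` carrier_of (dual S)))"

definition mu ::
  "('x::complex_vector, 'n::finite) lattice_seq nspace
     \<Rightarrow> (('x, 'n) lattice_seq \<Rightarrow> ('x, 'n) lattice_seq) \<Rightarrow> real" where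
  "mu S A = min (mu_tilde S A) (mu_tilde_dual S A)"

end

theory Submission
  imports Defs
begin

text \<open>All four limits exist separately. Write \<open>a\<close> and \<open>a'\<close> for the limits of the lower norms of \<open>A\<close> on the
  ranges of \<open>Q_m\<close> and of \<open>A\<^sup>*\<close> on the ranges of \<open>Q_m\<^sup>*\<close>. The Bernstein numbers of \<open>A\<close> and the right
  approximation numbers tend to \<open>a\<close>; the Bernstein numbers of \<open>A\<^sup>*\<close> and the left approximation numbers
  tend to \<open>a'\<close>. Taking minima gives the theorem.

  \<^emph>\<open>Lower bounds.\<close> The ranges of \<open>Q_m\<close> and \<open>Q_m\<^sup>*\<close> have finite codimension, because a box of the
  lattice is finite and \<open>X\<close> is finite-dimensional (\<open>finite_codim\<close>). So they compete in the Bernstein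
  numbers. If \<open>F\<close> has a large kernel, the kernel meets the range of \<open>Q_m\<close>, where \<open>A\<close> and \<open>A - F\<close> agree.
  For cokernels no such direct argument is possible, since the range of \<open>F\<close> need not be closed.
  Instead, if \<open>\<parallel>A - F\<parallel>\<close> is less than the lower norm of \<open>A\<^sup>*\<close> on the range of \<open>Q_m\<^sup>*\<close>, then the adjoint of
  \<open>Q_m F\<close> is bounded below there, so \<open>Q_m F\<close> maps onto the range of \<open>Q_m\<close> (\<open>approximate_solution\<close>,
  \<open>exact_solution\<close>), and the range of \<open>F\<close> has codimension at most the rank of \<open>P_m\<close>.

  \<^emph>\<open>Upper bounds.\<close> This is a gliding hump argument. It needs almost minimisers of \<open>A\<close> and of \<open>A\<^sup>*\<close> that
  have finite support and lie far out. They arise from arbitrary almost minimisers by multiplication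
  with finitely supported cutoff functions that almost commute with \<open>A\<close>
  (\<open>approximately_commuting_cutoff\<close>); this is where membership in \<open>L(X, P)\<close> enters. Cutting off a
  functional may destroy it when \<open>p = \<infinity>\<close>; there a compactness argument takes over
  (\<open>finite_dual_minimiser_closed\<close>). Since \<open>A\<close> almost maps boxes to boxes, one obtains any number of
  humps \<open>x_j\<close> with biorthogonal functionals \<open>g_j\<close> on disjoint shells whose images are almost disjoint as
  well. With the projection \<open>\<Pi> x = \<Sum> g_j(x) x_j\<close> the operators \<open>A - A \<Pi>\<close> and \<open>A - \<Pi> A\<close> then bound the right
  and the left approximation numbers, and the spans of the \<open>x_j\<close> and of the \<open>g_j\<close> bound the two kinds of
  Bernstein numbers (\<open>hump_system\<close>, \<open>dual_hump_system\<close>, \<open>biorthogonal_right\<close>, \<open>biorthogonal_left\<close>).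

  Of the spaces \<open>l\<^sup>p\<close> only a few lattice properties are used; they form the locale \<open>seq_space\<close>.\<close>

section \<open>Dimensions of quotients\<close>

text \<open>Gaussian elimination on the unknowns. Stating it for a matrix rather than for a set of vectors
  lets it serve two purposes: the rows may be coordinates of vectors, possibly with repetitions, or
  values of functionals.\<close>

lemma nontrivial_solution:
  fixes M :: "'g \<Rightarrow> 'e \<Rightarrow> complex"
  assumes "finite E" "finite G" "card E < card G"
  shows "\<exists>c. (\<exists>g\<in>G. c g \<noteq> 0) \<and> (\<forall>e\<in>E. (\<Sum>g\<in>G. c g * M g e) = 0)"
  using assms
proof (induction E arbitrary: G M rule: finite_induct)
  case empty
  then have "G \<noteq> {}" by auto
  then show ?case by (intro exI[of _ "\<lambda>_. 1"]) auto
next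
  case (insert e E)
  show ?case
  proof (cases "\<forall>g\<in>G. M g e = 0")
    case True
    then show ?thesis using insert.IH[of G M] insert.prems insert.hyps by auto
  next
    case False
    then obtain g0 where g0: "g0 \<in> G" "M g0 e \<noteq> 0" by auto
    define G' where "G' = G - {g0}"
    define M' where "M' g d = M g d - M g e / M g0 e * M g0 d" for g d
    have finG: "finite G'" and GG: "G = insert g0 G'" and notin: "g0 \<notin> G'"
      using insert.prems g0 by (auto simp: G'_def)
    have "card E < card G'"
      using insert.prems insert.hyps finG notin unfolding GG by simp
    from insert.IH[OF finG this, of M'] obtain c where
      c: "\<exists>g\<in>G'. c g \<noteq> 0" "\<forall>d\<in>E. (\<Sum>g\<in>G'. c g * M' g d) = 0" by auto
    define s where "s = - (\<Sum>g\<in>G'. c g * (M g e / M g0 e))"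
    define c' where "c' = c(g0 := s)"
    have split: "(\<Sum>g\<in>G. c' g * M g d) = s * M g0 d + (\<Sum>g\<in>G'. c g * M g d)" for d
    proof -
      have "(\<Sum>g\<in>G. c' g * M g d) = c' g0 * M g0 d + (\<Sum>g\<in>G'. c' g * M g d)"
        unfolding GG using finG notin by simp
      also have "(\<Sum>g\<in>G'. c' g * M g d) = (\<Sum>g\<in>G'. c g * M g d)"
        using notin by (intro sum.cong) (auto simp: c'_def)
      finally show ?thesis by (simp add: c'_def)
    qed
    have s: "(\<Sum>g\<in>G'. c g * M' g d) = s * M g0 d + (\<Sum>g\<in>G'. c g * M g d)" for d
      by (simp add: M'_def s_def algebra_simps sum_subtractf sum_distrib_left)
    have "\<exists>g\<in>G. c' g \<noteq> 0" using c(1) notin by (force simp: c'_def GG)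
    moreover have "(\<Sum>g\<in>G. c' g * M g d) = 0" if "d \<in> insert e E" for d
    proof -
      have "(\<Sum>g\<in>G'. c g * M' g d) = 0"
      proof (cases "d = e")
        case True
        then show ?thesis using g0 by (simp add: M'_def)
      next
        case False
        then show ?thesis using c(2) that by simp
      qed
      then show ?thesis by (simp add: split s)
    qed
    ultimately show ?thesis by blast
  qed
qed

lemma quotient_dim_ge:
  assumes "B \<subseteq> U" "independent_mod W B"
  shows "enat (card B) \<le> quotient_dim U W"
  unfolding quotient_dim_def using assms by (intro SUP_upper) auto

lemma quotient_dim_geE:
  assumes "enat m \<le> quotient_dim U W"
  obtains B where "B \<subseteq> U" "independent_mod W B" "m \<le> card B"
proof (cases m)
  case 0
  then show ?thesis using that[of "{}"] by (simp add: independent_mod_def)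
next
  case (Suc k)
  then have "enat k < quotient_dim U W" using assms by (metis Suc_ile_eq)
  then obtain B where "B \<in> {B. B \<subseteq> U \<and> independent_mod W B}" "enat k < enat (card B)"
    unfolding quotient_dim_def less_SUP_iff by blast
  then show ?thesis using that[of B] Suc by auto
qed

lemma quotient_dim_le_spanning:
  fixes e :: "'e \<Rightarrow> 'a::complex_vector"
  assumes W: "complex_vector.subspace W" and E: "finite E"
    and dec: "\<And>u. u \<in> U \<Longrightarrow> \<exists>c. u - (\<Sum>i\<in>E. c i *\<^sub>C e i) \<in> W"
  shows "quotient_dim U W \<le> enat (card E)"
  unfolding quotient_dim_def
proof (rule SUP_least, rule ccontr)
  fix B assume B: "B \<in> {B. B \<subseteq> U \<and> independent_mod W B}" and "\<not> enat (card B) \<le> enat (card E)"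
  then have card: "card E < card B" and fin: "finite B" by (auto simp: independent_mod_def)
  from dec B have "\<forall>b\<in>B. \<exists>c. b - (\<Sum>i\<in>E. c i *\<^sub>C e i) \<in> W" by blast
  then obtain M where M: "\<And>b. b \<in> B \<Longrightarrow> b - (\<Sum>i\<in>E. M b i *\<^sub>C e i) \<in> W" by metis
  from nontrivial_solution[OF E fin card, of M] obtain c where
    c: "\<exists>b\<in>B. c b \<noteq> 0" "\<forall>i\<in>E. (\<Sum>b\<in>B. c b * M b i) = 0" by auto
  have "(\<Sum>b\<in>B. c b *\<^sub>C (\<Sum>i\<in>E. M b i *\<^sub>C e i)) = (\<Sum>b\<in>B. \<Sum>i\<in>E. (c b * M b i) *\<^sub>C e i)"
    by (simp add: complex_vector.scale_sum_right scaleC_scaleC)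
  also have "\<dots> = (\<Sum>i\<in>E. \<Sum>b\<in>B. (c b * M b i) *\<^sub>C e i)" by (rule sum.swap)
  also have "\<dots> = (\<Sum>i\<in>E. (\<Sum>b\<in>B. c b * M b i) *\<^sub>C e i)"
    by (simp add: complex_vector.scale_sum_left)
  also have "\<dots> = 0" using c(2) by simp
  finally have "(\<Sum>b\<in>B. c b *\<^sub>C b) = (\<Sum>b\<in>B. c b *\<^sub>C (b - (\<Sum>i\<in>E. M b i *\<^sub>C e i)))"
    by (simp add: complex_vector.scale_right_diff_distrib sum_subtractf)
  also have "\<dots> \<in> W"
    using M by (intro complex_vector.subspace_sum[OF W] complex_vector.subspace_scale[OF W])
  finally show False using B c(1) by (auto simp: independent_mod_def)
qed

text \<open>For a space of functionals it is easier to name functionals on it that cut out \<open>W\<close>, namely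
  evaluations at points, than to name vectors that span a complement of \<open>W\<close>.\<close>

lemma quotient_dim_le_annihilator:
  fixes \<beta> :: "'e \<Rightarrow> 'a::complex_vector \<Rightarrow> complex"
  assumes E: "finite E"
    and lin: "\<And>B c i. \<lbrakk>finite B; B \<subseteq> U; i \<in> E\<rbrakk> \<Longrightarrow> \<beta> i (\<Sum>b\<in>B. c b *\<^sub>C b) = (\<Sum>b\<in>B. c b * \<beta> i b)"
    and ann: "\<And>B c. \<lbrakk>finite B; B \<subseteq> U; \<forall>i\<in>E. \<beta> i (\<Sum>b\<in>B. c b *\<^sub>C b) = 0\<rbrakk> \<Longrightarrow> (\<Sum>b\<in>B. c b *\<^sub>C b) \<in> W"
  shows "quotient_dim U W \<le> enat (card E)"
  unfolding quotient_dim_def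
proof (rule SUP_least, rule ccontr)
  fix B assume B: "B \<in> {B. B \<subseteq> U \<and> independent_mod W B}" and "\<not> enat (card B) \<le> enat (card E)"
  then have card: "card E < card B" and fin: "finite B" by (auto simp: independent_mod_def)
  from nontrivial_solution[OF E fin card, of "\<lambda>b i. \<beta> i b"] obtain c where
    c: "\<exists>b\<in>B. c b \<noteq> 0" "\<forall>i\<in>E. (\<Sum>b\<in>B. c b * \<beta> i b) = 0" by auto
  have "(\<Sum>b\<in>B. c b *\<^sub>C b) \<in> W" using B c fin by (intro ann) (auto simp: lin)
  then show False using B c(1) by (auto simp: independent_mod_def)
qed

section \<open>The Hahn-Banach theorem for complex seminorms\<close>

definition sublinear_on :: "'a::complex_vector set \<Rightarrow> ('a \<Rightarrow> real) \<Rightarrow> bool" where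
  "sublinear_on V q \<longleftrightarrow>
     (\<forall>x\<in>V. \<forall>y\<in>V. q (x + y) \<le> q x + q y) \<and>
     (\<forall>x\<in>V. \<forall>t\<ge>0. q (of_real t *\<^sub>C x) \<le> t * q x)"

lemma sublinear_on_add: "sublinear_on V q \<Longrightarrow> x \<in> V \<Longrightarrow> y \<in> V \<Longrightarrow> q (x + y) \<le> q x + q y"
  by (auto simp: sublinear_on_def)

lemma sublinear_on_scale_le: "sublinear_on V q \<Longrightarrow> x \<in> V \<Longrightarrow> 0 \<le> t \<Longrightarrow> q (of_real t *\<^sub>C x) \<le> t * q x"
  by (auto simp: sublinear_on_def)

context
  fixes V :: "'a::complex_vector set"
  assumes V: "complex_vector.subspace V"
begin

lemma sublinear_on_zero:
  assumes "sublinear_on V q" shows "q 0 = 0"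
proof -
  have "q (0 + 0) \<le> q 0 + q 0"
    using assms complex_vector.subspace_0[OF V] by (intro sublinear_on_add)
  moreover have "q (of_real 0 *\<^sub>C 0) \<le> 0 * q 0"
    using assms complex_vector.subspace_0[OF V] by (intro sublinear_on_scale_le) auto
  ultimately show ?thesis by simp
qed

lemma sublinear_on_scale:
  assumes q: "sublinear_on V q" and x: "x \<in> V" and t: "0 \<le> t"
  shows "q (of_real t *\<^sub>C x) = t * q x"
proof (cases "t = 0")
  case True
  then show ?thesis using sublinear_on_zero[OF q] by simp
next
  case False
  then have t: "t > 0" using t by simp
  have "q (of_real (inverse t) *\<^sub>C of_real t *\<^sub>C x) \<le> inverse t * q (of_real t *\<^sub>C x)"
    using t by (intro sublinear_on_scale_le[OF q] complex_vector.subspace_scale[OF V] x) auto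
  also have "of_real (inverse t) *\<^sub>C of_real t *\<^sub>C x = x"
  proof -
    have "complex_of_real (inverse t) * of_real t = 1" using t by simp
    then show ?thesis by (simp only: scaleC_scaleC scaleC_one)
  qed
  finally have "t * q x \<le> q (of_real t *\<^sub>C x)" using t by (simp add: field_simps)
  then show ?thesis using sublinear_on_scale_le[OF q x] t by (intro antisym) auto
qed

lemma sublinear_on_minus:
  assumes "sublinear_on V q" "x \<in> V" shows "- q (- x) \<le> q x"
  using sublinear_on_add[OF assms(1,2), of "-x"] sublinear_on_zero[OF assms(1)]
    complex_vector.subspace_neg[OF V assms(2)] by simp

text \<open>The functional \<open>q\<close> is lowered along \<open>y\<close> as far as subadditivity permits: the value at \<open>- y\<close>
  becomes at most \<open>- q y\<close>. So a minimal sublinear functional equals its own steepenings, and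
  \<open>q x \<le> q (x + y) - q y\<close> makes it additive.\<close>

definition steepen :: "('a \<Rightarrow> real) \<Rightarrow> 'a \<Rightarrow> 'a \<Rightarrow> real" where
  "steepen q y x = (if x \<in> V then INF t\<in>{0..}. q (x + of_real t *\<^sub>C y) - t * q y else 0)"

lemma
  assumes q: "sublinear_on V q" and y: "y \<in> V"
  shows sublinear_on_steepen: "sublinear_on V (steepen q y)"
    and steepen_le: "\<And>x t. x \<in> V \<Longrightarrow> 0 \<le> t \<Longrightarrow> steepen q y x \<le> q (x + of_real t *\<^sub>C y) - t * q y"
proof -
  have ty: "of_real t *\<^sub>C y \<in> V" for t by (intro complex_vector.subspace_scale[OF V] y)
  have lower: "- q (- x) \<le> q (x + of_real t *\<^sub>C y) - t * q y" if "x \<in> V" "0 \<le> t" for x t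
  proof -
    have "q ((x + of_real t *\<^sub>C y) + (- x)) \<le> q (x + of_real t *\<^sub>C y) + q (- x)"
      using that ty by (intro sublinear_on_add[OF q] complex_vector.subspace_add[OF V]
          complex_vector.subspace_neg[OF V])
    then show ?thesis using sublinear_on_scale[OF q y that(2)] by simp
  qed
  show le: "steepen q y x \<le> q (x + of_real t *\<^sub>C y) - t * q y" if "x \<in> V" "0 \<le> t" for x t
    unfolding steepen_def using that lower by (auto intro!: cINF_lower bdd_belowI2)
  have ge: "c \<le> steepen q y x" if "x \<in> V" "\<And>t. 0 \<le> t \<Longrightarrow> c \<le> q (x + of_real t *\<^sub>C y) - t * q y" for c x
    unfolding steepen_def using that by (auto intro!: cINF_greatest)
  show "sublinear_on V (steepen q y)"
    unfolding sublinear_on_def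
  proof (intro conjI ballI allI impI)
    fix u v assume uv: "u \<in> V" "v \<in> V"
    have "steepen q y (u + v) - (q (v + of_real s *\<^sub>C y) - s * q y) \<le> steepen q y u" if s: "0 \<le> s" for s
    proof (rule ge[OF uv(1)])
      fix t :: real assume t: "0 \<le> t"
      have "steepen q y (u + v) \<le> q ((u + v) + of_real (t + s) *\<^sub>C y) - (t + s) * q y"
        using s t uv by (intro le complex_vector.subspace_add[OF V]) auto
      also have "(u + v) + of_real (t + s) *\<^sub>C y = (u + of_real t *\<^sub>C y) + (v + of_real s *\<^sub>C y)"
        by (simp add: scaleC_add_left algebra_simps)
      also have "q \<dots> \<le> q (u + of_real t *\<^sub>C y) + q (v + of_real s *\<^sub>C y)"
        using uv ty by (intro sublinear_on_add[OF q] complex_vector.subspace_add[OF V])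
      finally show "steepen q y (u + v) - (q (v + of_real s *\<^sub>C y) - s * q y)
          \<le> q (u + of_real t *\<^sub>C y) - t * q y" by (simp add: algebra_simps)
    qed
    then have "steepen q y (u + v) - steepen q y u \<le> steepen q y v"
      by (intro ge[OF uv(2)]) (simp add: algebra_simps)
    then show "steepen q y (u + v) \<le> steepen q y u + steepen q y v" by simp
  next
    fix x t assume x: "x \<in> V" and t: "(0::real) \<le> t"
    show "steepen q y (of_real t *\<^sub>C x) \<le> t * steepen q y x"
    proof (cases "t = 0")
      case True
      then show ?thesis using le[of 0 0] complex_vector.subspace_0[OF V] sublinear_on_zero[OF q] by simp
    next
      case False
      then have t: "t > 0" using t by simp
      have "inverse t * steepen q y (of_real t *\<^sub>C x) \<le> steepen q y x"
      proof (rule ge[OF x])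
        fix s :: real assume s: "0 \<le> s"
        have "steepen q y (of_real t *\<^sub>C x) \<le> q (of_real t *\<^sub>C x + of_real (t * s) *\<^sub>C y) - (t * s) * q y"
          using s t x by (intro le complex_vector.subspace_scale[OF V]) auto
        also have "of_real t *\<^sub>C x + of_real (t * s) *\<^sub>C y = of_real t *\<^sub>C (x + of_real s *\<^sub>C y)"
          by (simp add: scaleC_add_right scaleC_scaleC)
        also have "q \<dots> = t * q (x + of_real s *\<^sub>C y)"
          using t x ty by (intro sublinear_on_scale[OF q] complex_vector.subspace_add[OF V]) auto
        finally show "inverse t * steepen q y (of_real t *\<^sub>C x) \<le> q (x + of_real s *\<^sub>C y) - s * q y"
          using t by (simp add: field_simps)
      qed
      then show ?thesis using t by (simp add: field_simps)
    qed
  qed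
qed

text \<open>Zorn's lemma applies since the pointwise infimum of a chain of sublinear functionals below \<open>p\<close> is
  sublinear again; it is finite because each member is at least \<open>- p (- x)\<close>.\<close>

lemma exists_minimal_sublinear:
  assumes p: "sublinear_on V p"
  shows "\<exists>q. sublinear_on V q \<and> (\<forall>x\<in>V. q x \<le> p x) \<and>
    (\<forall>r. sublinear_on V r \<longrightarrow> (\<forall>x\<in>V. r x \<le> q x) \<longrightarrow> (\<forall>x\<in>V. r x = q x))"
proof -
  define Q where "Q = {q. sublinear_on V q \<and> (\<forall>x\<in>V. q x \<le> p x) \<and> (\<forall>x. x \<notin> V \<longrightarrow> q x = 0)}"
  define P where "P = (\<lambda>(q::'a \<Rightarrow> real) r. r \<le> q)"
  define z where "z f = (\<lambda>x. if x \<in> V then f x else (0::real))" for f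
  have z_sub: "sublinear_on V (z f)" if "sublinear_on V f" for f
    using that V unfolding z_def sublinear_on_def
    by (auto simp: complex_vector.subspace_add complex_vector.subspace_scale)
  have lower: "- p (- x) \<le> q x" if "q \<in> Q" "x \<in> V" for q x
  proof -
    have "- q (- x) \<le> q x" using that by (intro sublinear_on_minus) (auto simp: Q_def)
    moreover have "q (- x) \<le> p (- x)"
      using that complex_vector.subspace_neg[OF V] by (auto simp: Q_def)
    ultimately show ?thesis by simp
  qed
  have "\<exists>m\<in>Q. \<forall>a\<in>Q. P m a \<longrightarrow> a = m"
  proof (rule predicate_Zorn)
    show "partial_order_on Q (relation_of P Q)"
      by (auto simp: partial_order_on_def preorder_on_def refl_on_def trans_def antisym_def
          relation_of_def P_def)
  next
    fix C assume C: "C \<in> Chains (relation_of P Q)"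
    then have CQ: "C \<subseteq> Q" and tot: "\<And>q r. q \<in> C \<Longrightarrow> r \<in> C \<Longrightarrow> q \<le> r \<or> r \<le> q"
      by (auto simp: Chains_def relation_of_def P_def)
    show "\<exists>u\<in>Q. \<forall>a\<in>C. P a u"
    proof (cases "C = {}")
      case True
      then show ?thesis using z_sub[OF p] by (auto simp: Q_def z_def intro!: bexI[of _ "z p"])
    next
      case False
      define u where "u x = (if x \<in> V then INF q\<in>C. q x else 0)" for x
      have le: "u x \<le> q x" if "q \<in> C" "x \<in> V" for q x
        unfolding u_def using that lower CQ by (auto intro!: cINF_lower bdd_belowI2[of _ "- p (- x)"])
      have ge: "c \<le> u x" if "x \<in> V" "\<And>q. q \<in> C \<Longrightarrow> c \<le> q x" for c x
        unfolding u_def using that False by (auto intro!: cINF_greatest)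
      have sub: "sublinear_on V q" if "q \<in> C" for q using that CQ by (auto simp: Q_def)
      have "sublinear_on V u" unfolding sublinear_on_def
      proof (intro conjI ballI allI impI)
        fix x y assume xy: "x \<in> V" "y \<in> V"
        have xyV: "x + y \<in> V" using xy by (intro complex_vector.subspace_add[OF V])
        have *: "u (x + y) \<le> q x + r y" if qr: "q \<in> C" "r \<in> C" for q r
          using tot[OF qr]
        proof
          assume "q \<le> r"
          then have "q y \<le> r y" by (simp add: le_fun_def)
          then show ?thesis
            using le[OF qr(1) xyV] sublinear_on_add[OF sub[OF qr(1)] xy] by linarith
        next
          assume "r \<le> q"
          then have "r x \<le> q x" by (simp add: le_fun_def)
          then show ?thesis
            using le[OF qr(2) xyV] sublinear_on_add[OF sub[OF qr(2)] xy] by linarith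
        qed
        have "u (x + y) - r y \<le> u x" if "r \<in> C" for r
          using *[OF _ that] by (intro ge xy) (simp add: algebra_simps)
        then have "u (x + y) - u x \<le> u y" by (intro ge xy) (simp add: algebra_simps)
        then show "u (x + y) \<le> u x + u y" by simp
      next
        fix x t assume x: "x \<in> V" and t: "(0::real) \<le> t"
        have tx: "of_real t *\<^sub>C x \<in> V" using x by (intro complex_vector.subspace_scale[OF V])
        have *: "u (of_real t *\<^sub>C x) \<le> t * q x" if "q \<in> C" for q
          using le[OF that tx] sublinear_on_scale_le[OF sub[OF that] x t] by linarith
        show "u (of_real t *\<^sub>C x) \<le> t * u x"
        proof (cases "t = 0")
          case True
          then show ?thesis using * False by auto
        next
          case F: False
          then have "u (of_real t *\<^sub>C x) / t \<le> u x"
            using * t by (intro ge x) (simp add: field_simps)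
          then show ?thesis using F t by (simp add: field_simps)
        qed
      qed
      moreover have "\<forall>x\<in>V. u x \<le> p x"
      proof
        fix x assume x: "x \<in> V"
        obtain q where q: "q \<in> C" using False by auto
        have "q x \<le> p x" using q CQ x by (auto simp: Q_def)
        then show "u x \<le> p x" using le[OF q x] by linarith
      qed
      ultimately have "u \<in> Q" by (simp add: Q_def u_def)
      moreover have "\<forall>q\<in>C. P q u"
      proof
        fix q assume q: "q \<in> C"
        have "u x \<le> q x" for x
          using le[OF q] q CQ by (cases "x \<in> V") (auto simp: u_def Q_def)
        then show "P q u" by (simp add: P_def le_fun_def)
      qed
      ultimately show ?thesis by blast
    qed
  qed
  then obtain q where q: "q \<in> Q" and min: "\<And>r. r \<in> Q \<Longrightarrow> r \<le> q \<Longrightarrow> r = q"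
    by (auto simp: P_def)
  show ?thesis
  proof (intro exI[of _ q] conjI allI impI ballI)
    show "sublinear_on V q" "\<And>x. x \<in> V \<Longrightarrow> q x \<le> p x" using q by (auto simp: Q_def)
    fix r x assume r: "sublinear_on V r" "\<forall>x\<in>V. r x \<le> q x" and x: "x \<in> V"
    have "r x \<le> p x" if "x \<in> V" for x
      using r(2) q that by (force simp: Q_def)
    then have "z r \<in> Q" using z_sub[OF r(1)] by (simp add: Q_def z_def)
    moreover have "z r \<le> q" using r q by (auto simp: z_def le_fun_def Q_def)
    ultimately have "z r = q" by (rule min)
    then show "r x = q x" using x by (auto simp: z_def)
  qed
qed

lemma sublinear_dominates_additive:
  assumes p: "sublinear_on V p"
  shows "\<exists>f. (\<forall>x\<in>V. \<forall>y\<in>V. f (x + y) = f x + f y) \<and>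
    (\<forall>x\<in>V. \<forall>t. f (of_real t *\<^sub>C x) = t * f x) \<and> (\<forall>x\<in>V. f x \<le> p x)"
proof -
  obtain q where q: "sublinear_on V q" "\<And>x. x \<in> V \<Longrightarrow> q x \<le> p x"
    and min: "\<And>r. sublinear_on V r \<Longrightarrow> \<forall>x\<in>V. r x \<le> q x \<Longrightarrow> \<forall>x\<in>V. r x = q x"
    using exists_minimal_sublinear[OF p] by blast
  have add: "q (x + y) = q x + q y" if xy: "x \<in> V" "y \<in> V" for x y
  proof -
    have "\<forall>u\<in>V. steepen q y u \<le> q u"
      using steepen_le[OF q(1) xy(2), of _ 0] by simp
    then have "steepen q y x = q x"
      using min[OF sublinear_on_steepen[OF q(1) xy(2)]] xy(1) by blast
    then have "q x \<le> q (x + y) - q y"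
      using steepen_le[OF q(1) xy(2,1), of 1] by (simp add: scaleC_one)
    then show ?thesis using sublinear_on_add[OF q(1) xy] by simp
  qed
  have neg: "q (- x) = - q x" if "x \<in> V" for x
    using add[OF that, of "- x"] sublinear_on_zero[OF q(1)] complex_vector.subspace_neg[OF V that] by simp
  have scale: "q (of_real t *\<^sub>C x) = t * q x" if x: "x \<in> V" for x t
  proof (cases "0 \<le> t")
    case True
    then show ?thesis using sublinear_on_scale[OF q(1) x] by simp
  next
    case False
    have e: "of_real t *\<^sub>C x = - (of_real (- t) *\<^sub>C x)" by simp
    have "q (of_real (- t) *\<^sub>C x) = (- t) * q x"
      by (rule sublinear_on_scale[OF q(1) x]) (use False in simp)
    moreover have "q (of_real t *\<^sub>C x) = - q (of_real (- t) *\<^sub>C x)"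
      by (subst e, rule neg, rule complex_vector.subspace_scale[OF V x])
    ultimately show ?thesis by simp
  qed
  show ?thesis using add scale q(2) by blast
qed

text \<open>A linear functional below the steepening of \<open>W\<close> along \<open>x0\<close> is at most \<open>- W x0\<close> at \<open>- x0\<close>, so it
  attains \<open>W x0\<close> at \<open>x0\<close>. The real functional \<open>f\<close> is the real part of \<open>g x = f x - \<i> f (\<i> x)\<close>.\<close>

theorem hahn_banach_seminorm:
  fixes W :: "'a \<Rightarrow> real"
  assumes tri: "\<And>x y. x \<in> V \<Longrightarrow> y \<in> V \<Longrightarrow> W (x + y) \<le> W x + W y"
    and hom: "\<And>a x. x \<in> V \<Longrightarrow> W (a *\<^sub>C x) = cmod a * W x"
    and x0: "x0 \<in> V"
  shows "\<exists>g. (\<forall>x\<in>V. \<forall>y\<in>V. g (x + y) = g x + g y) \<and> (\<forall>x\<in>V. \<forall>a. g (a *\<^sub>C x) = a * g x) \<and>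
    (\<forall>x\<in>V. cmod (g x) \<le> W x) \<and> g x0 = of_real (W x0)"
proof -
  have W: "sublinear_on V W" by (auto simp: sublinear_on_def tri hom)
  obtain f where f: "\<forall>x\<in>V. \<forall>y\<in>V. f (x + y) = f x + f y"
    "\<forall>x\<in>V. \<forall>t. f (of_real t *\<^sub>C x) = t * f x" "\<forall>x\<in>V. f x \<le> steepen W x0 x"
    using sublinear_dominates_additive[OF sublinear_on_steepen[OF W x0]] by blast
  note add = f(1)[rule_format] and scale = f(2)[rule_format] and le = f(3)[rule_format]
  have fW: "f x \<le> W x" if "x \<in> V" for x
    using le[OF that] steepen_le[OF W x0 that, of 0] by simp
  have nx0: "- x0 \<in> V" using x0 by (rule complex_vector.subspace_neg[OF V])
  have "f (- x0) = - f x0" using scale[OF x0, of "-1"] by (simp add: scaleC_one)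
  moreover have "f (- x0) \<le> - W x0"
    using le[OF nx0] steepen_le[OF W x0 nx0, of 1] sublinear_on_zero[OF W] by (simp add: scaleC_one)
  ultimately have fx0: "f x0 = W x0" using fW[OF x0] by simp
  define g where "g x = Complex (f x) (- f (\<i> *\<^sub>C x))" for x
  have sc: "a *\<^sub>C x \<in> V" if "x \<in> V" for a x using that by (rule complex_vector.subspace_scale[OF V])
  have fc: "f (a *\<^sub>C x) = Re a * f x + Im a * f (\<i> *\<^sub>C x)" if x: "x \<in> V" for a x
  proof -
    have "a *\<^sub>C x = of_real (Re a) *\<^sub>C x + of_real (Im a) *\<^sub>C (\<i> *\<^sub>C x)"
      unfolding scaleC_scaleC scaleC_add_left[symmetric]
      by (metis complex_eq mult.commute)
    then have "f (a *\<^sub>C x) = f (of_real (Re a) *\<^sub>C x) + f (of_real (Im a) *\<^sub>C (\<i> *\<^sub>C x))"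
      using x by (simp only: add sc)
    then show ?thesis using x by (simp only: scale sc)
  qed
  have gscale: "g (a *\<^sub>C x) = a * g x" if x: "x \<in> V" for a x
  proof -
    have "f (\<i> *\<^sub>C a *\<^sub>C x) = Re (\<i> * a) * f x + Im (\<i> * a) * f (\<i> *\<^sub>C x)"
      unfolding scaleC_scaleC by (rule fc[OF x])
    then have "g (a *\<^sub>C x) = Complex (Re a * f x + Im a * f (\<i> *\<^sub>C x)) (Im a * f x - Re a * f (\<i> *\<^sub>C x))"
      unfolding g_def fc[OF x, of a] by simp
    also have "\<dots> = a * g x" by (simp add: g_def complex_eq_iff algebra_simps)
    finally show ?thesis .
  qed
  have gle: "cmod (g x) \<le> W x" if x: "x \<in> V" for x
  proof (cases "g x = 0")
    case True
    have "0 \<le> W x"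
    proof -
      have "W (0 *\<^sub>C x) = 0" using hom[OF x, of 0] by simp
      moreover have "W (x + (-1) *\<^sub>C x) \<le> W x + W ((-1) *\<^sub>C x)" using x sc by (intro tri)
      ultimately show ?thesis using hom[OF x, of "-1"] by (simp add: scaleC_one)
    qed
    then show ?thesis using True by simp
  next
    case False
    \<comment> \<open>Rotating \<open>x\<close> makes the value of \<open>g\<close> real, where it is controlled by \<open>f\<close>.\<close>
    define c where "c = cnj (g x) / cmod (g x)"
    have c: "cmod c = 1" using False by (simp add: c_def norm_divide)
    have "cnj (g x) * g x = of_real ((cmod (g x))\<^sup>2)"
      by (metis complex_norm_square mult.commute)
    then have "c * g x = of_real ((cmod (g x))\<^sup>2) / of_real (cmod (g x))"
      by (simp only: c_def times_divide_eq_left)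
    then have "c * g x = cmod (g x)" using False by (simp add: power2_eq_square)
    then have "g (c *\<^sub>C x) = cmod (g x)" using gscale[OF x] by simp
    then have "cmod (g x) = f (c *\<^sub>C x)" by (metis complex.sel(1) g_def Re_complex_of_real)
    also have "\<dots> \<le> W (c *\<^sub>C x)" using x by (intro fW sc)
    finally show ?thesis using c hom[OF x] by simp
  qed
  have "g x0 = of_real (W x0)"
  proof -
    have "Re (g x0) = W x0" by (simp add: g_def fx0)
    moreover have "cmod (g x0) \<le> W x0" by (rule gle[OF x0])
    ultimately have "(Re (g x0))\<^sup>2 + (Im (g x0))\<^sup>2 \<le> (Re (g x0))\<^sup>2"
      by (metis cmod_power2 norm_ge_zero power_mono)
    then have "Im (g x0) = 0" by simp
    then show ?thesis using \<open>Re (g x0) = W x0\<close> by (simp add: complex_eq_iff)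
  qed
  moreover have "g (x + y) = g x + g y" if "x \<in> V" "y \<in> V" for x y
    using that by (simp add: g_def add sc scaleC_add_right complex_eq_iff)
  ultimately show ?thesis using gscale gle by blast
qed

end

section \<open>Normed spaces with a carrier, and their duals\<close>

lemma sum_fun_apply: "(\<Sum>i\<in>I. f i) x = (\<Sum>i\<in>I. f i x)"
  by (induction I rule: infinite_finite_induct) auto

locale normed_carrier =
  fixes S :: "'a::complex_vector nspace"
  assumes subspace: "complex_vector.subspace (carrier_of S)"
    and norm_triangle: "\<lbrakk>x \<in> carrier_of S; y \<in> carrier_of S\<rbrakk> \<Longrightarrow> norm_of S (x + y) \<le> norm_of S x + norm_of S y"
    and norm_scale: "x \<in> carrier_of S \<Longrightarrow> norm_of S (a *\<^sub>C x) = cmod a * norm_of S x"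
    and norm_pos: "\<lbrakk>x \<in> carrier_of S; x \<noteq> 0\<rbrakk> \<Longrightarrow> 0 < norm_of S x"

lemma normed_carrier_scalars: "normed_carrier scalars"
  by unfold_locales
    (auto simp: scalars_def complex_vector.subspace_def norm_mult norm_triangle_ineq scaleC_complex_def)

context
  fixes S :: "'a::complex_vector nspace" and T :: "'b::complex_vector nspace" and f
  assumes f: "f \<in> bounded_ops S T"
begin

lemma bounded_ops_mem: "x \<in> carrier_of S \<Longrightarrow> f x \<in> carrier_of T"
  using f by (simp add: bounded_ops_def)

lemma bounded_ops_add: "\<lbrakk>x \<in> carrier_of S; y \<in> carrier_of S\<rbrakk> \<Longrightarrow> f (x + y) = f x + f y"
  using f by (simp add: bounded_ops_def)

lemma bounded_ops_scale: "x \<in> carrier_of S \<Longrightarrow> f (a *\<^sub>C x) = a *\<^sub>C f x"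
  using f by (simp add: bounded_ops_def)

lemma bounded_ops_outside: "x \<notin> carrier_of S \<Longrightarrow> f x = 0"
  using f by (simp add: bounded_ops_def)

lemma bounded_ops_bound: "\<exists>C. \<forall>x\<in>carrier_of S. norm_of T (f x) \<le> C * norm_of S x"
  using f by (simp add: bounded_ops_def)

end

lemma bounded_opsI:
  assumes "\<And>x. x \<in> carrier_of S \<Longrightarrow> f x \<in> carrier_of T"
    and "\<And>x y. \<lbrakk>x \<in> carrier_of S; y \<in> carrier_of S\<rbrakk> \<Longrightarrow> f (x + y) = f x + f y"
    and "\<And>a x. x \<in> carrier_of S \<Longrightarrow> f (a *\<^sub>C x) = a *\<^sub>C f x"
    and "\<And>x. x \<in> carrier_of S \<Longrightarrow> norm_of T (f x) \<le> C * norm_of S x"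
    and "\<And>x. x \<notin> carrier_of S \<Longrightarrow> f x = 0"
  shows "f \<in> bounded_ops S T"
  using assms unfolding bounded_ops_def by blast

context normed_carrier
begin

abbreviation X where "X \<equiv> carrier_of S"
abbreviation N where "N \<equiv> norm_of S"

lemma zero_mem [simp]: "0 \<in> X" by (rule complex_vector.subspace_0[OF subspace])
lemma add_mem: "x \<in> X \<Longrightarrow> y \<in> X \<Longrightarrow> x + y \<in> X" by (rule complex_vector.subspace_add[OF subspace])
lemma scale_mem: "x \<in> X \<Longrightarrow> a *\<^sub>C x \<in> X" by (rule complex_vector.subspace_scale[OF subspace])
lemma diff_mem: "x \<in> X \<Longrightarrow> y \<in> X \<Longrightarrow> x - y \<in> X" by (rule complex_vector.subspace_diff[OF subspace])
lemma neg_mem: "x \<in> X \<Longrightarrow> - x \<in> X" by (rule complex_vector.subspace_neg[OF subspace])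
lemma sum_mem: "(\<And>i. i \<in> I \<Longrightarrow> x i \<in> X) \<Longrightarrow> (\<Sum>i\<in>I. x i) \<in> X"
  by (rule complex_vector.subspace_sum[OF subspace])

lemma norm_zero [simp]: "N 0 = 0" using norm_scale[OF zero_mem, of 0] by simp
lemma norm_nonneg: "x \<in> X \<Longrightarrow> 0 \<le> N x" using norm_pos[of x] by (cases "x = 0") auto

lemma norm_minus: "x \<in> X \<Longrightarrow> N (- x) = N x" using norm_scale[of x "-1"] by (simp add: scaleC_one)
lemma norm_diff: "x \<in> X \<Longrightarrow> y \<in> X \<Longrightarrow> N (x - y) \<le> N x + N y"
  using norm_triangle[of x "-y"] by (simp add: norm_minus neg_mem)

lemma norm_le_diff: "x \<in> X \<Longrightarrow> y \<in> X \<Longrightarrow> N x \<le> N y + N (x - y)"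
  using norm_triangle[of y "x - y"] by (simp add: diff_mem)
lemma norm_sum: "(\<And>i. i \<in> I \<Longrightarrow> x i \<in> X) \<Longrightarrow> N (\<Sum>i\<in>I. x i) \<le> (\<Sum>i\<in>I. N (x i))"
proof (induction I rule: infinite_finite_induct)
  case (insert i I)
  have "N (x i + (\<Sum>i\<in>I. x i)) \<le> N (x i) + N (\<Sum>i\<in>I. x i)"
    using insert by (intro norm_triangle sum_mem) auto
  also have "\<dots> \<le> N (x i) + (\<Sum>i\<in>I. N (x i))" using insert by auto
  finally show ?case using insert by simp
qed auto

lemma bounded_ops_zero: "f \<in> bounded_ops S T \<Longrightarrow> f 0 = 0"
  using bounded_ops_scale[of f S T 0 0] by simp

lemma bounded_ops_diff: "f \<in> bounded_ops S T \<Longrightarrow> x \<in> X \<Longrightarrow> y \<in> X \<Longrightarrow> f (x - y) = f x - f y"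
  using bounded_ops_add[of f S T x "(-1) *\<^sub>C y"] bounded_ops_scale[of f S T y "-1"]
  by (simp add: scale_mem scaleC_one neg_mem)

lemma bounded_ops_sum:
  assumes f: "f \<in> bounded_ops S T" and "\<And>i. i \<in> I \<Longrightarrow> x i \<in> X"
  shows "f (\<Sum>i\<in>I. x i) = (\<Sum>i\<in>I. f (x i))"
  using assms(2)
proof (induction I rule: infinite_finite_induct)
  case (insert i I)
  then show ?case by (simp add: bounded_ops_add[OF f] sum_mem)
qed (auto simp: bounded_ops_zero[OF f])

lemma bounded_ops_linear_sum:
  assumes f: "f \<in> bounded_ops S T" and "\<And>i. i \<in> I \<Longrightarrow> x i \<in> X"
  shows "f (\<Sum>i\<in>I. c i *\<^sub>C x i) = (\<Sum>i\<in>I. c i *\<^sub>C f (x i))"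
  using assms by (simp add: bounded_ops_sum[OF f] scale_mem bounded_ops_scale[OF f])

lemma op_norm_le:
  assumes "0 \<le> C" "\<And>x. x \<in> X \<Longrightarrow> norm_of T (f x) \<le> C * N x"
  shows "op_norm S T f \<le> C"
  unfolding op_norm_def
proof (rule cSUP_least)
  show "{x \<in> X. N x \<le> 1} \<noteq> {}" by (auto intro!: exI[of _ 0])
  fix x assume "x \<in> {x \<in> X. N x \<le> 1}"
  then show "norm_of T (f x) \<le> C" using assms(2)[of x] mult_left_mono[of "N x" 1 C] assms(1) by auto
qed

lemma
  assumes T: "normed_carrier T" and f: "f \<in> bounded_ops S T"
  shows op_norm_bound: "x \<in> X \<Longrightarrow> norm_of T (f x) \<le> op_norm S T f * N x"
    and op_norm_nonneg: "0 \<le> op_norm S T f"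
proof -
  interpret T: normed_carrier T by fact
  obtain C where C: "\<And>x. x \<in> X \<Longrightarrow> norm_of T (f x) \<le> C * N x" using bounded_ops_bound[OF f] by blast
  have bdd: "bdd_above ((\<lambda>x. norm_of T (f x)) ` {x \<in> X. N x \<le> 1})"
  proof (rule bdd_aboveI2)
    fix x assume x: "x \<in> {x \<in> X. N x \<le> 1}"
    have "norm_of T (f x) \<le> C * N x" using C x by auto
    also have "\<dots> \<le> \<bar>C\<bar> * N x" using x by (intro mult_right_mono) (auto simp: norm_nonneg)
    also have "\<dots> \<le> \<bar>C\<bar> * 1" using x by (intro mult_left_mono) auto
    finally show "norm_of T (f x) \<le> \<bar>C\<bar>" by simp
  qed
  have le: "norm_of T (f x) \<le> op_norm S T f" if "x \<in> X" "N x \<le> 1" for x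
    unfolding op_norm_def using that by (intro cSUP_upper bdd) auto
  show "0 \<le> op_norm S T f" using le[of 0] by (simp add: bounded_ops_zero[OF f])
  show "norm_of T (f x) \<le> op_norm S T f * N x" if x: "x \<in> X" for x
  proof (cases "x = 0")
    case True
    then show ?thesis by (simp add: bounded_ops_zero[OF f])
  next
    case False
    then have pos: "0 < N x" using x norm_pos by blast
    have "norm_of T (f (complex_of_real (1 / N x) *\<^sub>C x)) \<le> op_norm S T f"
      using pos x by (intro le scale_mem) (auto simp: norm_scale norm_divide)
    then show ?thesis using pos x
      by (simp add: bounded_ops_scale[OF f] T.norm_scale bounded_ops_mem[OF f] norm_divide field_simps)
  qed
qed

lemma bounded_ops_minus_op:
  assumes T: "normed_carrier T" and f: "f \<in> bounded_ops S T" and g: "g \<in> bounded_ops S T"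
  shows "f - g \<in> bounded_ops S T"
proof -
  interpret T: normed_carrier T by fact
  show ?thesis
  proof (rule bounded_opsI[where C = "op_norm S T f + op_norm S T g"])
    fix x assume x: "x \<in> X"
    have "norm_of T ((f - g) x) \<le> norm_of T (f x) + norm_of T (g x)"
      using x by (simp add: T.norm_diff bounded_ops_mem[OF f] bounded_ops_mem[OF g])
    then show "norm_of T ((f - g) x) \<le> (op_norm S T f + op_norm S T g) * N x"
      using op_norm_bound[OF T f x] op_norm_bound[OF T g x] by (simp add: distrib_right)
  qed (auto simp: bounded_ops_add[OF f] bounded_ops_add[OF g] bounded_ops_scale[OF f]
      bounded_ops_scale[OF g] bounded_ops_outside[OF f] bounded_ops_outside[OF g]
      bounded_ops_mem[OF f] bounded_ops_mem[OF g] complex_vector.scale_right_diff_distrib T.diff_mem)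
qed

abbreviation X' where "X' \<equiv> carrier_of (dual S)"
abbreviation N' where "N' \<equiv> norm_of (dual S)"

lemma dual_mem_iff: "g \<in> X' \<longleftrightarrow> g \<in> bounded_ops S scalars"
  by (simp add: dual_def)

lemma dual_norm_def: "N' = op_norm S scalars"
  by (simp add: dual_def)

lemma
  assumes g: "g \<in> X'"
  shows functional_add: "x \<in> X \<Longrightarrow> y \<in> X \<Longrightarrow> g (x + y) = g x + g y"
    and functional_diff: "x \<in> X \<Longrightarrow> y \<in> X \<Longrightarrow> g (x - y) = g x - g y"
    and functional_scale: "x \<in> X \<Longrightarrow> g (a *\<^sub>C x) = a * g x"
    and functional_zero: "g 0 = 0"
    and functional_outside: "x \<notin> X \<Longrightarrow> g x = 0"
    and functional_sum: "(\<And>i. i \<in> I \<Longrightarrow> u i \<in> X) \<Longrightarrow> g (\<Sum>i\<in>I. c i *\<^sub>C u i) = (\<Sum>i\<in>I. c i * g (u i))"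
    and functional_bound: "x \<in> X \<Longrightarrow> cmod (g x) \<le> N' g * N x"
proof -
  from g have b: "g \<in> bounded_ops S scalars" by (simp add: dual_mem_iff)
  show "x \<in> X \<Longrightarrow> y \<in> X \<Longrightarrow> g (x + y) = g x + g y" by (rule bounded_ops_add[OF b])
  show "x \<in> X \<Longrightarrow> y \<in> X \<Longrightarrow> g (x - y) = g x - g y" by (rule bounded_ops_diff[OF b])
  show "x \<in> X \<Longrightarrow> g (a *\<^sub>C x) = a * g x" using bounded_ops_scale[OF b] by (simp add: scaleC_complex_def)
  show "g 0 = 0" by (rule bounded_ops_zero[OF b])
  show "x \<notin> X \<Longrightarrow> g x = 0" by (rule bounded_ops_outside[OF b])
  show "(\<And>i. i \<in> I \<Longrightarrow> u i \<in> X) \<Longrightarrow> g (\<Sum>i\<in>I. c i *\<^sub>C u i) = (\<Sum>i\<in>I. c i * g (u i))"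
    using bounded_ops_linear_sum[OF b, of I u c] by (simp add: scaleC_complex_def)
  show "x \<in> X \<Longrightarrow> cmod (g x) \<le> N' g * N x"
    using op_norm_bound[OF normed_carrier_scalars b] by (simp add: dual_def scalars_def)
qed

lemma functional_norm_le:
  assumes "0 \<le> C" "\<And>x. x \<in> X \<Longrightarrow> cmod (g x) \<le> C * N x"
  shows "N' g \<le> C"
  unfolding dual_norm_def using assms by (intro op_norm_le) (auto simp: scalars_def)

lemma functionalI:
  assumes "\<And>x y. \<lbrakk>x \<in> X; y \<in> X\<rbrakk> \<Longrightarrow> g (x + y) = g x + g y"
    and "\<And>a x. x \<in> X \<Longrightarrow> g (a *\<^sub>C x) = a * g x"
    and "\<And>x. x \<in> X \<Longrightarrow> cmod (g x) \<le> C * N x"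
    and "\<And>x. x \<notin> X \<Longrightarrow> g x = 0"
  shows "g \<in> X'"
  unfolding dual_mem_iff using assms
  by (intro bounded_opsI[where C = C]) (auto simp: scalars_def scaleC_complex_def)

lemma functional_norming:
  assumes g: "g \<in> X'" and c: "c < N' g"
  obtains x where "x \<in> X" "N x \<le> 1" "c < cmod (g x)"
proof -
  have "\<exists>y\<in>(\<lambda>x. cmod (g x)) ` {x \<in> X. N x \<le> 1}. c < y"
  proof (rule less_cSupD)
    show "(\<lambda>x. cmod (g x)) ` {x \<in> X. N x \<le> 1} \<noteq> {}" by (auto intro!: exI[of _ 0])
    show "c < Sup ((\<lambda>x. cmod (g x)) ` {x \<in> X. N x \<le> 1})"
      using c by (simp add: dual_norm_def op_norm_def scalars_def)
  qed
  then show thesis using that by auto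
qed

text \<open>Hence every result about normed carriers also holds for the dual space.\<close>

lemma normed_carrier_dual: "normed_carrier (dual S)"
proof
  have sc: "(a *\<^sub>C g) \<in> X'" if g: "g \<in> X'" for a g
  proof (rule functionalI[where C = "cmod a * N' g"])
    fix x assume "x \<in> X"
    then show "cmod ((a *\<^sub>C g) x) \<le> cmod a * N' g * N x"
      using mult_left_mono[OF functional_bound[OF g, of x], of "cmod a"]
      by (simp add: scaleC_fun_def scaleC_complex_def norm_mult mult.assoc)
  qed (simp_all add: g scaleC_fun_def scaleC_complex_def functional_add[OF g] functional_scale[OF g]
        functional_outside[OF g] distrib_left mult.left_commute)
  have ad: "g + h \<in> X'" if "g \<in> X'" "h \<in> X'" for g h
  proof (rule functionalI[where C = "N' g + N' h"])
    fix x assume "x \<in> X"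
    then show "cmod ((g + h) x) \<le> (N' g + N' h) * N x"
      using norm_triangle_ineq[of "g x" "h x"] functional_bound[OF that(1)] functional_bound[OF that(2)]
      by (fastforce simp: distrib_right)
  qed (use that in \<open>auto simp: functional_add functional_scale functional_outside algebra_simps\<close>)
  have nn: "0 \<le> N' g" if "g \<in> X'" for g
    unfolding dual_norm_def using that by (intro op_norm_nonneg normed_carrier_scalars) (simp add: dual_mem_iff)
  have z: "0 \<in> X'" by (rule functionalI[where C = 0]) auto
  show "complex_vector.subspace X'"
    using sc ad z by (simp add: complex_vector.subspace_def)
  show "N' (g + h) \<le> N' g + N' h" if "g \<in> X'" "h \<in> X'" for g h
  proof (rule functional_norm_le)
    show "0 \<le> N' g + N' h" using that nn by simp
    fix x assume "x \<in> X"
    then show "cmod ((g + h) x) \<le> (N' g + N' h) * N x"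
      using norm_triangle_ineq[of "g x" "h x"] functional_bound[OF that(1)] functional_bound[OF that(2)]
      by (fastforce simp: distrib_right)
  qed
  have le: "N' (a *\<^sub>C g) \<le> cmod a * N' g" if "g \<in> X'" for a g
    by (rule functional_norm_le)
      (use that nn in \<open>auto simp: scaleC_fun_def scaleC_complex_def norm_mult mult.assoc intro!: mult_left_mono functional_bound\<close>)
  show "N' (a *\<^sub>C g) = cmod a * N' g" if g: "g \<in> X'" for a g
  proof (cases "a = 0")
    case True
    have "N' (0 *\<^sub>C g) = 0" using le[OF g, of 0] nn[OF sc[OF g, of 0]] by simp
    then show ?thesis using True by simp
  next
    case False
    have "N' ((1 / a) *\<^sub>C (a *\<^sub>C g)) \<le> cmod (1 / a) * N' (a *\<^sub>C g)" by (intro le sc g)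
    moreover have "(1 / a) *\<^sub>C (a *\<^sub>C g) = g" using False by (simp add: scaleC_one)
    ultimately have "N' g \<le> cmod (1 / a) * N' (a *\<^sub>C g)" by simp
    then have "cmod a * N' g \<le> N' (a *\<^sub>C g)" using False by (simp add: norm_divide field_simps)
    then show ?thesis using le[OF g, of a] by simp
  qed
  show "0 < N' g" if g: "g \<in> X'" "g \<noteq> 0" for g
  proof -
    obtain x where "g x \<noteq> 0" using g(2) by (auto simp: fun_eq_iff)
    then have x: "x \<in> X" "0 < cmod (g x)" using functional_outside[OF g(1)] by auto
    then have "0 < N' g * N x" using functional_bound[OF g(1) x(1)] by linarith
    then show ?thesis using norm_nonneg[OF x(1)] by (simp add: zero_less_mult_iff)
  qed
qed

lemma adjoint_op_mem:
  assumes "\<And>x. x \<in> X \<Longrightarrow> A x \<in> X"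
    and "\<And>x y. \<lbrakk>x \<in> X; y \<in> X\<rbrakk> \<Longrightarrow> A (x + y) = A x + A y"
    and "\<And>a x. x \<in> X \<Longrightarrow> A (a *\<^sub>C x) = a *\<^sub>C A x"
    and "\<And>x. x \<in> X \<Longrightarrow> N (A x) \<le> C * N x" and g: "g \<in> X'"
  shows "adjoint_op S A g \<in> X'"
proof (rule functionalI[where C = "N' g * C"])
  interpret D: normed_carrier "dual S" by (rule normed_carrier_dual)
  fix x assume x: "x \<in> X"
  have "cmod (g (A x)) \<le> N' g * N (A x)" by (intro functional_bound g assms x)
  also have "\<dots> \<le> N' g * (C * N x)" by (intro mult_left_mono assms x D.norm_nonneg g)
  finally show "cmod (adjoint_op S A g x) \<le> N' g * C * N x" using x by (simp add: adjoint_op_def)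
qed (use assms in \<open>auto simp: adjoint_op_def add_mem scale_mem functional_add functional_scale\<close>)

lemma adjoint_op_bounded:
  assumes A: "A \<in> bounded_ops S S"
  shows "(\<lambda>g. if g \<in> X' then adjoint_op S A g else 0) \<in> bounded_ops (dual S) (dual S)"
    and "g \<in> X' \<Longrightarrow> adjoint_op S A g \<in> X'"
    and "g \<in> X' \<Longrightarrow> N' (adjoint_op S A g) \<le> op_norm S S A * N' g"
proof -
  interpret D: normed_carrier "dual S" by (rule normed_carrier_dual)
  have S: "normed_carrier S" ..
  show mem: "adjoint_op S A g \<in> X'" if "g \<in> X'" for g
    by (rule adjoint_op_mem[where C = "op_norm S S A"])
      (use A that in \<open>auto simp: bounded_ops_mem bounded_ops_add bounded_ops_scale op_norm_bound[OF S]\<close>)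
  show le: "N' (adjoint_op S A g) \<le> op_norm S S A * N' g" if g: "g \<in> X'" for g
  proof (rule functional_norm_le)
    show "0 \<le> op_norm S S A * N' g" using op_norm_nonneg[OF S A] D.norm_nonneg[OF g] by simp
    fix x assume x: "x \<in> X"
    have "cmod (g (A x)) \<le> N' g * N (A x)" using x by (intro functional_bound g bounded_ops_mem[OF A])
    also have "\<dots> \<le> N' g * (op_norm S S A * N x)"
      by (intro mult_left_mono D.norm_nonneg g op_norm_bound[OF S A] x)
    finally show "cmod (adjoint_op S A g x) \<le> op_norm S S A * N' g * N x"
      using x by (simp add: adjoint_op_def mult_ac)
  qed
  show "(\<lambda>g. if g \<in> X' then adjoint_op S A g else 0) \<in> bounded_ops (dual S) (dual S)"
  proof (rule bounded_opsI[where C = "op_norm S S A"])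
    fix g h assume g: "g \<in> X'" and h: "h \<in> X'"
    have "adjoint_op S A (g + h) = adjoint_op S A g + adjoint_op S A h"
      by (simp add: adjoint_op_def fun_eq_iff)
    then show "(if g + h \<in> X' then adjoint_op S A (g + h) else 0)
        = (if g \<in> X' then adjoint_op S A g else 0) + (if h \<in> X' then adjoint_op S A h else 0)"
      using g h D.add_mem[OF g h] by simp
  next
    fix a g assume g: "g \<in> X'"
    have "adjoint_op S A (a *\<^sub>C g) = a *\<^sub>C adjoint_op S A g"
      by (simp add: adjoint_op_def fun_eq_iff scaleC_fun_def scaleC_complex_def)
    then show "(if a *\<^sub>C g \<in> X' then adjoint_op S A (a *\<^sub>C g) else 0)
        = a *\<^sub>C (if g \<in> X' then adjoint_op S A g else 0)"
      using g D.scale_mem[OF g] by simp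
  qed (simp_all add: mem le)
qed

section \<open>Operators whose adjoint is bounded below\<close>

lemma functional_below_seminorm:
  assumes tri: "\<And>x y. x \<in> X \<Longrightarrow> y \<in> X \<Longrightarrow> W (x + y) \<le> W x + W y"
    and hom: "\<And>a x. x \<in> X \<Longrightarrow> W (a *\<^sub>C x) = cmod a * W x"
    and bound: "\<And>x. x \<in> X \<Longrightarrow> W x \<le> C * N x"
    and x0: "x0 \<in> X"
  shows "\<exists>g\<in>X'. (\<forall>x\<in>X. cmod (g x) \<le> W x) \<and> g x0 = of_real (W x0)"
proof -
  obtain h where h: "\<forall>x\<in>X. \<forall>y\<in>X. h (x + y) = h x + h y"
    "\<forall>x\<in>X. \<forall>a. h (a *\<^sub>C x) = a * h x" "\<forall>x\<in>X. cmod (h x) \<le> W x"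
    "h x0 = of_real (W x0)"
    using hahn_banach_seminorm[OF subspace, of W x0] tri hom x0 by blast
  show ?thesis
  proof (intro bexI[of _ "\<lambda>x. if x \<in> X then h x else 0"] conjI)
    show "(\<lambda>x. if x \<in> X then h x else 0) \<in> X'"
      using h bound by (intro functionalI[where C = C]) (auto simp: add_mem scale_mem intro: order_trans)
  qed (use h x0 in auto)
qed

text \<open>The hypothesis says that the adjoint of \<open>T\<close> is bounded below by \<open>\<delta>\<close>, but only as far as
  functionals are seen by \<open>z\<close>. The seminorm \<open>W y = inf_x N x + b N (y - T x)\<close> measures how well \<open>T x = y\<close>
  can be solved. A functional below \<open>W\<close> is bounded by \<open>1\<close> after composition with \<open>T\<close>, so the
  Hahn-Banach functional that attains \<open>W z\<close> gives \<open>W z \<le> N z / \<delta>\<close>.\<close>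

lemma approximate_solution:
  assumes T: "T \<in> bounded_ops S S" and z: "z \<in> X" and \<delta>: "0 < \<delta>" and \<eta>: "0 < \<eta>"
    and below: "\<And>g. \<lbrakk>g \<in> X'; \<And>x. x \<in> X \<Longrightarrow> cmod (g (T x)) \<le> N x\<rbrakk> \<Longrightarrow> cmod (g z) \<le> N z / \<delta>"
  obtains x where "x \<in> X" "N x \<le> N z / \<delta> + \<eta>" "N (z - T x) \<le> \<eta>"
proof -
  define K where "K = N z / \<delta> + \<eta>"
  have K: "K > 0" unfolding K_def using norm_nonneg[OF z] \<delta> \<eta> by (simp add: add_nonneg_pos)
  \<comment> \<open>A weight so large that total cost \<open>K\<close> leaves an error of at most \<open>\<eta>\<close>.\<close>
  define b where "b = K / \<eta>"
  have b: "b > 0" using K \<eta> by (simp add: b_def)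
  define W where "W y = (INF x\<in>X. N x + b * N (y - T x))" for y
  have TX: "x \<in> X \<Longrightarrow> T x \<in> X" for x by (rule bounded_ops_mem[OF T])
  have pos: "0 \<le> N x + b * N (y - T x)" if "x \<in> X" "y \<in> X" for x y
    using that b TX by (intro add_nonneg_nonneg mult_nonneg_nonneg norm_nonneg diff_mem) auto
  have le: "W y \<le> N x + b * N (y - T x)" if "x \<in> X" "y \<in> X" for x y
    unfolding W_def using that pos by (intro cINF_lower bdd_belowI2[of _ 0]) auto
  have ge: "c \<le> W y" if "\<And>x. x \<in> X \<Longrightarrow> c \<le> N x + b * N (y - T x)" for c y
    unfolding W_def using that by (intro cINF_greatest) (auto intro: zero_mem)
  have tri: "W (u + v) \<le> W u + W v" if uv: "u \<in> X" "v \<in> X" for u v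
  proof -
    have *: "W (u + v) \<le> (N x + b * N (u - T x)) + (N y + b * N (v - T y))" if xy: "x \<in> X" "y \<in> X" for x y
    proof -
      have "W (u + v) \<le> N (x + y) + b * N (u + v - T (x + y))"
        using uv xy by (intro le add_mem)
      also have "u + v - T (x + y) = (u - T x) + (v - T y)"
        using xy by (simp add: bounded_ops_add[OF T])
      also have "N (x + y) + b * N \<dots> \<le> (N x + N y) + b * (N (u - T x) + N (v - T y))"
        using uv xy TX b by (intro add_mono mult_left_mono norm_triangle diff_mem) auto
      finally show ?thesis by (simp add: algebra_simps)
    qed
    have "W (u + v) - (N y + b * N (v - T y)) \<le> W u" if "y \<in> X" for y
      using *[OF _ that] by (intro ge) (simp add: algebra_simps)
    then have "W (u + v) - W u \<le> W v" by (intro ge) (simp add: algebra_simps)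
    then show ?thesis by simp
  qed
  have hle: "W (a *\<^sub>C u) \<le> cmod a * W u" if u: "u \<in> X" and a: "a \<noteq> 0" for a u
  proof -
    have "W (a *\<^sub>C u) / cmod a \<le> W u"
    proof (rule ge)
      fix x assume x: "x \<in> X"
      have "W (a *\<^sub>C u) \<le> N (a *\<^sub>C x) + b * N (a *\<^sub>C u - T (a *\<^sub>C x))"
        using u x by (intro le scale_mem)
      also have "a *\<^sub>C u - T (a *\<^sub>C x) = a *\<^sub>C (u - T x)"
        using x by (simp add: bounded_ops_scale[OF T] complex_vector.scale_right_diff_distrib)
      also have "N (a *\<^sub>C x) + b * N \<dots> = cmod a * (N x + b * N (u - T x))"
        unfolding norm_scale[OF x] norm_scale[OF diff_mem[OF u TX[OF x]]] by (simp add: algebra_simps)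
      finally show "W (a *\<^sub>C u) / cmod a \<le> N x + b * N (u - T x)" using a by (simp add: field_simps)
    qed
    then show ?thesis using a by (simp add: field_simps)
  qed
  have W0: "W 0 = 0"
  proof (rule antisym)
    show "W 0 \<le> 0" using le[of 0 0] by (simp add: bounded_ops_zero[OF T])
    show "0 \<le> W 0" by (rule ge, rule pos) simp_all
  qed
  have hom: "W (a *\<^sub>C u) = cmod a * W u" if u: "u \<in> X" for a u
  proof (cases "a = 0")
    case False
    have "W ((1 / a) *\<^sub>C (a *\<^sub>C u)) \<le> cmod (1 / a) * W (a *\<^sub>C u)"
      using False u by (intro hle scale_mem) auto
    moreover have "(1 / a) *\<^sub>C (a *\<^sub>C u) = u" using False by (simp add: scaleC_one)
    ultimately show ?thesis
      using hle[OF u False] False by (intro antisym) (auto simp: norm_divide field_simps)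
  qed (simp add: W0)
  have "W x \<le> b * N x" if "x \<in> X" for x using le[OF zero_mem that] by (simp add: bounded_ops_zero[OF T])
  then obtain g where g: "g \<in> X'" "\<forall>x\<in>X. cmod (g x) \<le> W x" "g z = of_real (W z)"
    using functional_below_seminorm[of W b z] tri hom z by blast
  have "cmod (g (T x)) \<le> N x" if "x \<in> X" for x
    using bspec[OF g(2) TX[OF that]] le[OF that TX[OF that]] by simp
  then have "cmod (g z) \<le> N z / \<delta>" by (rule below[OF g(1)])
  then have "W z < K" using g(3) \<eta> by (simp add: K_def)
  then have "\<exists>x\<in>X. N x + b * N (z - T x) < K"
    using ge[of K z] by (meson not_less)
  then obtain x where x: "x \<in> X" "N x + b * N (z - T x) < K" by blast
  have "0 \<le> N (z - T x)" "0 \<le> N x" using x z TX by (auto intro!: norm_nonneg diff_mem)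
  then have "N x \<le> K" "b * N (z - T x) \<le> K" using x(2) b by (smt (verit) mult_nonneg_nonneg)+
  then have "N (z - T x) \<le> \<eta>" using K \<eta> by (simp add: b_def field_simps)
  then show thesis using that[OF x(1)] \<open>N x \<le> K\<close> by (simp add: K_def)
qed

text \<open>The iteration of the open mapping theorem: the residuals of approximate solutions decrease
  geometrically, and the corrections sum up by completeness.\<close>

lemma exact_solution:
  assumes T: "T \<in> bounded_ops S S" and Z: "complex_vector.subspace Z" "Z \<subseteq> X"
    and TZ: "\<And>x. x \<in> X \<Longrightarrow> T x \<in> Z" and \<delta>: "0 < \<delta>"
    and approx: "\<And>z \<eta>. \<lbrakk>z \<in> Z; 0 < \<eta>\<rbrakk> \<Longrightarrow> \<exists>x\<in>X. N x \<le> N z / \<delta> + \<eta> \<and> N (z - T x) \<le> \<eta>"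
    and complete: "\<And>x C. (\<And>j. x j \<in> X \<and> N (x j) \<le> C * (1/2)^j)
      \<Longrightarrow> \<exists>s\<in>X. (\<lambda>n. N (s - (\<Sum>j<n. x j))) \<longlonglongrightarrow> 0"
    and z: "z \<in> Z"
  shows "\<exists>x\<in>X. T x = z"
proof -
  have S: "normed_carrier S" ..
  from approx have "\<forall>z\<in>Z. \<forall>j::nat. \<exists>x\<in>X. N x \<le> N z / \<delta> + (1/2)^Suc j \<and> N (z - T x) \<le> (1/2)^Suc j"
    by (intro ballI allI approx) simp_all
  then obtain h where h: "\<And>z j. z \<in> Z \<Longrightarrow> h z j \<in> X"
    "\<And>z j. z \<in> Z \<Longrightarrow> N (h z j) \<le> N z / \<delta> + (1/2)^Suc j"
    "\<And>z j. z \<in> Z \<Longrightarrow> N (z - T (h z j)) \<le> (1/2)^Suc j"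
    by metis
  define r where "r = rec_nat z (\<lambda>j w. w - T (h w j))"
  have r0: "r 0 = z" and rS: "r (Suc j) = r j - T (h (r j) j)" for j by (simp_all add: r_def)
  have rZ: "r j \<in> Z" for j
    by (induction j) (auto simp: r0 rS z h TZ intro!: complex_vector.subspace_diff[OF Z(1)])
  define K where "K = N z + 1"
  have K: "K \<ge> 1" using norm_nonneg[of z] z Z by (auto simp: K_def)
  have Nr: "N (r j) \<le> K * (1/2)^j" for j
  proof (cases j)
    case 0
    then show ?thesis by (simp add: r0 K_def)
  next
    case (Suc i)
    have "N (r j) \<le> 1 * (1/2)^j" using h(3)[OF rZ[of i]] by (simp add: Suc rS)
    also have "\<dots> \<le> K * (1/2)^j" using K by (intro mult_right_mono) auto
    finally show ?thesis .
  qed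
  define x where "x j = h (r j) j" for j
  have xX: "x j \<in> X" for j by (simp add: x_def h rZ)
  have "N (x j) \<le> (K / \<delta> + 1) * (1/2)^j" for j
  proof -
    have "N (x j) \<le> N (r j) / \<delta> + (1/2)^Suc j" unfolding x_def by (intro h rZ)
    also have "\<dots> \<le> (K * (1/2)^j) / \<delta> + (1/2)^j"
      using \<delta> Nr[of j] by (intro add_mono divide_right_mono) auto
    finally show ?thesis by (simp add: algebra_simps)
  qed
  with complete[of x] xX obtain s where s: "s \<in> X" "(\<lambda>n. N (s - (\<Sum>j<n. x j))) \<longlonglongrightarrow> 0" by blast
  have "(\<Sum>j<n. T (x j)) = z - r n" for n
    by (induction n) (auto simp: r0 rS x_def)
  then have Tsum: "T (\<Sum>j<n. x j) = z - r n" for n using xX by (simp add: bounded_ops_sum[OF T])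
  have rX: "r n \<in> X" for n using rZ Z by auto
  have "N (T s - z) \<le> op_norm S S T * N (s - (\<Sum>j<n. x j)) + K * (1/2)^n" for n
  proof -
    have sn: "s - (\<Sum>j<n. x j) \<in> X" by (intro diff_mem s sum_mem xX)
    have "T s - z = T (s - (\<Sum>j<n. x j)) - r n"
      using s xX by (simp add: bounded_ops_diff[OF T] sum_mem Tsum)
    also have "N \<dots> \<le> N (T (s - (\<Sum>j<n. x j))) + N (r n)"
      using sn by (intro norm_diff bounded_ops_mem[OF T] rX)
    finally show ?thesis using op_norm_bound[OF S T sn] Nr[of n] by linarith
  qed
  moreover have "(\<lambda>n. op_norm S S T * N (s - (\<Sum>j<n. x j)) + K * (1/2)^n) \<longlonglongrightarrow> op_norm S S T * 0 + K * 0"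
    by (intro tendsto_intros s LIMSEQ_power_zero) auto
  ultimately have "N (T s - z) \<le> 0"
    by (intro LIMSEQ_le_const[where X = "\<lambda>n. op_norm S S T * N (s - (\<Sum>j<n. x j)) + K * (1/2)^n"]) auto
  moreover have "T s - z \<in> X" using z Z s TZ by (intro diff_mem) auto
  ultimately have "T s - z = 0" using norm_pos by fastforce
  then show ?thesis using s by auto
qed

section \<open>Lower norms, Bernstein numbers and approximation numbers\<close>

lemma lower_norm_le:
  assumes A: "A \<in> bounded_ops S S" and V: "V \<subseteq> X" "x \<in> V" "N x = 1"
  shows "lower_norm S A V \<le> N (A x)"
  unfolding lower_norm_def using V
  by (intro cINF_lower bdd_belowI2[of _ 0]) (auto intro!: norm_nonneg bounded_ops_mem[OF A])

lemma unit_vector: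
  assumes V: "complex_vector.subspace V" "V \<subseteq> X" "x \<in> V" "x \<noteq> 0"
  shows "of_real (1 / N x) *\<^sub>C x \<in> V" "N (of_real (1 / N x) *\<^sub>C x) = 1"
  using V norm_pos[of x]
  by (auto simp: norm_scale norm_divide subset_iff intro!: complex_vector.subspace_scale[OF V(1)])

lemma lower_norm_bound:
  assumes A: "A \<in> bounded_ops S S" and V: "complex_vector.subspace V" "V \<subseteq> X" "x \<in> V"
  shows "lower_norm S A V * N x \<le> N (A x)"
proof (cases "x = 0")
  case False
  then have pos: "N x > 0" using V norm_pos by auto
  have "lower_norm S A V \<le> N (A (of_real (1 / N x) *\<^sub>C x))"
    using unit_vector[OF V False] V by (intro lower_norm_le A) auto
  also have "\<dots> = N (A x) / N x" 
    using V pos by (auto simp: bounded_ops_scale[OF A] norm_scale bounded_ops_mem[OF A] subset_iff norm_divide)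
  finally show ?thesis using pos by (simp add: field_simps)
qed (simp add: bounded_ops_zero[OF A])

lemma lower_norm_ge:
  assumes V: "complex_vector.subspace V" "V \<subseteq> X" "x \<in> V" "x \<noteq> 0"
    and "\<And>y. y \<in> V \<Longrightarrow> c * N y \<le> N (A y)"
  shows "c \<le> lower_norm S A V"
  unfolding lower_norm_def using unit_vector[OF V] assms(5) by (intro cINF_greatest) fastforce+

lemma lower_norm_less:
  assumes V: "complex_vector.subspace V" "V \<subseteq> X" "x \<in> V" "x \<noteq> 0"
    and "lower_norm S A V < c"
  obtains y where "y \<in> V" "N y = 1" "N (A y) < c"
proof -
  have "\<exists>y\<in>(\<lambda>x. N (A x)) ` {x \<in> V. N x = 1}. y < c"
    using assms(5) unit_vector[OF V] unfolding lower_norm_def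
    by (intro cInf_lessD) auto
  then show thesis using that by auto
qed

lemma finite_codim_meets:
  assumes V: "quotient_dim X V < enat m" and B: "B \<subseteq> X" "independent_mod {0} B" "m \<le> card B"
  obtains c where "(\<Sum>b\<in>B. c b *\<^sub>C b) \<in> V" "(\<Sum>b\<in>B. c b *\<^sub>C b) \<noteq> 0"
proof -
  have fin: "finite B" using B by (simp add: independent_mod_def)
  have "\<not> independent_mod V B"
    using quotient_dim_ge[OF B(1), of V] V B(3)
    by (meson enat_ord_simps(1) leD le_less_trans order_trans)
  then obtain c where c: "(\<Sum>b\<in>B. c b *\<^sub>C b) \<in> V" "\<exists>b\<in>B. c b \<noteq> 0"
    using fin by (auto simp: independent_mod_def)
  then have "(\<Sum>b\<in>B. c b *\<^sub>C b) \<noteq> 0" using B(2) by (auto simp: independent_mod_def)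
  then show thesis using that c by blast
qed

text \<open>Every subspace of small codimension meets the span of a large independent family; this turns the
  estimate on such spans into an upper bound for all subspaces at once. The operator \<open>A0\<close> agrees with
  \<open>A\<close> on the carrier; for adjoints, only \<open>A0\<close> vanishes off the carrier as members of \<open>bounded_ops\<close> do.\<close>

lemma bernstein_number_tendsto:
  assumes A: "\<And>x. x \<in> X \<Longrightarrow> A x = A0 x" "A0 \<in> bounded_ops S S"
    and lower: "\<And>e. 0 < e \<Longrightarrow> \<exists>V k. complex_vector.subspace V \<and> V \<subseteq> X \<and> quotient_dim X V \<le> enat k
        \<and> (\<forall>x\<in>V. (a - e) * N x \<le> N (A x))"
    and upper: "\<And>e m. 0 < e \<Longrightarrow> \<exists>B. B \<subseteq> X \<and> independent_mod {0} B \<and> m \<le> card B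
        \<and> (\<forall>c. N (A (\<Sum>b\<in>B. c b *\<^sub>C b)) \<le> (a + e) * N (\<Sum>b\<in>B. c b *\<^sub>C b))"
  shows "bernstein_number S A \<longlonglongrightarrow> a"
proof (rule LIMSEQ_I)
  fix r :: real assume r: "0 < r"
  define e where "e = r / 2"
  have e: "0 < e" "e < r" using r by (auto simp: e_def)
  have le: "lower_norm S A V \<le> a + e" and ex: "\<exists>x\<in>V. x \<noteq> 0"
    if V: "complex_vector.subspace V" "V \<subseteq> X" "quotient_dim X V < enat m" for V m
  proof -
    obtain B where B: "B \<subseteq> X" "independent_mod {0} B" "m \<le> card B"
      "\<And>c. N (A (\<Sum>b\<in>B. c b *\<^sub>C b)) \<le> (a + e) * N (\<Sum>b\<in>B. c b *\<^sub>C b)"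
      using upper[OF e(1), of m] by blast
    obtain c where c: "(\<Sum>b\<in>B. c b *\<^sub>C b) \<in> V" "(\<Sum>b\<in>B. c b *\<^sub>C b) \<noteq> 0"
      using finite_codim_meets[OF V(3) B(1-3)] by blast
    let ?x = "\<Sum>b\<in>B. c b *\<^sub>C b"
    have xX: "?x \<in> X" using c V by auto
    have "lower_norm S A V = lower_norm S A0 V"
      unfolding lower_norm_def using V A by (intro INF_cong) auto
    then have "lower_norm S A V * N ?x \<le> N (A ?x)"
      using lower_norm_bound[OF A(2) V(1,2) c(1)] A(1)[OF xX] by simp
    also have "\<dots> \<le> (a + e) * N ?x" by (rule B)
    finally show "lower_norm S A V \<le> a + e" using norm_pos[OF xX c(2)] by simp
    show "\<exists>x\<in>V. x \<noteq> 0" using c by blast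
  qed
  obtain V k where V: "complex_vector.subspace V" "V \<subseteq> X" "quotient_dim X V \<le> enat k"
    "\<And>x. x \<in> V \<Longrightarrow> (a - e) * N x \<le> N (A x)" using lower[OF e(1)] by blast
  show "\<exists>n0. \<forall>m\<ge>n0. norm (bernstein_number S A m - a) < r"
  proof (intro exI allI impI)
    fix m assume m: "Suc k \<le> m"
    have "enat k < enat m" using m by simp
    with V(3) have qd: "quotient_dim X V < enat m" by (rule le_less_trans)
    let ?\<V> = "{V. complex_vector.subspace V \<and> V \<subseteq> X \<and> quotient_dim X V < enat m}"
    have V_in: "V \<in> ?\<V>" using V qd by blast
    have "bernstein_number S A m \<le> a + e"
      unfolding bernstein_number_def using V_in le by (intro cSUP_least) blast+
    moreover obtain x where x: "x \<in> V" "x \<noteq> 0" using ex[OF V(1,2) qd] by blast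
    have "a - e \<le> lower_norm S A V" by (rule lower_norm_ge[OF V(1,2) x V(4)])
    moreover have "lower_norm S A V \<le> bernstein_number S A m"
      unfolding bernstein_number_def using V_in le
      by (intro cSUP_upper bdd_aboveI2[of _ _ "a + e"]) blast+
    ultimately show "norm (bernstein_number S A m - a) < r" using e by (simp add: abs_less_iff)
  qed
qed

lemma
  assumes A: "A \<in> bounded_ops S S"
  shows right_approx_number_tendsto:
    "\<lbrakk>\<And>e. 0 < e \<Longrightarrow> \<exists>k. \<forall>F\<in>bounded_ops S S. enat k < subspace_dim {x \<in> X. F x = 0} \<longrightarrow> a - e \<le> op_norm S S (A - F);
      \<And>e m. 0 < e \<Longrightarrow> \<exists>F\<in>bounded_ops S S. enat m \<le> subspace_dim {x \<in> X. F x = 0} \<and> op_norm S S (A - F) \<le> a + e\<rbrakk>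
      \<Longrightarrow> right_approx_number S A \<longlonglongrightarrow> a"
    and left_approx_number_tendsto:
    "\<lbrakk>\<And>e. 0 < e \<Longrightarrow> \<exists>k. \<forall>F\<in>bounded_ops S S. enat k < quotient_dim X (F ` X) \<longrightarrow> a - e \<le> op_norm S S (A - F);
      \<And>e m. 0 < e \<Longrightarrow> \<exists>F\<in>bounded_ops S S. enat m \<le> quotient_dim X (F ` X) \<and> op_norm S S (A - F) \<le> a + e\<rbrakk>
      \<Longrightarrow> left_approx_number S A \<longlonglongrightarrow> a"
proof -
  have S: "normed_carrier S" ..
  have gen: "(\<lambda>m. INF F\<in>{F \<in> bounded_ops S S. enat m \<le> d F}. op_norm S S (A - F)) \<longlonglongrightarrow> a"
    if lo: "\<And>e. 0 < e \<Longrightarrow> \<exists>k. \<forall>F\<in>bounded_ops S S. enat k < d F \<longrightarrow> a - e \<le> op_norm S S (A - F)"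
      and up: "\<And>e m. 0 < e \<Longrightarrow> \<exists>F\<in>bounded_ops S S. enat m \<le> d F \<and> op_norm S S (A - F) \<le> a + e" for d
  proof (rule LIMSEQ_I)
    fix r :: real assume r: "0 < r"
    define e where "e = r / 2"
    have e: "0 < e" "e < r" using r by (auto simp: e_def)
    obtain k where k: "\<And>F. F \<in> bounded_ops S S \<Longrightarrow> enat k < d F \<Longrightarrow> a - e \<le> op_norm S S (A - F)"
      using lo[OF e(1)] by blast
    show "\<exists>n0. \<forall>m\<ge>n0. norm ((INF F\<in>{F \<in> bounded_ops S S. enat m \<le> d F}. op_norm S S (A - F)) - a) < r"
    proof (intro exI allI impI)
      fix m assume m: "Suc k \<le> m"
      obtain F where F: "F \<in> bounded_ops S S" "enat m \<le> d F" "op_norm S S (A - F) \<le> a + e"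
        using up[OF e(1)] by blast
      let ?I = "INF F\<in>{F \<in> bounded_ops S S. enat m \<le> d F}. op_norm S S (A - F)"
      have "?I \<le> op_norm S S (A - F)"
        using F A by (intro cINF_lower bdd_belowI2[of _ 0]) (auto intro!: op_norm_nonneg S bounded_ops_minus_op)
      moreover have "a - e \<le> ?I"
      proof (rule cINF_greatest)
        fix G assume "G \<in> {F \<in> bounded_ops S S. enat m \<le> d F}"
        moreover have "enat k < enat m" using m by simp
        ultimately show "a - e \<le> op_norm S S (A - G)" using k[of G] less_le_trans by blast
      qed (use F in auto)
      ultimately show "norm (?I - a) < r" using F e by (simp add: abs_less_iff)
    qed
  qed
  show "right_approx_number S A \<longlonglongrightarrow> a"
    if "\<And>e. 0 < e \<Longrightarrow> \<exists>k. \<forall>F\<in>bounded_ops S S. enat k < subspace_dim {x \<in> X. F x = 0} \<longrightarrow> a - e \<le> op_norm S S (A - F)"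
      "\<And>e m. 0 < e \<Longrightarrow> \<exists>F\<in>bounded_ops S S. enat m \<le> subspace_dim {x \<in> X. F x = 0} \<and> op_norm S S (A - F) \<le> a + e"
    using gen[of "\<lambda>F. subspace_dim {x \<in> X. F x = 0}"] that unfolding right_approx_number_def by blast
  show "left_approx_number S A \<longlonglongrightarrow> a"
    if "\<And>e. 0 < e \<Longrightarrow> \<exists>k. \<forall>F\<in>bounded_ops S S. enat k < quotient_dim X (F ` X) \<longrightarrow> a - e \<le> op_norm S S (A - F)"
      "\<And>e m. 0 < e \<Longrightarrow> \<exists>F\<in>bounded_ops S S. enat m \<le> quotient_dim X (F ` X) \<and> op_norm S S (A - F) \<le> a + e"
    using gen[of "\<lambda>F. quotient_dim X (F ` X)"] that unfolding left_approx_number_def by blast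
qed

end

context normed_carrier
begin

section \<open>Perturbations from biorthogonal systems\<close>

definition biorthogonal :: "nat \<Rightarrow> (nat \<Rightarrow> 'a) \<Rightarrow> (nat \<Rightarrow> 'a \<Rightarrow> complex) \<Rightarrow> bool" where
  "biorthogonal m x g \<longleftrightarrow> (\<forall>j<m. x j \<in> X \<and> g j \<in> X') \<and>
     (\<forall>i<m. \<forall>j<m. g i (x j) = (if i = j then 1 else 0))"

context
  fixes m x g
  assumes bi: "biorthogonal m x g"
begin

lemma biorthogonal_mem: "j < m \<Longrightarrow> x j \<in> X" "j < m \<Longrightarrow> g j \<in> X'"
  using bi by (auto simp: biorthogonal_def)

lemma biorthogonal_apply: "i < m \<Longrightarrow> j < m \<Longrightarrow> g i (x j) = (if i = j then 1 else 0)"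
  using bi by (auto simp: biorthogonal_def)

lemma biorthogonal_coefficient:
  "i < m \<Longrightarrow> g i (\<Sum>j<m. c j *\<^sub>C x j) = c i"
  by (subst functional_sum) (auto simp: biorthogonal_mem biorthogonal_apply if_distrib cong: if_cong)

lemma biorthogonal_inj: "inj_on x {..<m}" "inj_on g {..<m}"
proof -
  show "inj_on x {..<m}"
    by (rule inj_onI) (metis biorthogonal_apply lessThan_iff zero_neq_one)
  show "inj_on g {..<m}"
    by (rule inj_onI) (metis biorthogonal_apply lessThan_iff zero_neq_one)
qed

lemma biorthogonal_independent_mod:
  assumes "\<And>i y. i < m \<Longrightarrow> y \<in> W \<Longrightarrow> g i y = 0"
  shows "independent_mod W (x ` {..<m})"
  unfolding independent_mod_def
proof (intro conjI allI impI ballI)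
  fix c b assume c: "(\<Sum>b\<in>x ` {..<m}. c b *\<^sub>C b) \<in> W" and b: "b \<in> x ` {..<m}"
  then obtain i where i: "i < m" "b = x i" by auto
  have "(\<Sum>b\<in>x ` {..<m}. c b *\<^sub>C b) = (\<Sum>j<m. c (x j) *\<^sub>C x j)"
    by (subst sum.reindex[OF biorthogonal_inj(1)]) simp
  then show "c b = 0" using assms[OF i(1) c] biorthogonal_coefficient[OF i(1), of "\<lambda>j. c (x j)"] i(2) by simp
qed simp

lemma dual_linear_sum_apply: "(\<Sum>b\<in>g ` {..<m}. c b *\<^sub>C b) y = (\<Sum>j<m. c (g j) * g j y)"
  by (subst sum.reindex[OF biorthogonal_inj(2)]) (simp add: sum_fun_apply scaleC_fun_def scaleC_complex_def)

lemma biorthogonal_independent_dual: "independent_mod {0} (g ` {..<m})"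
  unfolding independent_mod_def
proof (intro conjI allI impI ballI)
  fix c b assume c: "(\<Sum>b\<in>g ` {..<m}. c b *\<^sub>C b) \<in> {0}" and b: "b \<in> g ` {..<m}"
  then obtain i where i: "i < m" "b = g i" by auto
  have "0 = (\<Sum>b\<in>g ` {..<m}. c b *\<^sub>C b) (x i)" using c by simp
  also have "\<dots> = (\<Sum>j<m. if j = i then c (g j) else 0)"
    unfolding dual_linear_sum_apply using i by (intro sum.cong) (auto simp: biorthogonal_apply)
  also have "\<dots> = c b" using i by simp
  finally show "c b = 0" ..
qed simp

text \<open>With \<open>\<Pi> y = \<Sum> g_j(y) x_j\<close>, the operator \<open>A - A \<Pi>\<close> annihilates every \<open>x_j\<close>, and \<open>A = A \<Pi>\<close> on the span of
  the \<open>x_j\<close>. The hypothesis bounds the norm of \<open>A \<Pi>\<close>.\<close>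

lemma biorthogonal_right:
  assumes A: "A \<in> bounded_ops S S" and C: "0 \<le> C"
    and bound: "\<And>y. y \<in> X \<Longrightarrow> N (\<Sum>j<m. g j y *\<^sub>C A (x j)) \<le> C * N y"
  shows "\<exists>F\<in>bounded_ops S S. enat m \<le> subspace_dim {x \<in> X. F x = 0} \<and> op_norm S S (A - F) \<le> C"
    and "\<exists>B. B \<subseteq> X \<and> independent_mod {0} B \<and> m \<le> card B
        \<and> (\<forall>c. N (A (\<Sum>b\<in>B. c b *\<^sub>C b)) \<le> C * N (\<Sum>b\<in>B. c b *\<^sub>C b))"
proof -
  define G where "G y = (\<Sum>j<m. g j y *\<^sub>C A (x j))" for y
  have S: "normed_carrier S" ..
  have G: "G \<in> bounded_ops S S"
  proof (rule bounded_opsI[where C = C])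
    fix y z assume "y \<in> X" "z \<in> X"
    then have "g j (y + z) = g j y + g j z" if "j < m" for j
      using that by (intro functional_add biorthogonal_mem)
    then show "G (y + z) = G y + G z" by (simp add: G_def scaleC_add_left sum.distrib)
  next
    fix a y assume "y \<in> X"
    then have "g j (a *\<^sub>C y) = a * g j y" if "j < m" for j
      using that by (intro functional_scale biorthogonal_mem)
    then show "G (a *\<^sub>C y) = a *\<^sub>C G y" by (simp add: G_def complex_vector.scale_sum_right)
  next
    fix y assume "y \<notin> X"
    then have "g j y = 0" if "j < m" for j using that by (intro functional_outside biorthogonal_mem)
    then show "G y = 0" by (simp add: G_def)
  next
    fix y assume "y \<in> X"
    then show "G y \<in> X"
      unfolding G_def by (intro sum_mem scale_mem bounded_ops_mem[OF A] biorthogonal_mem) auto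
  qed (use bound in \<open>simp add: G_def\<close>)
  have F: "A - G \<in> bounded_ops S S" by (rule bounded_ops_minus_op[OF S A G])
  have Fx: "(A - G) (x j) = 0" if "j < m" for j
  proof -
    have "G (x j) = (\<Sum>i<m. if i = j then A (x i) else 0)"
      unfolding G_def using that by (intro sum.cong) (auto simp: biorthogonal_apply scaleC_one)
    then show ?thesis using that by simp
  qed
  let ?B = "x ` {..<m}"
  have B: "?B \<subseteq> X" "independent_mod {0} ?B" "m \<le> card ?B"
    using biorthogonal_mem biorthogonal_independent_mod[of "{0}"]
    by (auto simp: card_image[OF biorthogonal_inj(1)] functional_zero)
  have "enat (card ?B) \<le> subspace_dim {x \<in> X. (A - G) x = 0}"
    using B Fx by (intro quotient_dim_ge) auto
  then have "enat m \<le> subspace_dim {x \<in> X. (A - G) x = 0}"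
    by (simp add: card_image[OF biorthogonal_inj(1)])
  moreover have "op_norm S S (A - (A - G)) \<le> C"
    using bound C by (intro op_norm_le) (auto simp: G_def)
  ultimately show "\<exists>F\<in>bounded_ops S S. enat m \<le> subspace_dim {x \<in> X. F x = 0} \<and> op_norm S S (A - F) \<le> C"
    using F by blast
  have "N (A (\<Sum>b\<in>?B. c b *\<^sub>C b)) \<le> C * N (\<Sum>b\<in>?B. c b *\<^sub>C b)" for c
  proof -
    let ?y = "\<Sum>b\<in>?B. c b *\<^sub>C b"
    have y: "?y \<in> X" using B by (intro sum_mem scale_mem) auto
    have "(A - G) ?y = (\<Sum>b\<in>?B. c b *\<^sub>C (A - G) b)"
      using B by (intro bounded_ops_linear_sum[OF F]) auto
    also have "\<dots> = 0" using Fx by (intro sum.neutral) auto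
    finally have "A ?y = G ?y" by simp
    then show ?thesis using bound[OF y] by (simp add: G_def)
  qed
  then show "\<exists>B. B \<subseteq> X \<and> independent_mod {0} B \<and> m \<le> card B
        \<and> (\<forall>c. N (A (\<Sum>b\<in>B. c b *\<^sub>C b)) \<le> C * N (\<Sum>b\<in>B. c b *\<^sub>C b))"
    using B by blast
qed

text \<open>Here the operator is \<open>A - \<Pi> A\<close>. All \<open>g_j\<close> vanish on its range, so the \<open>x_j\<close> are independent modulo
  that range whether or not it is closed.\<close>

lemma biorthogonal_left:
  assumes A: "A \<in> bounded_ops S S" and C: "0 \<le> C"
    and bound: "\<And>y. y \<in> X \<Longrightarrow> N (\<Sum>j<m. g j (A y) *\<^sub>C x j) \<le> C * N y"
  shows "\<exists>F\<in>bounded_ops S S. enat m \<le> quotient_dim X (F ` X) \<and> op_norm S S (A - F) \<le> C"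
    and "\<exists>B. B \<subseteq> X' \<and> independent_mod {0} B \<and> m \<le> card B
        \<and> (\<forall>c. N' (adjoint_op S A (\<Sum>b\<in>B. c b *\<^sub>C b)) \<le> C * N' (\<Sum>b\<in>B. c b *\<^sub>C b))"
proof -
  interpret D: normed_carrier "dual S" by (rule normed_carrier_dual)
  define G where "G y = (\<Sum>j<m. g j (A y) *\<^sub>C x j)" for y
  have S: "normed_carrier S" ..
  have AX: "y \<in> X \<Longrightarrow> A y \<in> X" for y by (rule bounded_ops_mem[OF A])
  have G: "G \<in> bounded_ops S S"
  proof (rule bounded_opsI[where C = C])
    fix y z assume yz: "y \<in> X" "z \<in> X"
    then have "g j (A (y + z)) = g j (A y) + g j (A z)" if "j < m" for j
      using that by (simp add: bounded_ops_add[OF A] functional_add[OF biorthogonal_mem(2)] AX)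
    then show "G (y + z) = G y + G z" by (simp add: G_def scaleC_add_left sum.distrib)
  next
    fix a y assume "y \<in> X"
    then have "g j (A (a *\<^sub>C y)) = a * g j (A y)" if "j < m" for j
      using that by (simp add: bounded_ops_scale[OF A] functional_scale[OF biorthogonal_mem(2)] AX)
    then show "G (a *\<^sub>C y) = a *\<^sub>C G y" by (simp add: G_def complex_vector.scale_sum_right)
  next
    fix y assume "y \<notin> X"
    then have "g j (A y) = 0" if "j < m" for j
      using that by (simp add: bounded_ops_outside[OF A] functional_zero[OF biorthogonal_mem(2)])
    then show "G y = 0" by (simp add: G_def)
  next
    fix y assume "y \<in> X"
    then show "G y \<in> X"
      unfolding G_def by (intro sum_mem scale_mem biorthogonal_mem) auto
  qed (use bound in \<open>simp add: G_def\<close>)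
  have F: "A - G \<in> bounded_ops S S" by (rule bounded_ops_minus_op[OF S A G])
  have gF: "g i ((A - G) y) = 0" if i: "i < m" and y: "y \<in> X" for i y
  proof -
    have "g i (G y) = g i (A y)" unfolding G_def by (rule biorthogonal_coefficient[OF i])
    then show ?thesis
      using functional_diff[OF biorthogonal_mem(2)[OF i] AX[OF y] bounded_ops_mem[OF G y]] by simp
  qed
  let ?B = "x ` {..<m}"
  have "enat (card ?B) \<le> quotient_dim X ((A - G) ` X)"
  proof (rule quotient_dim_ge)
    show "?B \<subseteq> X" using biorthogonal_mem by auto
    show "independent_mod ((A - G) ` X) ?B"
      by (rule biorthogonal_independent_mod) (use gF in blast)
  qed
  then have "enat m \<le> quotient_dim X ((A - G) ` X)"
    by (simp add: card_image[OF biorthogonal_inj(1)])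
  moreover have "op_norm S S (A - (A - G)) \<le> C"
    using bound C by (intro op_norm_le) (auto simp: G_def)
  ultimately show "\<exists>F\<in>bounded_ops S S. enat m \<le> quotient_dim X (F ` X) \<and> op_norm S S (A - F) \<le> C"
    using F by blast
  let ?H = "g ` {..<m}"
  have H: "?H \<subseteq> X'" "independent_mod {0} ?H" "m \<le> card ?H"
    using biorthogonal_mem biorthogonal_independent_dual by (auto simp: card_image[OF biorthogonal_inj(2)])
  have "N' (adjoint_op S A (\<Sum>b\<in>?H. c b *\<^sub>C b)) \<le> C * N' (\<Sum>b\<in>?H. c b *\<^sub>C b)" for c
  proof -
    define h where "h = (\<Sum>b\<in>?H. c b *\<^sub>C b)"
    have h: "h \<in> X'" unfolding h_def using H by (intro D.sum_mem D.scale_mem) auto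
    have hF: "h ((A - G) y) = 0" if "y \<in> X" for y
      unfolding h_def dual_linear_sum_apply using gF[OF _ that] by simp
    have "N' (adjoint_op S A h) \<le> C * N' h"
    proof (rule functional_norm_le)
      show "0 \<le> C * N' h" using C D.norm_nonneg[OF h] by simp
      fix y assume y: "y \<in> X"
      have "h (A y) = h (G y)"
        using hF[OF y] functional_diff[OF h AX[OF y] bounded_ops_mem[OF G y]] by simp
      then have "cmod (h (A y)) \<le> N' h * N (G y)"
        using functional_bound[OF h bounded_ops_mem[OF G y]] by simp
      also have "\<dots> \<le> N' h * (C * N y)"
        using bound[OF y] by (intro mult_left_mono D.norm_nonneg h) (simp add: G_def)
      finally show "cmod (adjoint_op S A h y) \<le> C * N' h * N y"
        using y by (simp add: adjoint_op_def mult_ac)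
    qed
    then show ?thesis by (simp add: h_def)
  qed
  then show "\<exists>B. B \<subseteq> X' \<and> independent_mod {0} B \<and> m \<le> card B
        \<and> (\<forall>c. N' (adjoint_op S A (\<Sum>b\<in>B. c b *\<^sub>C b)) \<le> C * N' (\<Sum>b\<in>B. c b *\<^sub>C b))"
    using H by blast
qed

end

lemma lower_norm_cong: "(\<And>x. x \<in> V \<Longrightarrow> A x = B x) \<Longrightarrow> lower_norm S A V = lower_norm S B V"
  unfolding lower_norm_def by (intro INF_cong) auto

lemma lower_norm_limit:
  assumes A: "A \<in> bounded_ops S S"
    and V: "\<And>m. complex_vector.subspace (V m)" "\<And>m. V m \<subseteq> X" "\<And>m. \<exists>x\<in>V m. x \<noteq> 0" "\<And>m. V (Suc m) \<subseteq> V m"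
  shows "(\<lambda>m. lower_norm S A (V m)) \<longlonglongrightarrow> lim (\<lambda>m. lower_norm S A (V m))"
    and "lower_norm S A (V m) \<le> lim (\<lambda>m. lower_norm S A (V m))"
    and "0 \<le> lim (\<lambda>m. lower_norm S A (V m))"
proof -
  have S: "normed_carrier S" ..
  let ?L = "\<lambda>m. lower_norm S A (V m)"
  have inc: "incseq ?L"
  proof (rule incseq_SucI)
    fix m
    obtain x where "x \<in> V (Suc m)" "x \<noteq> 0" using V(3) by blast
    moreover have "y \<in> V (Suc m) \<Longrightarrow> y \<in> V m" for y using V(4)[of m] by blast
    ultimately show "?L m \<le> ?L (Suc m)"
      using V(1,2) by (intro lower_norm_ge lower_norm_bound A) auto
  qed
  have bdd: "?L m \<le> op_norm S S A" for m
  proof -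
    obtain x where x: "x \<in> V m" "x \<noteq> 0" using V(3) by blast
    have xX: "x \<in> X" using x V by blast
    have "?L m * N x \<le> op_norm S S A * N x"
      using lower_norm_bound[OF A V(1,2) x(1)] op_norm_bound[OF S A xX] by (rule order_trans)
    then show ?thesis using norm_pos[OF xX x(2)] by simp
  qed
  obtain l where l: "?L \<longlonglongrightarrow> l" "\<And>m. ?L m \<le> l" using incseq_convergent[OF inc] bdd by metis
  then have lim: "lim ?L = l" by (simp add: limI)
  show "?L \<longlonglongrightarrow> lim ?L" using l lim by simp
  show "?L m \<le> lim ?L" for m using l lim by simp
  obtain x where x: "x \<in> V 0" "x \<noteq> 0" using V(3) by blast
  have "0 \<le> ?L 0"
    using V(2)[of 0] by (intro lower_norm_ge[OF V(1,2) x]) (auto intro!: norm_nonneg bounded_ops_mem[OF A])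
  then show "0 \<le> lim ?L" using l(2)[of 0] lim by simp
qed

end

section \<open>Sequence spaces on the lattice\<close>

definition restrict_seq :: "'i set \<Rightarrow> ('i \<Rightarrow> 'x::zero) \<Rightarrow> 'i \<Rightarrow> 'x" where
  "restrict_seq E x = (\<lambda>i. if i \<in> E then x i else 0)"

definition cube :: "nat \<Rightarrow> (int ^ 'n) set" where
  "cube n = {i. \<forall>k. - int n \<le> i $ k \<and> i $ k \<le> int n}"

definition single_seq :: "'i \<Rightarrow> 'x::zero \<Rightarrow> 'i \<Rightarrow> 'x" where
  "single_seq i v = (\<lambda>j. if j = i then v else 0)"

lemma P_proj_eq: "P_proj n x = restrict_seq (cube n) x"
  by (simp add: P_proj_def restrict_seq_def cube_def)

lemma Q_proj_eq: "Q_proj n x = restrict_seq (- cube n) x"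
  by (auto simp: Q_proj_def P_proj_eq restrict_seq_def fun_eq_iff)

lemma finite_cube: "finite (cube n :: (int ^ 'n::finite) set)"
proof -
  have "($) ` (cube n :: (int ^ 'n) set) \<subseteq> PiE UNIV (\<lambda>_. {- int n .. int n})"
    by (auto simp: cube_def)
  moreover have "finite (PiE (UNIV :: 'n set) (\<lambda>_. {- int n .. int n}))" by (intro finite_PiE) auto
  ultimately have "finite (($) ` (cube n :: (int ^ 'n) set))" by (rule finite_subset)
  then show ?thesis by (rule finite_imageD) (auto simp: inj_on_def vec_eq_iff)
qed

lemma cube_mono: "m \<le> n \<Longrightarrow> (cube m :: (int ^ 'n) set) \<subseteq> cube n"
proof
  fix i :: "int ^ 'n" assume mn: "m \<le> n" and i: "i \<in> cube m"
  have "- int n \<le> i $ k \<and> i $ k \<le> int n" for k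
  proof -
    have "- int m \<le> i $ k \<and> i $ k \<le> int m" using i by (simp add: cube_def)
    then show ?thesis using mn by linarith
  qed
  then show "i \<in> cube n" by (simp add: cube_def)
qed

lemma finite_subset_cube:
  fixes F :: "(int ^ 'n::finite) set"
  assumes "finite F" obtains n where "F \<subseteq> cube n"
proof -
  have "finite ((\<lambda>(i, k). nat \<bar>i $ k\<bar>) ` (F \<times> UNIV))" using assms by simp
  then obtain n where n: "\<And>a. a \<in> (\<lambda>(i, k). nat \<bar>i $ k\<bar>) ` (F \<times> UNIV) \<Longrightarrow> a \<le> n"
    by (meson finite_nat_set_iff_bounded_le)
  have "F \<subseteq> cube n"
  proof
    fix i assume "i \<in> F"
    then have "nat \<bar>i $ k\<bar> \<le> n" for k by (intro n) (auto intro!: image_eqI[of _ _ "(i, k)"])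
    then have "\<bar>i $ k\<bar> \<le> int n" for k by (metis nat_le_iff)
    then show "i \<in> cube n" unfolding cube_def by (simp add: abs_le_iff minus_le_iff)
  qed
  then show thesis by (rule that)
qed

lemma restrict_restrict: "restrict_seq E (restrict_seq F x) = restrict_seq (E \<inter> F) x"
  by (auto simp: restrict_seq_def fun_eq_iff)

lemma restrict_add: "restrict_seq E (x + y) = restrict_seq E x + restrict_seq E (y :: _ \<Rightarrow> _::comm_monoid_add)"
  by (auto simp: restrict_seq_def fun_eq_iff)

lemma restrict_diff: "restrict_seq E (x - y) = restrict_seq E x - restrict_seq E (y :: _ \<Rightarrow> _::ab_group_add)"
  by (auto simp: restrict_seq_def fun_eq_iff)

lemma restrict_scale: "restrict_seq E (a *\<^sub>C x) = a *\<^sub>C restrict_seq E x"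
  by (auto simp: restrict_seq_def fun_eq_iff scaleC_fun_def)

lemma restrict_sum: "restrict_seq E (\<Sum>j\<in>J. x j) = (\<Sum>j\<in>J. restrict_seq E (x j :: _ \<Rightarrow> _::comm_monoid_add))"
  by (auto simp: restrict_seq_def fun_eq_iff sum_fun_apply)

lemma restrict_id: "(\<And>i. i \<notin> E \<Longrightarrow> x i = 0) \<Longrightarrow> restrict_seq E x = x"
  by (auto simp: restrict_seq_def fun_eq_iff)

lemma restrict_split: "restrict_seq E x + restrict_seq (- E) x = (x :: _ \<Rightarrow> _::comm_monoid_add)"
  by (auto simp: restrict_seq_def fun_eq_iff)

text \<open>The properties shared by all spaces \<open>l\<^sup>p\<close>. The exponent is hidden in \<open>disjoint_mono\<close>: the norm of a
  sum of two disjointly supported sequences is a monotone function of the two norms. In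
  \<open>vanishing_or_closed\<close>, the first alternative holds for \<open>p = 0\<close>, and the second one, a kind of weak-star
  completeness, for \<open>1 \<le> p\<close>.\<close>

locale seq_space = normed_carrier S
  for S :: "('x::{complex_normed_vector, banach}, 'n::finite) lattice_seq nspace" +
  assumes solid: "\<lbrakk>x \<in> carrier_of S; \<And>i. norm (y i) \<le> norm (x i)\<rbrakk>
      \<Longrightarrow> y \<in> carrier_of S \<and> norm_of S y \<le> norm_of S x"
    and single: "single_seq i v \<in> carrier_of S" "norm_of S (single_seq i v) = norm v"
    and disjoint_mono: "\<lbrakk>x \<in> carrier_of S; x' \<in> carrier_of S; y \<in> carrier_of S; y' \<in> carrier_of S;
      \<And>i. x i = 0 \<or> x' i = 0; \<And>i. y i = 0 \<or> y' i = 0;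
      norm_of S x \<le> norm_of S y; norm_of S x' \<le> norm_of S y'\<rbrakk>
      \<Longrightarrow> norm_of S (x + x') \<le> norm_of S (y + y')"
    and norm_approx: "\<lbrakk>x \<in> carrier_of S; 0 < e\<rbrakk> \<Longrightarrow> \<exists>n. norm_of S x - e < norm_of S (P_proj n x)"
    and complete: "(\<And>j. u j \<in> carrier_of S \<and> norm_of S (u j) \<le> C * (1/2)^j)
      \<Longrightarrow> \<exists>s\<in>carrier_of S. (\<lambda>n. norm_of S (s - (\<Sum>j<n. u j))) \<longlonglongrightarrow> 0"
    and vanishing_or_closed: "(\<forall>x\<in>carrier_of S. (\<lambda>n. norm_of S (Q_proj n x)) \<longlonglongrightarrow> 0) \<or>
      (\<forall>x C. (\<forall>n. norm_of S (P_proj n x) \<le> C) \<longrightarrow> x \<in> carrier_of S)"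
    and nontrivial: "\<exists>v::'x. v \<noteq> 0"
    and finite_dim: "\<exists>b::'x set. finite b \<and> complex_vector.span b = UNIV"
begin

lemma restrict_mem: "x \<in> X \<Longrightarrow> restrict_seq E x \<in> X"
  and restrict_le: "x \<in> X \<Longrightarrow> N (restrict_seq E x) \<le> N x"
  using solid[of x "restrict_seq E x"] by (auto simp: restrict_seq_def)

lemma coordinate_le: "norm (x i) \<le> N x" if "x \<in> X"
proof -
  have "norm (single_seq i (x i) j) \<le> norm (x j)" for j by (simp add: single_seq_def)
  then show ?thesis using solid[OF that, of "single_seq i (x i)"] by (simp add: single)
qed

lemma finite_support:
  assumes "finite F" "\<And>i. i \<notin> F \<Longrightarrow> x i = 0"
  shows "x \<in> X" "N x \<le> (\<Sum>i\<in>F. norm (x i))"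
proof -
  have x: "x = (\<Sum>i\<in>F. single_seq i (x i))"
    using assms by (auto simp: fun_eq_iff sum_fun_apply single_seq_def)
  show "x \<in> X" by (subst x) (intro sum_mem single)
  have "N (\<Sum>i\<in>F. single_seq i (x i)) \<le> (\<Sum>i\<in>F. N (single_seq i (x i)))" by (intro norm_sum single)
  then show "N x \<le> (\<Sum>i\<in>F. norm (x i))" using x by (simp add: single)
qed

lemma disjoint_sum_mono:
  assumes "finite J" "\<And>j. j \<in> J \<Longrightarrow> x j \<in> X \<and> y j \<in> X \<and> N (x j) \<le> N (y j)"
    and "\<And>i j k. \<lbrakk>j \<in> J; k \<in> J; j \<noteq> k\<rbrakk> \<Longrightarrow> x j i = 0 \<or> x k i = 0"
    and "\<And>i j k. \<lbrakk>j \<in> J; k \<in> J; j \<noteq> k\<rbrakk> \<Longrightarrow> y j i = 0 \<or> y k i = 0"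
  shows "N (\<Sum>j\<in>J. x j) \<le> N (\<Sum>j\<in>J. y j)"
  using assms
proof (induction J rule: finite_induct)
  case (insert j J)
  have "N (x j + (\<Sum>j\<in>J. x j)) \<le> N (y j + (\<Sum>j\<in>J. y j))"
  proof (rule disjoint_mono)
    show "x j \<in> X" "y j \<in> X" "N (x j) \<le> N (y j)" using insert.prems(1)[of j] by auto
    show "(\<Sum>j\<in>J. x j) \<in> X" "(\<Sum>j\<in>J. y j) \<in> X" using insert.prems(1) by (auto intro!: sum_mem)
    show "x j i = 0 \<or> (\<Sum>j\<in>J. x j) i = 0" for i
      unfolding sum_fun_apply using insert.prems(2)[of j _ i] insert.hyps
      by (cases "x j i = 0") (auto intro!: sum.neutral)
    show "y j i = 0 \<or> (\<Sum>j\<in>J. y j) i = 0" for i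
      unfolding sum_fun_apply using insert.prems(3)[of j _ i] insert.hyps
      by (cases "y j i = 0") (auto intro!: sum.neutral)
    show "N (\<Sum>j\<in>J. x j) \<le> N (\<Sum>j\<in>J. y j)"
      by (rule insert.IH) (use insert.prems in auto)
  qed
  then show ?case by (simp only: sum.insert[OF insert.hyps])
qed simp

lemma Q_image: "Q_proj m ` X = {x \<in> X. restrict_seq (- cube m) x = x}"
proof (intro set_eqI iffI)
  fix x assume "x \<in> Q_proj m ` X"
  then show "x \<in> {x \<in> X. restrict_seq (- cube m) x = x}"
    by (auto simp: Q_proj_eq restrict_mem restrict_restrict)
next
  fix x assume "x \<in> {x \<in> X. restrict_seq (- cube m) x = x}"
  then have "x = Q_proj m x" "x \<in> X" by (auto simp: Q_proj_eq)
  then show "x \<in> Q_proj m ` X" by blast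
qed

lemma subspace_Q: "complex_vector.subspace (Q_proj m ` X)"
  unfolding Q_image
  by (auto simp: complex_vector.subspace_def add_mem scale_mem restrict_add restrict_scale)
    (simp add: restrict_seq_def fun_eq_iff)

lemma Q_subset: "Q_proj m ` X \<subseteq> X" by (auto simp: Q_image)

lemma outside_cube: "\<exists>i::int ^ 'n. i \<notin> cube m"
  by (rule exI[of _ "\<chi> k. int m + 1"]) (auto simp: cube_def)

lemma Q_nontrivial: "\<exists>x\<in>Q_proj m ` X. x \<noteq> 0"
proof -
  obtain v :: 'x where v: "v \<noteq> 0" using nontrivial by blast
  obtain i :: "int ^ 'n" where i: "i \<notin> cube m" using outside_cube by blast
  have "single_seq i v \<in> Q_proj m ` X" 
    using i single(1)[of i v] unfolding Q_image by (auto simp: restrict_seq_def single_seq_def fun_eq_iff)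
  moreover have "single_seq i v \<noteq> 0" using v by (auto simp: single_seq_def fun_eq_iff)
  ultimately show ?thesis by blast
qed

lemma Q_decreasing: "Q_proj (Suc m) ` X \<subseteq> Q_proj m ` X"
proof
  fix x assume "x \<in> Q_proj (Suc m) ` X"
  then have x: "x \<in> X" "restrict_seq (- cube (Suc m)) x = x" by (auto simp: Q_image)
  have "restrict_seq (- cube m) (restrict_seq (- cube (Suc m)) x) = restrict_seq (- cube (Suc m)) x"
    using cube_mono[of m "Suc m"] unfolding restrict_restrict by (intro arg_cong2[of _ _ _ _ restrict_seq]) auto
  then show "x \<in> Q_proj m ` X" using x by (simp add: Q_image)
qed

abbreviation imQ' where "imQ' m \<equiv> adjoint_op S (Q_proj m) ` X'"

lemma adjoint_Q_mem: "g \<in> X' \<Longrightarrow> adjoint_op S (Q_proj m) g \<in> X'"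
  by (rule adjoint_op_mem[where C = 1])
    (auto simp: Q_proj_eq restrict_mem restrict_add restrict_scale restrict_le)

lemma Q'_image: "imQ' m = {g \<in> X'. \<forall>x\<in>X. g (restrict_seq (- cube m) x) = g x}"
proof (intro set_eqI iffI)
  fix g assume "g \<in> imQ' m"
  then obtain h where h: "h \<in> X'" "g = adjoint_op S (Q_proj m) h" by auto
  then show "g \<in> {g \<in> X'. \<forall>x\<in>X. g (restrict_seq (- cube m) x) = g x}"
    using adjoint_Q_mem[OF h(1)] by (auto simp: adjoint_op_def Q_proj_eq restrict_mem restrict_restrict)
next
  fix g assume g: "g \<in> {g \<in> X'. \<forall>x\<in>X. g (restrict_seq (- cube m) x) = g x}"
  then have "g = adjoint_op S (Q_proj m) g"
    by (auto simp: adjoint_op_def Q_proj_eq fun_eq_iff functional_outside)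
  then show "g \<in> imQ' m" using g by blast
qed

lemma subspace_Q': "complex_vector.subspace (imQ' m)"
proof -
  interpret D: normed_carrier "dual S" by (rule normed_carrier_dual)
  show ?thesis unfolding Q'_image
    unfolding complex_vector.subspace_def using D.zero_mem D.add_mem D.scale_mem
    by (auto simp: scaleC_fun_def)
qed

lemma Q'_subset: "imQ' m \<subseteq> X'" by (auto simp: Q'_image)

lemma Q'_nontrivial: "\<exists>g\<in>imQ' m. g \<noteq> 0"
proof -
  obtain x where x: "x \<in> Q_proj m ` X" "x \<noteq> 0" using Q_nontrivial by blast
  then have xX: "x \<in> X" "restrict_seq (- cube m) x = x" by (auto simp: Q_image)
  obtain g where g: "g \<in> X'" "g x = of_real (N x)"
    using functional_below_seminorm[of N 1 x] xX norm_triangle norm_scale by auto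
  have "adjoint_op S (Q_proj m) g x \<noteq> 0"
    using xX g norm_pos[OF xX(1) x(2)] by (simp add: adjoint_op_def Q_proj_eq)
  then have "adjoint_op S (Q_proj m) g \<noteq> 0" by auto
  then show ?thesis using g by blast
qed

lemma Q'_decreasing: "imQ' (Suc m) \<subseteq> imQ' m"
proof
  fix g assume g: "g \<in> imQ' (Suc m)"
  then have gX: "g \<in> X'" and eq: "\<And>x. x \<in> X \<Longrightarrow> g (restrict_seq (- cube (Suc m)) x) = g x"
    by (auto simp: Q'_image)
  have "g (restrict_seq (- cube m) x) = g x" if x: "x \<in> X" for x
  proof -
    have "- cube (Suc m) \<inter> - cube m = (- cube (Suc m) :: (int ^ 'n) set)" using cube_mono[of m "Suc m"] by auto
    then have "g (restrict_seq (- cube m) x) = g (restrict_seq (- cube (Suc m)) x)"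
      using eq[OF restrict_mem[OF x, of "- cube m"]] by (simp add: restrict_restrict)
    then show ?thesis using eq[OF x] by simp
  qed
  then show "g \<in> imQ' m" using gX by (simp add: Q'_image)
qed

lemma finite_basis:
  obtains b :: "'x set" where "finite b" "\<And>v. \<exists>r. v = (\<Sum>w\<in>b. r w *\<^sub>C w)"
proof -
  obtain b :: "'x set" where b: "finite b" "complex_vector.span b = UNIV" using finite_dim by blast
  show thesis
    using b complex_vector.span_finite[OF b(1)] by (intro that[of b]) auto
qed

text \<open>One bound \<open>d\<close>, the dimension of the sequences supported in the box, serves all cases. The last
  one is made for the range of an operator \<open>F\<close> such that \<open>Q_m F\<close> maps onto the range of \<open>Q_m\<close>.\<close>

lemma finite_codim:
  "\<exists>d. quotient_dim X (Q_proj m ` X) \<le> enat d \<and> quotient_dim X' (imQ' m) \<le> enat d \<and>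
     (\<forall>W. complex_vector.subspace W \<longrightarrow> (\<forall>x\<in>X. \<exists>w\<in>W. restrict_seq (- cube m) (x - w) = 0)
        \<longrightarrow> quotient_dim X W \<le> enat d)"
proof -
  obtain b :: "'x set" where b: "finite b" "\<And>v. \<exists>r. v = (\<Sum>w\<in>b. r w *\<^sub>C w)" using finite_basis by blast
  define E :: "((int ^ 'n) \<times> 'x) set" where "E = cube m \<times> b"
  define e where "e = (\<lambda>(i, w). single_seq i w :: int ^ 'n \<Rightarrow> 'x)"
  have E: "finite E" using b(1) by (simp add: E_def finite_cube)
  have span: "\<exists>c. restrict_seq (cube m) x = (\<Sum>k\<in>E. c k *\<^sub>C e k)" for x :: "int ^ 'n \<Rightarrow> 'x"
  proof -
    have "\<forall>i. \<exists>r. x i = (\<Sum>w\<in>b. r w *\<^sub>C w)" using b(2) by blast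
    then obtain r where r: "\<And>i. x i = (\<Sum>w\<in>b. r i w *\<^sub>C w)" by (auto dest!: choice)
    have "restrict_seq (cube m) x j = (\<Sum>(i, w)\<in>E. r i w *\<^sub>C single_seq i w) j" for j
    proof -
      have "(\<Sum>(i, w)\<in>E. r i w *\<^sub>C single_seq i w) j = (\<Sum>(i, w)\<in>E. r i w *\<^sub>C single_seq i w j)"
        by (simp add: sum_fun_apply scaleC_fun_def case_prod_unfold)
      also have "\<dots> = (\<Sum>i\<in>cube m. \<Sum>w\<in>b. r i w *\<^sub>C single_seq i w j)"
        by (simp add: E_def sum.cartesian_product)
      also have "\<dots> = (\<Sum>i\<in>cube m. if i = j then x j else 0)"
        by (intro sum.cong refl) (auto simp: single_seq_def r)
      finally show ?thesis by (simp add: restrict_seq_def finite_cube)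
    qed
    then have "restrict_seq (cube m) x = (\<Sum>k\<in>E. (\<lambda>(i, w). r i w) k *\<^sub>C e k)"
      by (auto simp: e_def case_prod_unfold)
    then show ?thesis by blast
  qed
  have gen: "quotient_dim X W \<le> enat (card E)"
    if W: "complex_vector.subspace W" "\<forall>x\<in>X. \<exists>w\<in>W. restrict_seq (- cube m) (x - w) = 0" for W
  proof (rule quotient_dim_le_spanning[OF W(1) E])
    fix x assume "x \<in> X"
    then obtain w where w: "w \<in> W" "restrict_seq (- cube m) (x - w) = 0" using W(2) by blast
    obtain c where c: "restrict_seq (cube m) (x - w) = (\<Sum>k\<in>E. c k *\<^sub>C e k)" using span by blast
    have "x - w = (\<Sum>k\<in>E. c k *\<^sub>C e k)"
      using restrict_split[of "cube m" "x - w"] w(2) c by simp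
    then have "x - (\<Sum>k\<in>E. c k *\<^sub>C e k) = w" by (simp add: algebra_simps)
    then show "\<exists>c. x - (\<Sum>k\<in>E. c k *\<^sub>C e k) \<in> W" using w(1) by metis
  qed
  have "quotient_dim X (Q_proj m ` X) \<le> enat (card E)"
  proof (rule gen[OF subspace_Q], rule ballI)
    fix x assume x: "x \<in> X"
    have "restrict_seq (- cube m) (x - Q_proj m x) = 0"
      by (auto simp: restrict_seq_def Q_proj_eq fun_eq_iff)
    then show "\<exists>w\<in>Q_proj m ` X. restrict_seq (- cube m) (x - w) = 0" using x by blast
  qed
  moreover have "quotient_dim X' (imQ' m) \<le> enat (card E)"
  proof (rule quotient_dim_le_annihilator[OF E, of _ "\<lambda>k g. g (e k)"])
    interpret D: normed_carrier "dual S" by (rule normed_carrier_dual)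
    fix B c assume B: "finite B" "B \<subseteq> X'" "\<forall>k\<in>E. (\<Sum>g\<in>B. c g *\<^sub>C g) (e k) = 0"
    let ?g = "\<Sum>g\<in>B. c g *\<^sub>C g"
    have g: "?g \<in> X'" using B by (intro D.sum_mem D.scale_mem) auto
    have eX: "e k \<in> X" for k by (auto simp: e_def single split: prod.split)
    have "?g (restrict_seq (- cube m) x) = ?g x" if x: "x \<in> X" for x
    proof -
      obtain c' where c': "restrict_seq (cube m) x = (\<Sum>k\<in>E. c' k *\<^sub>C e k)" using span by blast
      have "?g (restrict_seq (cube m) x) = (\<Sum>k\<in>E. c' k * ?g (e k))"
        unfolding c' by (rule functional_sum[OF g eX])
      also have "\<dots> = 0" using B(3) by simp
      finally show ?thesis
        using functional_add[OF g restrict_mem[OF x] restrict_mem[OF x], of "cube m" "- cube m"]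
        by (simp only: restrict_split) simp
    qed
    then show "?g \<in> imQ' m" using g by (simp add: Q'_image)
  qed (simp add: sum_fun_apply scaleC_fun_def scaleC_complex_def)
  ultimately show ?thesis using gen by blast
qed

end

section \<open>Compactness of bounded sets of sequences under pointwise convergence\<close>

lemma continuous_on_scaleC_left:
  fixes v :: "'x::complex_normed_vector"
  shows "continuous_on T (\<lambda>a. a *\<^sub>C v)"
proof -
  have "a *\<^sub>C v = Re a *\<^sub>R v + Im a *\<^sub>R (\<i> *\<^sub>C v)" for a
  proof -
    have "a *\<^sub>C v = (of_real (Re a) + of_real (Im a) * \<i>) *\<^sub>C v" by (metis complex_eq mult.commute)
    then show ?thesis by (simp only: scaleC_add_left scaleR_scaleC scaleC_scaleC)
  qed
  then have "(\<lambda>a. a *\<^sub>C v) = (\<lambda>a. Re a *\<^sub>R v + Im a *\<^sub>R (\<i> *\<^sub>C v))" by blast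
  then show ?thesis by (simp only:) (intro continuous_intros)
qed

lemma compact_product:
  fixes K :: "'i \<Rightarrow> 'a::topological_space set"
  assumes "\<And>i. compact (K i)"
  shows "compact (PiE UNIV K)"
proof -
  have "compactin (product_topology (\<lambda>i. euclidean) UNIV) (PiE UNIV K)"
    using assms unfolding compactin_PiE by simp
  then show ?thesis unfolding euclidean_product_topology by simp
qed

text \<open>The coordinates with respect to a basis are bounded by a multiple of the norm, because the norm
  attains a positive minimum on the compact set of vectors whose largest coordinate has modulus \<open>1\<close>.\<close>

lemma compact_cball_finite_dim:
  fixes b :: "'x::complex_normed_vector set"
  assumes "finite b" "complex_vector.span b = UNIV"
  shows "compact (cball (0::'x) r)"
proof -
  obtain B where B: "B \<subseteq> b" "complex_vector.independent B" "b \<subseteq> complex_vector.span B"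
    using complex_vector.maximal_independent_subset[of b] by blast
  have fin: "finite B" using B(1) assms(1) by (rule finite_subset)
  have span: "complex_vector.span B = UNIV"
    using complex_vector.span_minimal[OF B(3) complex_vector.subspace_span] assms(2) by auto
  define f where "f c = (\<Sum>w\<in>B. c w *\<^sub>C w)" for c
  have f_cont: "continuous_on T f" for T
    unfolding f_def
    by (intro continuous_on_sum continuous_on_compose2[OF continuous_on_scaleC_left[of UNIV]]
        continuous_on_subset[OF continuous_on_product_coordinates]) auto
  define K where "K s = PiE UNIV (\<lambda>w. if w \<in> B then cball (0::complex) s else {0})" for s
  have K: "compact (K s)" for s unfolding K_def by (intro compact_product) auto
  have onto: "\<exists>c. v = f c \<and> (\<forall>w. w \<notin> B \<longrightarrow> c w = 0)" for v :: 'x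
  proof -
    have "v \<in> complex_vector.span B" using span by simp
    then obtain c where "v = (\<Sum>w\<in>B. c w *\<^sub>C w)" using complex_vector.span_finite[OF fin] by auto
    then have "v = f (\<lambda>w. if w \<in> B then c w else 0)" by (simp add: f_def)
    then show ?thesis by (intro exI[of _ "\<lambda>w. if w \<in> B then c w else 0"]) simp
  qed
  show ?thesis
  proof (cases "B = {}")
    case True
    then have "v = 0" for v :: 'x using onto[of v] by (simp add: f_def)
    then have "cball (0::'x) r \<subseteq> {0}" by auto
    then show ?thesis by (meson finite.emptyI finite.insertI finite_imp_compact finite_subset)
  next
    case False
    define Q where "Q = K 1 \<inter> (\<Union>w\<in>B. {c. cmod (c w) = 1})"
    have "closed {c :: 'x \<Rightarrow> complex. cmod (c w) = 1}" for w
      by (intro closed_Collect_eq continuous_on_norm continuous_on_product_coordinates continuous_on_const)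
    then have Qc: "compact Q" unfolding Q_def using fin by (intro compact_Int_closed K closed_UN) auto
    obtain w0 where "w0 \<in> B" using False by blast
    then have "(\<lambda>w. if w = w0 then 1 else 0) \<in> Q" by (auto simp: Q_def K_def)
    then have "Q \<noteq> {}" by blast
    then obtain c0 where c0: "c0 \<in> Q" "\<And>c. c \<in> Q \<Longrightarrow> norm (f c0) \<le> norm (f c)"
      using continuous_attains_inf[OF Qc, of "\<lambda>c. norm (f c)"] f_cont continuous_on_norm by blast
    have pos: "norm (f c0) > 0"
    proof -
      have "f c0 \<noteq> 0"
      proof
        assume "f c0 = 0"
        then have "c0 w = 0" if "w \<in> B" for w
          using complex_vector.independentD[OF B(2) fin, of c0 w] that by (simp add: f_def)
        then show False using c0(1) by (auto simp: Q_def)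
      qed
      then show ?thesis by simp
    qed
    have "cball 0 r \<subseteq> f ` K (r / norm (f c0))"
    proof
      fix v :: 'x assume v: "v \<in> cball 0 r"
      obtain c where c: "v = f c" "\<And>w. w \<notin> B \<Longrightarrow> c w = 0" using onto by blast
      define s where "s = Max ((\<lambda>w. cmod (c w)) ` B)"
      have s: "cmod (c w) \<le> s" if "w \<in> B" for w unfolding s_def using that fin by auto
      have "s \<in> (\<lambda>w. cmod (c w)) ` B" unfolding s_def using fin False by (intro Max_in) auto
      then obtain w1 where w1: "w1 \<in> B" "cmod (c w1) = s" by auto
      have "s \<le> r / norm (f c0)"
      proof (cases "s = 0")
        case True
        have "0 \<le> r" using v norm_ge_zero[of v] by (simp only: mem_cball_0)
        then show ?thesis using True pos by simp
      next
        case False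
        then have sp: "s > 0" using w1 by (metis norm_ge_zero order_le_less)
        have "f (\<lambda>w. c w / of_real s) = (1 / of_real s) *\<^sub>C f c"
          by (simp add: f_def complex_vector.scale_sum_right scaleC_scaleC)
        then have "norm (f (\<lambda>w. c w / of_real s)) = norm v / s"
          using sp c(1) by (simp add: norm_scaleC norm_divide)
        moreover have "(\<lambda>w. c w / of_real s) \<in> Q"
          using s sp w1 c(2) by (auto simp: Q_def K_def norm_divide intro!: bexI[of _ w1])
        ultimately have "norm (f c0) \<le> norm v / s" using c0(2) by metis
        also have "\<dots> \<le> r / s" using v sp by (intro divide_right_mono) auto
        finally show ?thesis using sp pos by (simp add: field_simps)
      qed
      then have "c \<in> K (r / norm (f c0))" using s c(2) by (force simp: K_def)
      then show "v \<in> f ` K (r / norm (f c0))" using c(1) by blast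
    qed
    then have "cball 0 r = cball 0 r \<inter> f ` K (r / norm (f c0))" by blast
    moreover have "compact (cball 0 r \<inter> f ` K (r / norm (f c0)))"
      by (intro closed_Int_compact compact_continuous_image f_cont K) auto
    ultimately show ?thesis by metis
  qed
qed

lemma bounded_subsequence_pointwise:
  fixes u :: "nat \<Rightarrow> 'i::countable \<Rightarrow> 'x::real_normed_vector"
  assumes "compact (cball (0::'x) r)" "\<And>n i. norm (u n i) \<le> r"
  obtains v \<rho> where "strict_mono \<rho>" "\<And>i. (\<lambda>n. u (\<rho> n) i) \<longlonglongrightarrow> v i"
proof -
  have "compact (PiE (UNIV :: 'i set) (\<lambda>_. cball (0::'x) r))" by (intro compact_product assms(1))
  then have "seq_compact (PiE (UNIV :: 'i set) (\<lambda>_. cball (0::'x) r))"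
    by (rule compact_imp_seq_compact)
  moreover have "\<forall>n. u n \<in> PiE UNIV (\<lambda>_. cball 0 r)" using assms(2) by auto
  ultimately obtain v \<rho> where v: "strict_mono (\<rho> :: nat \<Rightarrow> nat)" "(u \<circ> \<rho>) \<longlonglongrightarrow> v"
    unfolding seq_compact_def by blast
  have "(\<lambda>n. u (\<rho> n) i) \<longlonglongrightarrow> v i" for i
    using continuous_on_tendsto_compose[OF continuous_on_product_coordinates[of i] v(2)] by simp
  then show thesis using that v(1) by blast
qed

section \<open>Operators that respect the boxes asymptotically\<close>

definition scale_seq :: "('i \<Rightarrow> real) \<Rightarrow> ('i \<Rightarrow> 'x::complex_vector) \<Rightarrow> 'i \<Rightarrow> 'x" where
  "scale_seq \<phi> x = (\<lambda>i. of_real (\<phi> i) *\<^sub>C x i)"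

context seq_space
begin

lemma normed_carrier_S: "normed_carrier S" ..

text \<open>The substitute for orthogonality: estimates on disjoint blocks add up without loss. The blocks
  of the \<open>u_j\<close> and those of \<open>x\<close> may differ, which covers block shifts.\<close>

lemma block_sum_le:
  assumes J: "finite J" and x: "x \<in> X" and C: "0 \<le> C"
    and u: "\<And>j. j \<in> J \<Longrightarrow> u j \<in> X" "\<And>j. j \<in> J \<Longrightarrow> N (u j) \<le> C * N (restrict_seq (F j) x)"
    and supp: "\<And>i j. j \<in> J \<Longrightarrow> i \<notin> E j \<Longrightarrow> u j i = 0"
    and dis: "\<And>j k. \<lbrakk>j \<in> J; k \<in> J; j \<noteq> k\<rbrakk> \<Longrightarrow> E j \<inter> E k = {} \<and> F j \<inter> F k = {}"
  shows "N (\<Sum>j\<in>J. u j) \<le> C * N x"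
proof -
  have "N (\<Sum>j\<in>J. u j) \<le> N (\<Sum>j\<in>J. of_real C *\<^sub>C restrict_seq (F j) x)"
  proof (rule disjoint_sum_mono[OF J])
    show "u j \<in> X \<and> of_real C *\<^sub>C restrict_seq (F j) x \<in> X \<and> N (u j) \<le> N (of_real C *\<^sub>C restrict_seq (F j) x)"
      if "j \<in> J" for j using u that x C by (simp add: scale_mem restrict_mem norm_scale)
    show "u j i = 0 \<or> u k i = 0" if "j \<in> J" "k \<in> J" "j \<noteq> k" for i j k
      using supp dis that by blast
    show "(of_real C *\<^sub>C restrict_seq (F j) x) i = 0 \<or> (of_real C *\<^sub>C restrict_seq (F k) x) i = 0"
      if "j \<in> J" "k \<in> J" "j \<noteq> k" for i j k
    proof -
      have "i \<notin> F j \<or> i \<notin> F k" using dis[OF that] by blast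
      then show ?thesis by (auto simp: scaleC_fun_def restrict_seq_def)
    qed
  qed
  also have "(\<Sum>j\<in>J. of_real C *\<^sub>C restrict_seq (F j) x) = of_real C *\<^sub>C (\<Sum>j\<in>J. restrict_seq (F j) x)"
    by (simp only: complex_vector.scale_sum_right)
  also have "N \<dots> = C * N (\<Sum>j\<in>J. restrict_seq (F j) x)"
    using C x by (simp only: norm_scale[OF sum_mem[OF restrict_mem[OF x]]]) simp
  also have "(\<Sum>j\<in>J. restrict_seq (F j) x) = restrict_seq (\<Union>j\<in>J. F j) x"
  proof
    fix i
    show "(\<Sum>j\<in>J. restrict_seq (F j) x) i = restrict_seq (\<Union>j\<in>J. F j) x i"
    proof (cases "\<exists>k\<in>J. i \<in> F k")
      case True
      then obtain k where k: "k \<in> J" "i \<in> F k" by blast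
      have "(\<Sum>j\<in>J. restrict_seq (F j) x i) = (\<Sum>j\<in>J. if j = k then x i else 0)"
        using dis k by (intro sum.cong refl) (auto simp: restrict_seq_def)
      then show ?thesis using k J by (auto simp: sum_fun_apply restrict_seq_def)
    next
      case False
      then show ?thesis by (auto simp: sum_fun_apply restrict_seq_def intro!: sum.neutral)
    qed
  qed
  also have "C * N (restrict_seq (\<Union>j\<in>J. F j) x) \<le> C * N x"
    using C x by (intro mult_left_mono restrict_le)
  finally show ?thesis .
qed

lemma
  assumes "x \<in> X" "\<And>i. \<bar>\<phi> i\<bar> \<le> 1"
  shows scale_seq_mem: "scale_seq \<phi> x \<in> X" and scale_seq_le: "N (scale_seq \<phi> x) \<le> N x"
proof -
  have "norm (scale_seq \<phi> x i) \<le> norm (x i)" for i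
    using mult_right_mono[OF assms(2)[of i] norm_ge_zero[of "x i"]] by (simp add: scale_seq_def norm_scaleC)
  from solid[OF assms(1) this] show "scale_seq \<phi> x \<in> X" "N (scale_seq \<phi> x) \<le> N x" by auto
qed

lemma op_norm_zero_on: "(\<And>x. x \<in> X \<Longrightarrow> f x = 0) \<Longrightarrow> op_norm S S f = 0"
proof -
  assume f: "\<And>x. x \<in> X \<Longrightarrow> f x = 0"
  have "op_norm S S f = (SUP x\<in>{x \<in> X. N x \<le> 1}. 0)"
    unfolding op_norm_def by (intro SUP_cong) (auto simp: f)
  also have "\<dots> = (0::real)" by (intro cSUP_const) (auto intro!: exI[of _ 0])
  finally show ?thesis .
qed

lemma Q_mem_imp: "Q_proj n x \<in> X \<Longrightarrow> x \<in> X"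
proof -
  assume "Q_proj n x \<in> X"
  moreover have "restrict_seq (cube n) x \<in> X"
    by (rule finite_support(1)[OF finite_cube[of n]]) (simp add: restrict_seq_def)
  ultimately have "restrict_seq (cube n) x + restrict_seq (- cube n) x \<in> X"
    by (intro add_mem) (simp_all add: Q_proj_eq)
  then show "x \<in> X" by (simp only: restrict_split)
qed

lemma Q_comp_bounded:
  assumes B: "B \<in> bounded_ops S S"
  shows "Q_proj n \<circ> B \<in> bounded_ops S S" "B \<circ> Q_proj n \<in> bounded_ops S S"
proof -
  show "Q_proj n \<circ> B \<in> bounded_ops S S"
  proof (rule bounded_opsI[where C = "op_norm S S B"])
    fix x assume x: "x \<in> X"
    show "N ((Q_proj n \<circ> B) x) \<le> op_norm S S B * N x"
      using restrict_le[OF bounded_ops_mem[OF B x], of "- cube n"] op_norm_bound[OF normed_carrier_S B x]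
      by (simp add: Q_proj_eq)
  qed (simp_all add: Q_proj_eq restrict_mem bounded_ops_mem[OF B] bounded_ops_add[OF B]
        bounded_ops_scale[OF B] bounded_ops_outside[OF B] restrict_add restrict_scale,
       simp add: restrict_seq_def fun_eq_iff)
  show "B \<circ> Q_proj n \<in> bounded_ops S S"
  proof (rule bounded_opsI[where C = "op_norm S S B"])
    fix x assume x: "x \<in> X"
    have "N (B (restrict_seq (- cube n) x)) \<le> op_norm S S B * N (restrict_seq (- cube n) x)"
      by (intro op_norm_bound[OF normed_carrier_S B] restrict_mem x)
    also have "\<dots> \<le> op_norm S S B * N x"
      by (intro mult_left_mono restrict_le x op_norm_nonneg[OF normed_carrier_S B])
    finally show "N ((B \<circ> Q_proj n) x) \<le> op_norm S S B * N x" by (simp add: Q_proj_eq)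
  next
    fix x assume "x \<notin> X"
    then have "Q_proj n x \<notin> X" using Q_mem_imp by blast
    then show "(B \<circ> Q_proj n) x = 0" by (simp add: bounded_ops_outside[OF B])
  qed (simp_all add: Q_proj_eq restrict_mem restrict_add restrict_scale bounded_ops_mem[OF B]
        bounded_ops_add[OF B] bounded_ops_scale[OF B])
qed

lemma P_compact_P: "(\<lambda>x. if x \<in> X then P_proj k x else 0) \<in> P_compact_ops S" (is "?K \<in> _")
proof -
  have K: "?K \<in> bounded_ops S S"
    by (rule bounded_opsI[where C = 1])
      (auto simp: P_proj_eq restrict_mem restrict_le restrict_add restrict_scale add_mem scale_mem)
  have "op_norm S S (Q_proj n \<circ> ?K) + op_norm S S (?K \<circ> Q_proj n) = 0" if n: "k \<le> n" for n
  proof -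
    have c: "- cube n \<inter> cube k = ({} :: (int ^ 'n) set)" "cube k \<inter> - cube n = ({} :: (int ^ 'n) set)"
      using cube_mono[OF n] by auto
    have e: "restrict_seq {} x = 0" for x :: "int ^ 'n \<Rightarrow> 'x" by (simp add: restrict_seq_def fun_eq_iff)
    have "op_norm S S (Q_proj n \<circ> ?K) = 0"
      by (rule op_norm_zero_on) (simp add: Q_proj_eq P_proj_eq restrict_restrict c e)
    moreover have "op_norm S S (?K \<circ> Q_proj n) = 0"
      by (rule op_norm_zero_on) (simp add: Q_proj_eq P_proj_eq restrict_restrict c e)
    ultimately show ?thesis by simp
  qed
  then have "(\<lambda>n. op_norm S S (Q_proj n \<circ> ?K) + op_norm S S (?K \<circ> Q_proj n)) \<longlonglongrightarrow> 0"
    by (intro tendsto_eventually eventually_sequentiallyI[of k])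
  then show ?thesis using K by (simp add: P_compact_ops_def)
qed

lemma P_compact_decay:
  assumes B: "B \<in> P_compact_ops S" and e: "0 < e"
  shows "\<exists>n0. \<forall>n\<ge>n0. \<forall>x\<in>X. N (Q_proj n (B x)) \<le> e * N x \<and> N (B (Q_proj n x)) \<le> e * N x"
proof -
  have b: "B \<in> bounded_ops S S" and lim: "(\<lambda>n. op_norm S S (Q_proj n \<circ> B) + op_norm S S (B \<circ> Q_proj n)) \<longlonglongrightarrow> 0"
    using B by (auto simp: P_compact_ops_def)
  obtain n0 where n0: "\<And>n. n \<ge> n0 \<Longrightarrow> op_norm S S (Q_proj n \<circ> B) + op_norm S S (B \<circ> Q_proj n) < e"
    using order_tendstoD(2)[OF lim e] by (auto simp: eventually_sequentially)
  have "N (Q_proj n (B x)) \<le> e * N x \<and> N (B (Q_proj n x)) \<le> e * N x" if n: "n \<ge> n0" and x: "x \<in> X" for n x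
  proof -
    note bb = Q_comp_bounded[OF b, of n]
    have le: "op_norm S S (Q_proj n \<circ> B) \<le> e" "op_norm S S (B \<circ> Q_proj n) \<le> e"
      using n0[OF n] op_norm_nonneg[OF normed_carrier_S bb(1)] op_norm_nonneg[OF normed_carrier_S bb(2)] by linarith+
    show ?thesis
      using op_norm_bound[OF normed_carrier_S bb(1) x] op_norm_bound[OF normed_carrier_S bb(2) x]
        mult_right_mono[OF le(1) norm_nonneg[OF x]] mult_right_mono[OF le(2) norm_nonneg[OF x]]
      by simp
  qed
  then show ?thesis by blast
qed

lemma LP_bounded: "A \<in> LP_ops S \<Longrightarrow> A \<in> bounded_ops S S"
  by (simp add: LP_ops_def)

lemma LP_decay:
  assumes A: "A \<in> LP_ops S" and e: "0 < e"
  shows "\<exists>n0. \<forall>n\<ge>n0. \<forall>x\<in>X. N (restrict_seq (cube k) (A (restrict_seq (- cube n) x))) \<le> e * N x \<and>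
    N (restrict_seq (- cube n) (A (restrict_seq (cube k) x))) \<le> e * N x"
proof -
  let ?K = "\<lambda>x. if x \<in> X then P_proj k x else 0"
  have AK: "A \<circ> ?K \<in> P_compact_ops S" and KA: "?K \<circ> A \<in> P_compact_ops S"
    using A P_compact_P[of k] by (auto simp: LP_ops_def)
  obtain n1 where n1: "\<And>n x. n \<ge> n1 \<Longrightarrow> x \<in> X \<Longrightarrow> N (Q_proj n ((A \<circ> ?K) x)) \<le> e * N x"
    using P_compact_decay[OF AK e] by blast
  obtain n2 where n2: "\<And>n x. n \<ge> n2 \<Longrightarrow> x \<in> X \<Longrightarrow> N ((?K \<circ> A) (Q_proj n x)) \<le> e * N x"
    using P_compact_decay[OF KA e] by blast
  show ?thesis
  proof (intro exI[of _ "max n1 n2"] allI impI ballI conjI)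
    fix n x assume n: "max n1 n2 \<le> n" and x: "x \<in> X"
    have AQ: "A (restrict_seq (- cube n) x) \<in> X" by (intro bounded_ops_mem[OF LP_bounded[OF A]] restrict_mem x)
    show "N (restrict_seq (cube k) (A (restrict_seq (- cube n) x))) \<le> e * N x"
      using n2[of n x] n x AQ by (simp add: Q_proj_eq P_proj_eq)
    show "N (restrict_seq (- cube n) (A (restrict_seq (cube k) x))) \<le> e * N x"
      using n1[of n x] n x by (simp add: Q_proj_eq P_proj_eq)
  qed
qed

text \<open>Choose boxes that grow so fast that \<open>A\<close> is almost block tridiagonal with respect to the shells
  between them, and let \<open>\<phi>\<close> decrease from \<open>1\<close> to \<open>0\<close> in \<open>M\<close> equal steps, constant on shells. In the
  commutator the diagonal blocks cancel, each of the two off-diagonals has norm at most \<open>\<parallel>A\<parallel> / M\<close>, and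
  the at most \<open>(M + 1)\<^sup>2\<close> remaining blocks have norm at most \<open>\<delta>\<close> each.\<close>

lemma approximately_commuting_cutoff:
  assumes A: "A \<in> LP_ops S" and e: "0 < e"
  shows "\<exists>\<phi> l. (\<forall>i. 0 \<le> \<phi> i \<and> \<phi> i \<le> 1) \<and> (\<forall>i\<in>cube k. \<phi> i = 1) \<and> (\<forall>i. i \<notin> cube l \<longrightarrow> \<phi> i = 0) \<and>
    (\<forall>x\<in>X. N (A (scale_seq \<phi> x) - scale_seq \<phi> (A x)) \<le> e * N x)"
proof -
  note Ab = LP_bounded[OF A]
  have AX: "x \<in> X \<Longrightarrow> A x \<in> X" for x by (rule bounded_ops_mem[OF Ab])
  define a where "a = op_norm S S A"
  have a: "0 \<le> a" unfolding a_def by (rule op_norm_nonneg[OF normed_carrier_S Ab])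
  obtain M0 :: nat where M0: "4 * a / e < real M0" using reals_Archimedean2 by blast
  define M where "M = Suc M0"
  have M: "0 < M" "4 * a / e \<le> real M" using M0 by (auto simp: M_def)
  then have M2: "2 * (a / M) \<le> e / 2" using e by (simp add: field_simps)
  define \<delta> where "\<delta> = e / (2 * (real M + 1)^2)"
  have \<delta>: "0 < \<delta>" using e by (simp add: \<delta>_def)
  have "\<forall>k. \<exists>n\<ge>k. \<forall>x\<in>X. N (restrict_seq (cube k) (A (restrict_seq (- cube n) x))) \<le> \<delta> * N x \<and>
    N (restrict_seq (- cube n) (A (restrict_seq (cube k) x))) \<le> \<delta> * N x"
  proof
    fix k
    obtain n0 where "\<And>n. n \<ge> n0 \<Longrightarrow> \<forall>x\<in>X. N (restrict_seq (cube k) (A (restrict_seq (- cube n) x))) \<le> \<delta> * N x \<and>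
      N (restrict_seq (- cube n) (A (restrict_seq (cube k) x))) \<le> \<delta> * N x"
      using LP_decay[OF A \<delta>, of k] by blast
    then show "\<exists>n\<ge>k. \<forall>x\<in>X. N (restrict_seq (cube k) (A (restrict_seq (- cube n) x))) \<le> \<delta> * N x \<and>
      N (restrict_seq (- cube n) (A (restrict_seq (cube k) x))) \<le> \<delta> * N x"
      by (intro exI[of _ "max k n0"]) simp
  qed
  then obtain nx where nx: "\<And>k. k \<le> nx k"
    "\<And>k x. x \<in> X \<Longrightarrow> N (restrict_seq (cube k) (A (restrict_seq (- cube (nx k)) x))) \<le> \<delta> * N x"
    "\<And>k x. x \<in> X \<Longrightarrow> N (restrict_seq (- cube (nx k)) (A (restrict_seq (cube k) x))) \<le> \<delta> * N x"
    by metis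
  define n where "n j = (nx ^^ j) k" for j
  have nSuc: "n (Suc j) = nx (n j)" for j by (simp add: n_def)
  have "incseq n" by (rule incseq_SucI) (simp add: nSuc nx(1))
  then have n_mono: "cube (n i) \<subseteq> (cube (n j) :: (int ^ 'n) set)" if "i \<le> j" for i j
    using that by (intro cube_mono) (rule incseqD)
  \<comment> \<open>The number of the shell that contains \<open>i\<close>; the last shell \<open>M\<close> is the complement of all boxes before.\<close>
  define \<kappa> where "\<kappa> i = (LEAST j. j = M \<or> i \<in> cube (n j))" for i :: "int ^ 'n"
  have \<kappa>M: "\<kappa> i \<le> M" for i unfolding \<kappa>_def by (rule Least_le) simp
  have \<kappa>_or: "\<kappa> i = M \<or> i \<in> cube (n (\<kappa> i))" for i
    unfolding \<kappa>_def by (rule LeastI[of _ M]) simp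
  have \<kappa>_in: "i \<in> cube (n l)" if "\<kappa> i \<le> l" "\<kappa> i < M" for i l
    using \<kappa>_or[of i] n_mono[OF that(1)] that(2) by auto
  have \<kappa>_out: "i \<notin> cube (n l)" if "l < \<kappa> i" for i l
    using not_less_Least[OF that[unfolded \<kappa>_def]] by simp
  define R :: "nat \<Rightarrow> (int ^ 'n \<Rightarrow> 'x) \<Rightarrow> int ^ 'n \<Rightarrow> 'x" where "R j = restrict_seq {i. \<kappa> i = j}" for j
  define c where "c j = 1 - real j / real M" for j
  have c01: "0 \<le> c j \<and> c j \<le> 1" if "j \<le> M" for j using that M by (simp add: c_def field_simps)
  define \<phi> where "\<phi> i = c (\<kappa> i)" for i
  have \<phi>01: "0 \<le> \<phi> i \<and> \<phi> i \<le> 1" for i using c01[OF \<kappa>M] by (simp add: \<phi>_def)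
  have \<phi>1: "\<phi> i = 1" if "i \<in> cube k" for i
  proof -
    have "\<kappa> i = 0" unfolding \<kappa>_def by (rule Least_eq_0) (simp add: n_def that)
    then show ?thesis by (simp add: \<phi>_def c_def)
  qed
  have \<phi>0: "\<phi> i = 0" if "i \<notin> cube (n M)" for i
  proof -
    have "\<kappa> i = M" using \<kappa>_in[of i M] \<kappa>M[of i] that by force
    then show ?thesis using M by (simp add: \<phi>_def c_def)
  qed
  have RX: "R j x \<in> X" "N (R j x) \<le> N x" if "x \<in> X" for j x
    using that by (simp_all add: R_def restrict_mem restrict_le)
  have R_sum: "(\<Sum>j\<le>M. R j x) = x" for x
  proof
    fix i
    have "(\<Sum>j\<le>M. R j x) i = (\<Sum>j\<le>M. if j = \<kappa> i then x i else 0)"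
      unfolding sum_fun_apply R_def by (intro sum.cong) (auto simp: restrict_seq_def)
    then show "(\<Sum>j\<le>M. R j x) i = x i" using \<kappa>M[of i] by simp
  qed
  have scale_R: "scale_seq \<phi> x = (\<Sum>j\<le>M. of_real (c j) *\<^sub>C R j x)" for x
  proof
    fix i
    have "(\<Sum>j\<le>M. of_real (c j) *\<^sub>C R j x) i = (\<Sum>j\<le>M. if j = \<kappa> i then of_real (c j) *\<^sub>C x i else 0)"
      unfolding sum_fun_apply R_def by (intro sum.cong) (auto simp: restrict_seq_def scaleC_fun_def)
    then show "scale_seq \<phi> x i = (\<Sum>j\<le>M. of_real (c j) *\<^sub>C R j x) i"
      using \<kappa>M[of i] by (simp add: scale_seq_def \<phi>_def)
  qed
  have far: "N (R l (A (R j x))) \<le> \<delta> * N x"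
    if x: "x \<in> X" and l: "l \<le> M" and j: "j \<le> M" and lj: "l + 2 \<le> j \<or> j + 2 \<le> l" for x j l
    using lj
  proof
    assume lj: "l + 2 \<le> j"
    have 1: "restrict_seq {i. \<kappa> i = l} y = restrict_seq {i. \<kappa> i = l} (restrict_seq (cube (n l)) y)" for y :: "int ^ 'n \<Rightarrow> 'x"
      using \<kappa>_in[of _ l] lj j by (auto simp: restrict_seq_def fun_eq_iff)
    have 2: "restrict_seq {i. \<kappa> i = j} x = restrict_seq (- cube (n (Suc l))) (restrict_seq {i. \<kappa> i = j} x)"
      using \<kappa>_out[of "Suc l"] lj by (auto simp: restrict_seq_def fun_eq_iff)
    have "N (R l (A (R j x))) = N (restrict_seq {i. \<kappa> i = l} (restrict_seq (cube (n l)) (A (restrict_seq (- cube (n (Suc l))) (R j x)))))"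
      unfolding R_def using 1 2 by simp
    also have "\<dots> \<le> N (restrict_seq (cube (n l)) (A (restrict_seq (- cube (n (Suc l))) (R j x))))"
      by (intro restrict_le restrict_mem AX RX x)
    also have "\<dots> \<le> \<delta> * N (R j x)" unfolding nSuc by (intro nx RX x)
    also have "\<dots> \<le> \<delta> * N x" using \<delta> by (intro mult_left_mono RX x) auto
    finally show ?thesis .
  next
    assume lj: "j + 2 \<le> l"
    have 1: "restrict_seq {i. \<kappa> i = l} y = restrict_seq {i. \<kappa> i = l} (restrict_seq (- cube (n (Suc j))) y)" for y :: "int ^ 'n \<Rightarrow> 'x"
      using \<kappa>_out[of "Suc j"] lj by (auto simp: restrict_seq_def fun_eq_iff)
    have 2: "restrict_seq {i. \<kappa> i = j} x = restrict_seq (cube (n j)) (restrict_seq {i. \<kappa> i = j} x)"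
      using \<kappa>_in[of _ j] lj l by (auto simp: restrict_seq_def fun_eq_iff)
    have "N (R l (A (R j x))) = N (restrict_seq {i. \<kappa> i = l} (restrict_seq (- cube (n (Suc j))) (A (restrict_seq (cube (n j)) (R j x)))))"
      unfolding R_def using 1 2 by simp
    also have "\<dots> \<le> N (restrict_seq (- cube (n (Suc j))) (A (restrict_seq (cube (n j)) (R j x))))"
      by (intro restrict_le restrict_mem AX RX x)
    also have "\<dots> \<le> \<delta> * N (R j x)" unfolding nSuc by (intro nx RX x)
    also have "\<dots> \<le> \<delta> * N x" using \<delta> by (intro mult_left_mono RX x) auto
    finally show ?thesis .
  qed
  have main: "N (A (scale_seq \<phi> x) - scale_seq \<phi> (A x)) \<le> e * N x" if x: "x \<in> X" for x
  proof -
    define t where "t = (\<lambda>(j, l). of_real (c j - c l) *\<^sub>C R l (A (R j x)))"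
    have tX: "t p \<in> X" for p by (auto simp: t_def split: prod.split intro!: scale_mem RX AX x)
    have "A (scale_seq \<phi> x) = (\<Sum>j\<le>M. of_real (c j) *\<^sub>C A (R j x))"
      unfolding scale_R by (intro bounded_ops_linear_sum[OF Ab] RX x)
    also have "\<dots> = (\<Sum>j\<le>M. \<Sum>l\<le>M. of_real (c j) *\<^sub>C R l (A (R j x)))"
      by (intro sum.cong refl) (simp only: complex_vector.scale_sum_right[symmetric] R_sum)
    finally have 1: "A (scale_seq \<phi> x) = (\<Sum>j\<le>M. \<Sum>l\<le>M. of_real (c j) *\<^sub>C R l (A (R j x)))" .
    have Ax: "A x = (\<Sum>j\<le>M. A (R j x))"
      by (subst bounded_ops_sum[OF Ab, symmetric]) (use RX x R_sum in auto)
    have "scale_seq \<phi> (A x) = (\<Sum>l\<le>M. of_real (c l) *\<^sub>C R l (\<Sum>j\<le>M. A (R j x)))"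
      unfolding scale_R Ax[symmetric] ..
    also have "\<dots> = (\<Sum>l\<le>M. \<Sum>j\<le>M. of_real (c l) *\<^sub>C R l (A (R j x)))"
      by (simp only: R_def restrict_sum complex_vector.scale_sum_right)
    also have "\<dots> = (\<Sum>j\<le>M. \<Sum>l\<le>M. of_real (c l) *\<^sub>C R l (A (R j x)))" by (rule sum.swap)
    finally have "A (scale_seq \<phi> x) - scale_seq \<phi> (A x) = (\<Sum>j\<le>M. \<Sum>l\<le>M. t (j, l))"
      unfolding 1 t_def by (simp only: sum_subtractf[symmetric] complex_vector.scale_left_diff_distrib[symmetric]
          of_real_diff[symmetric] case_prod_conv)
    also have "\<dots> = (\<Sum>p\<in>{..M} \<times> {..M}. t p)" by (simp only: sum.cartesian_product case_prod_eta)
    finally have eq: "A (scale_seq \<phi> x) - scale_seq \<phi> (A x) = (\<Sum>p\<in>{..M} \<times> {..M}. t p)" .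
    define U where "U = (\<lambda>l. (Suc l, l)) ` {..<M}"
    define D where "D = (\<lambda>l. (l, Suc l)) ` {..<M}"
    define Z where "Z = {..M} \<times> {..M} - (U \<union> D)"
    have UD: "U \<inter> D = {}" "U \<union> D \<subseteq> {..M} \<times> {..M}" "finite U" "finite D" by (auto simp: U_def D_def)
    have "(\<Sum>p\<in>{..M} \<times> {..M}. t p) = (\<Sum>p\<in>Z. t p) + (\<Sum>p\<in>U \<union> D. t p)"
      unfolding Z_def by (rule sum.subset_diff[OF UD(2)]) simp
    also have "(\<Sum>p\<in>U \<union> D. t p) = (\<Sum>p\<in>U. t p) + (\<Sum>p\<in>D. t p)"
      by (rule sum.union_disjoint[OF UD(3,4,1)])
    finally have eq2: "(\<Sum>p\<in>{..M} \<times> {..M}. t p) = (\<Sum>p\<in>Z. t p) + ((\<Sum>p\<in>U. t p) + (\<Sum>p\<in>D. t p))" .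
    have NA: "N (A (R j x)) \<le> a * N (R j x)" for j
      unfolding a_def by (intro op_norm_bound[OF normed_carrier_S Ab] RX x)
    have near: "N (t (j, l)) \<le> a / M * N (R j x)" if "j = Suc l \<or> l = Suc j" for j l
    proof -
      have "\<bar>c j - c l\<bar> = 1 / M" using that M by (auto simp: c_def field_simps)
      then have "N (t (j, l)) = 1 / M * N (R l (A (R j x)))"
        unfolding t_def case_prod_conv norm_scale[OF RX(1)[OF AX[OF RX(1)[OF x]]]] norm_of_real by simp
      also have "\<dots> \<le> 1 / M * (a * N (R j x))"
        using RX(2)[OF AX[OF RX(1)[OF x]]] NA[of j] by (intro mult_left_mono) (auto intro: order_trans)
      finally show ?thesis by simp
    qed
    have supp: "t (j, l) i = 0" if "i \<notin> {i. \<kappa> i = l}" for i j l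
      using that by (simp add: t_def R_def restrict_seq_def scaleC_fun_def)
    have "(\<Sum>p\<in>U. t p) = (\<Sum>l<M. t (Suc l, l))" unfolding U_def by (subst sum.reindex) (auto simp: inj_on_def)
    moreover have "N (\<Sum>l<M. t (Suc l, l)) \<le> a / M * N x"
      by (rule block_sum_le[where F = "\<lambda>l. {i. \<kappa> i = Suc l}" and E = "\<lambda>l. {i. \<kappa> i = l}"])
        (use a M x near supp tX in \<open>auto simp: R_def\<close>)
    ultimately have NU: "N (\<Sum>p\<in>U. t p) \<le> a / M * N x" by simp
    have "(\<Sum>p\<in>D. t p) = (\<Sum>l<M. t (l, Suc l))" unfolding D_def by (subst sum.reindex) (auto simp: inj_on_def)
    moreover have "N (\<Sum>l<M. t (l, Suc l)) \<le> a / M * N x"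
      by (rule block_sum_le[where F = "\<lambda>l. {i. \<kappa> i = l}" and E = "\<lambda>l. {i. \<kappa> i = Suc l}"])
        (use a M x near supp tX in \<open>auto simp: R_def\<close>)
    ultimately have ND: "N (\<Sum>p\<in>D. t p) \<le> a / M * N x" by simp
    have tZ: "N (t p) \<le> \<delta> * N x" if p: "p \<in> Z" for p
    proof -
      obtain j l where jl: "p = (j, l)" "j \<le> M" "l \<le> M" "(j, l) \<notin> U" "(j, l) \<notin> D"
        using p by (cases p) (auto simp: Z_def)
      have ne: "j \<noteq> Suc l" "l \<noteq> Suc j" using jl by (auto simp: U_def D_def)
      show ?thesis
      proof (cases "j = l")
        case True
        then have "t p = 0" by (simp add: t_def jl)
        then show ?thesis using \<delta> norm_nonneg[OF x] by simp
      next
        case False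
        then have "l + 2 \<le> j \<or> j + 2 \<le> l" using ne by linarith
        then have f: "N (R l (A (R j x))) \<le> \<delta> * N x" using far x jl by blast
        have "\<bar>c j - c l\<bar> \<le> 1" using c01[OF jl(2)] c01[OF jl(3)] by linarith
        then have "\<bar>c j - c l\<bar> * N (R l (A (R j x))) \<le> 1 * N (R l (A (R j x)))"
          by (intro mult_right_mono norm_nonneg RX AX x)
        then have "N (t p) \<le> N (R l (A (R j x)))"
          unfolding jl t_def case_prod_conv norm_scale[OF RX(1)[OF AX[OF RX(1)[OF x]]]] norm_of_real by simp
        then show ?thesis using f by linarith
      qed
    qed
    have "N (\<Sum>p\<in>Z. t p) \<le> (\<Sum>p\<in>Z. N (t p))" by (intro norm_sum tX)
    also have "\<dots> \<le> real (card Z) * (\<delta> * N x)" using tZ by (rule sum_bounded_above)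
    also have "\<dots> \<le> (real M + 1)^2 * (\<delta> * N x)"
    proof (rule mult_right_mono)
      have "card Z \<le> card ({..M} \<times> {..M})" unfolding Z_def by (intro card_mono) auto
      also have "\<dots> = Suc M ^ 2" by (simp add: card_cartesian_product power2_eq_square)
      finally have "real (card Z) \<le> real (Suc M ^ 2)" by (simp only: of_nat_le_iff)
      then show "real (card Z) \<le> (real M + 1)^2" by (simp add: add.commute)
      show "0 \<le> \<delta> * N x" using \<delta> norm_nonneg[OF x] by simp
    qed
    also have "(real M + 1)^2 * (\<delta> * N x) = e / 2 * N x"
    proof -
      have "(real M + 1)^2 > 0" by (simp add: zero_less_power)
      then have "(real M + 1)^2 * \<delta> = e / 2" unfolding \<delta>_def by (simp add: field_simps)
      then show ?thesis by (simp only: mult.assoc[symmetric])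
    qed
    finally have NZ: "N (\<Sum>p\<in>Z. t p) \<le> e / 2 * N x" .
    have m: "(\<Sum>p\<in>Z. t p) \<in> X" "(\<Sum>p\<in>U. t p) \<in> X" "(\<Sum>p\<in>D. t p) \<in> X" by (intro sum_mem tX)+
    have "N ((\<Sum>p\<in>Z. t p) + ((\<Sum>p\<in>U. t p) + (\<Sum>p\<in>D. t p)))
        \<le> N (\<Sum>p\<in>Z. t p) + N ((\<Sum>p\<in>U. t p) + (\<Sum>p\<in>D. t p))" by (intro norm_triangle add_mem m)
    also have "\<dots> \<le> N (\<Sum>p\<in>Z. t p) + (N (\<Sum>p\<in>U. t p) + N (\<Sum>p\<in>D. t p))"
      by (intro add_left_mono norm_triangle m)
    also have "\<dots> \<le> e / 2 * N x + 2 * (a / M) * N x" using NZ NU ND by linarith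
    also have "\<dots> \<le> e / 2 * N x + e / 2 * N x"
      by (intro add_left_mono mult_right_mono M2 norm_nonneg x)
    finally show ?thesis unfolding eq eq2 by simp
  qed
  show ?thesis using \<phi>01 \<phi>1 \<phi>0 main by blast
qed

end

context seq_space
begin

section \<open>Almost minimisers with finite support\<close>

text \<open>Multiply \<open>x\<close> with a cutoff function that is \<open>1\<close> where most of the norm of \<open>x\<close> is located.\<close>

lemma finite_minimiser:
  assumes A: "A \<in> LP_ops S" and x: "x \<in> Q_proj m ` X" "N x = 1" "N (A x) < c"
  shows "\<exists>y\<in>X. \<exists>l. restrict_seq (cube l - cube m) y = y \<and> N y = 1 \<and> N (A y) \<le> c"
proof -
  note Ab = LP_bounded[OF A]
  have xX: "x \<in> X" and xm: "restrict_seq (- cube m) x = x" using x by (auto simp: Q_image)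
  have AxX: "A x \<in> X" by (rule bounded_ops_mem[OF Ab xX])
  have b: "0 \<le> N (A x)" by (rule norm_nonneg[OF AxX])
  then have c: "0 < c" using x by simp
  \<comment> \<open>The solution of \<open>N (A x) + e = c (1 - e)\<close>: the image gains at most \<open>e\<close>, the vector loses at most \<open>e\<close>.\<close>
  define e where "e = (c - N (A x)) / (1 + c)"
  have e: "0 < e" using x c by (simp add: e_def)
  have ec: "e * (1 + c) = c - N (A x)" using c by (simp add: e_def)
  have e1: "e < 1"
  proof (rule ccontr)
    assume "\<not> e < 1"
    then have "1 * (1 + c) \<le> e * (1 + c)" using c by (intro mult_right_mono) auto
    then show False using ec b by simp
  qed
  obtain k where k: "N x - e < N (P_proj k x)" using norm_approx[OF xX e] by blast
  obtain \<phi> l where \<phi>: "\<And>i. 0 \<le> \<phi> i \<and> \<phi> i \<le> 1" "\<And>i. i \<in> cube k \<Longrightarrow> \<phi> i = 1"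
    "\<And>i. i \<notin> cube l \<Longrightarrow> \<phi> i = 0" "\<And>x. x \<in> X \<Longrightarrow> N (A (scale_seq \<phi> x) - scale_seq \<phi> (A x)) \<le> e * N x"
    using approximately_commuting_cutoff[OF A e, of k] by blast
  have abs\<phi>: "\<bar>\<phi> i\<bar> \<le> 1" for i using \<phi>(1)[of i] by simp
  define w where "w = scale_seq \<phi> x"
  have wX: "w \<in> X" unfolding w_def by (rule scale_seq_mem[OF xX abs\<phi>])
  have "restrict_seq (cube k) w = restrict_seq (cube k) x"
    using \<phi>(2) by (auto simp: w_def restrict_seq_def scale_seq_def fun_eq_iff scaleC_one)
  then have "1 - e < N w"
    using k restrict_le[OF wX, of "cube k"] x(2) by (simp add: P_proj_eq)
  then have Nw: "0 < N w" "1 - e < N w" using e1 by auto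
  have wsupp: "restrict_seq (cube l - cube m) w = w"
  proof (rule restrict_id)
    fix i :: "int ^ 'n" assume "i \<notin> cube l - cube m"
    then have "\<phi> i = 0 \<or> x i = 0" using \<phi>(3)[of i] fun_cong[OF xm, of i] by (auto simp: restrict_seq_def split: if_splits)
    then show "w i = 0" by (auto simp: w_def scale_seq_def)
  qed
  have "N (A w) \<le> N (scale_seq \<phi> (A x)) + N (A w - scale_seq \<phi> (A x))"
    by (intro norm_le_diff bounded_ops_mem[OF Ab] wX scale_seq_mem AxX abs\<phi>)
  also have "\<dots> \<le> N (A x) + e * 1"
    unfolding w_def using \<phi>(4)[OF xX] x(2) by (intro add_mono scale_seq_le AxX abs\<phi>) auto
  also have "\<dots> = c * (1 - e)" using ec by (simp add: algebra_simps)
  also have "\<dots> \<le> c * N w" using Nw c by (intro mult_left_mono) auto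
  finally have NAw: "N (A w) \<le> c * N w" .
  define y where "y = of_real (1 / N w) *\<^sub>C w"
  have "y \<in> X" unfolding y_def by (intro scale_mem wX)
  moreover have "restrict_seq (cube l - cube m) y = y" unfolding y_def restrict_scale wsupp ..
  moreover have "N y = 1" unfolding y_def norm_scale[OF wX] using Nw by (simp add: norm_divide)
  moreover have "N (A y) \<le> c"
    unfolding y_def bounded_ops_scale[OF Ab wX] norm_scale[OF bounded_ops_mem[OF Ab wX]]
    using Nw NAw by (simp add: norm_divide field_simps)
  ultimately show ?thesis by blast
qed

lemma restrict_functional:
  assumes g: "g \<in> X'"
  shows "(\<lambda>x. if x \<in> X then g (restrict_seq E x) else 0) \<in> X'"
proof (rule functionalI[where C = "N' g"])
  interpret D: normed_carrier "dual S" by (rule normed_carrier_dual)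
  fix x assume x: "x \<in> X"
  have "cmod (g (restrict_seq E x)) \<le> N' g * N (restrict_seq E x)" by (intro functional_bound[OF g] restrict_mem x)
  also have "\<dots> \<le> N' g * N x" by (intro mult_left_mono restrict_le x D.norm_nonneg g)
  finally show "cmod (if x \<in> X then g (restrict_seq E x) else 0) \<le> N' g * N x" using x by simp
qed (simp_all add: add_mem scale_mem restrict_add restrict_scale restrict_mem functional_add[OF g] functional_scale[OF g])

text \<open>If sequences are norm limits of their truncations, a functional is almost normed by a finitely
  supported sequence, so it survives a cutoff that is \<open>1\<close> there.\<close>

lemma finite_dual_minimiser_vanishing:
  assumes A: "A \<in> LP_ops S" and g: "g \<in> imQ' m" "N' g = 1" "N' (adjoint_op S A g) < c"
    and van: "\<forall>x\<in>X. (\<lambda>n. N (Q_proj n x)) \<longlonglongrightarrow> 0"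
  shows "\<exists>h\<in>X'. \<exists>l. (\<forall>x\<in>X. h (restrict_seq (cube l - cube m) x) = h x) \<and> N' h = 1 \<and>
    (\<forall>y\<in>X. cmod (h (A y)) \<le> c * N y)"
proof -
  interpret D: normed_carrier "dual S" by (rule normed_carrier_dual)
  note Ab = LP_bounded[OF A]
  have AX: "x \<in> X \<Longrightarrow> A x \<in> X" for x by (rule bounded_ops_mem[OF Ab])
  have gX: "g \<in> X'" and gm: "\<And>x. x \<in> X \<Longrightarrow> g (restrict_seq (- cube m) x) = g x" using g by (auto simp: Q'_image)
  define b where "b = N' (adjoint_op S A g)"
  have AgX: "adjoint_op S A g \<in> X'" by (rule adjoint_op_bounded(2)[OF Ab gX])
  have b: "0 \<le> b" "b < c" using D.norm_nonneg[OF AgX] g by (auto simp: b_def)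
  have gA: "cmod (g (A y)) \<le> b * N y" if "y \<in> X" for y
    using functional_bound[OF AgX that] that by (simp add: b_def adjoint_op_def)
  have gle: "cmod (g y) \<le> N y" if "y \<in> X" for y using functional_bound[OF gX that] g by simp
  have c: "0 < c" using b by simp
  \<comment> \<open>The solution of \<open>b + e = c (1 - 2 e)\<close>; the norm of the functional drops by at most \<open>2 e\<close>.\<close>
  define e where "e = (c - b) / (1 + 2 * c)"
  have e: "0 < e" using b c by (simp add: e_def)
  have ec: "e * (1 + 2 * c) = c - b" using c by (simp add: e_def)
  have e1: "2 * e < 1"
  proof (rule ccontr)
    assume "\<not> 2 * e < 1"
    then have "1 * (1 + 2 * c) \<le> (2 * e) * (1 + 2 * c)" using c by (intro mult_right_mono) auto
    moreover have "(2 * e) * (1 + 2 * c) = 2 * (c - b)" using ec by (simp only: mult.assoc)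
    ultimately have "1 * (1 + 2 * c) \<le> 2 * (c - b)" by (simp only:)
    then show False using b by simp
  qed
  obtain x where x: "x \<in> X" "N x \<le> 1" "1 - e < cmod (g x)"
    using functional_norming[OF gX, of "1 - e"] g(2) e by auto
  obtain k where k: "N (Q_proj k x) < e"
    using order_tendstoD(2)[OF bspec[OF van x(1)] e] by (auto simp: eventually_sequentially)
  obtain \<phi> l where \<phi>: "\<And>i. 0 \<le> \<phi> i \<and> \<phi> i \<le> 1" "\<And>i. i \<in> cube k \<Longrightarrow> \<phi> i = 1"
    "\<And>i. i \<notin> cube l \<Longrightarrow> \<phi> i = 0" "\<And>x. x \<in> X \<Longrightarrow> N (A (scale_seq \<phi> x) - scale_seq \<phi> (A x)) \<le> e * N x"
    using approximately_commuting_cutoff[OF A e, of k] by blast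
  have abs\<phi>: "\<bar>\<phi> i\<bar> \<le> 1" for i using \<phi>(1)[of i] by simp
  have sX: "scale_seq \<phi> y \<in> X" "N (scale_seq \<phi> y) \<le> N y" if "y \<in> X" for y
    using scale_seq_mem[OF that abs\<phi>] scale_seq_le[OF that abs\<phi>] by auto
  define h where "h y = (if y \<in> X then g (scale_seq \<phi> y) else 0)" for y
  have hX: "h \<in> X'"
  proof (rule functionalI[where C = 1])
    fix y z assume yz: "y \<in> X" "z \<in> X"
    have "scale_seq \<phi> (y + z) = scale_seq \<phi> y + scale_seq \<phi> z"
      by (simp add: scale_seq_def fun_eq_iff scaleC_add_right)
    then show "h (y + z) = h y + h z" using yz by (simp add: h_def add_mem functional_add[OF gX] sX)
  next
    fix a y assume y: "y \<in> X"
    have "scale_seq \<phi> (a *\<^sub>C y) = a *\<^sub>C scale_seq \<phi> y"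
      by (simp add: scale_seq_def fun_eq_iff scaleC_fun_def mult.commute)
    then show "h (a *\<^sub>C y) = a * h y" using y by (simp add: h_def scale_mem functional_scale[OF gX] sX)
  next
    fix y assume y: "y \<in> X"
    show "cmod (h y) \<le> 1 * N y" using gle[OF sX(1)[OF y]] sX(2)[OF y] y by (simp add: h_def)
  qed (simp add: h_def)
  have hsupp: "h (restrict_seq (cube l - cube m) y) = h y" if y: "y \<in> X" for y
  proof -
    have "scale_seq \<phi> (restrict_seq (cube l - cube m) y) = restrict_seq (- cube m) (scale_seq \<phi> y)"
      using \<phi>(3) by (auto simp: scale_seq_def restrict_seq_def fun_eq_iff)
    then show ?thesis using y by (simp add: h_def restrict_mem gm sX)
  qed
  have PX: "restrict_seq (cube k) x \<in> X" "N (restrict_seq (cube k) x) \<le> 1"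
    using x restrict_le[OF x(1), of "cube k"] by (auto simp: restrict_mem)
  have "scale_seq \<phi> (restrict_seq (cube k) x) = restrict_seq (cube k) x"
    using \<phi>(2) by (auto simp: scale_seq_def restrict_seq_def fun_eq_iff scaleC_one)
  then have "h (restrict_seq (cube k) x) = g (restrict_seq (cube k) x)" using PX by (simp add: h_def)
  moreover have "g (restrict_seq (cube k) x) + g (restrict_seq (- cube k) x) = g x"
    using functional_add[OF gX, of "restrict_seq (cube k) x" "restrict_seq (- cube k) x"] x(1)
    by (simp only: restrict_mem restrict_split)
  moreover have "cmod (g (restrict_seq (- cube k) x)) < e"
    using gle[OF restrict_mem[OF x(1)], of "- cube k"] k by (simp add: Q_proj_eq)
  ultimately have "1 - 2 * e < cmod (h (restrict_seq (cube k) x))"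
    using x(3) norm_triangle_ineq[of "g (restrict_seq (cube k) x)" "g (restrict_seq (- cube k) x)"] by simp
  also have "\<dots> \<le> N' h * N (restrict_seq (cube k) x)" by (rule functional_bound[OF hX PX(1)])
  also have "\<dots> \<le> N' h * 1" by (intro mult_left_mono PX D.norm_nonneg hX)
  finally have Nh: "1 - 2 * e < N' h" by simp
  then have Nh0: "0 < N' h" using e1 by simp
  have hA: "cmod (h (A y)) \<le> c * N' h * N y" if y: "y \<in> X" for y
  proof -
    have "g (scale_seq \<phi> (A y)) = g (A (scale_seq \<phi> y)) - g (A (scale_seq \<phi> y) - scale_seq \<phi> (A y))"
      using y by (simp add: functional_diff[OF gX] AX sX)
    then have "cmod (h (A y)) \<le> cmod (g (A (scale_seq \<phi> y))) + cmod (g (A (scale_seq \<phi> y) - scale_seq \<phi> (A y)))"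
      using AX[OF y] norm_triangle_ineq4 by (simp add: h_def)
    also have "\<dots> \<le> b * N (scale_seq \<phi> y) + N (A (scale_seq \<phi> y) - scale_seq \<phi> (A y))"
      by (intro add_mono gA gle diff_mem AX sX y)
    also have "\<dots> \<le> b * N y + e * N y"
      by (intro add_mono mult_left_mono sX y b \<phi>(4))
    also have "\<dots> = (b + e) * N y" by (simp add: algebra_simps)
    also have "b + e = c * (1 - 2 * e)" using ec by (simp add: algebra_simps)
    also have "c * (1 - 2 * e) * N y \<le> c * N' h * N y"
      using Nh c by (intro mult_right_mono mult_left_mono norm_nonneg y) auto
    finally show ?thesis .
  qed
  define f where "f = of_real (1 / N' h) *\<^sub>C h"
  have fv: "f y = of_real (1 / N' h) * h y" for y by (simp add: f_def scaleC_fun_def scaleC_complex_def)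
  show ?thesis
  proof (intro bexI[of _ f] exI[of _ l] conjI ballI)
    show "f \<in> X'" unfolding f_def by (intro D.scale_mem hX)
    show "N' f = 1" unfolding f_def D.norm_scale[OF hX] using Nh0 by (simp add: norm_divide)
    show "f (restrict_seq (cube l - cube m) y) = f y" if "y \<in> X" for y by (simp add: fv hsupp[OF that])
    show "cmod (f (A y)) \<le> c * N y" if "y \<in> X" for y
      using hA[OF that] Nh0 by (simp add: fv norm_mult norm_divide field_simps)
  qed
qed

text \<open>On bounded sets, \<open>A\<close> is continuous for pointwise convergence: each coordinate of \<open>A w\<close> depends, up to
  a small error, only on finitely many coordinates of \<open>w\<close>.\<close>

lemma bounded_pointwise_null_image:
  assumes A: "A \<in> LP_ops S" and w: "\<And>n. w n \<in> X" "\<And>n. N (w n) \<le> C"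
    and null: "\<And>i. (\<lambda>n. w n i) \<longlonglongrightarrow> 0"
  shows "(\<lambda>n. A (w n) i) \<longlonglongrightarrow> 0"
proof (rule LIMSEQ_I)
  note Ab = LP_bounded[OF A]
  have AX: "x \<in> X \<Longrightarrow> A x \<in> X" for x by (rule bounded_ops_mem[OF Ab])
  fix r :: real assume r: "0 < r"
  have C: "0 \<le> C" using w(2)[of 0] norm_nonneg[OF w(1)[of 0]] by simp
  define e where "e = r / (2 * (C + 1))"
  have e: "0 < e" using r C by (simp add: e_def)
  have eC: "e * C < r / 2"
  proof -
    have "e * C < e * (C + 1)" using e by simp
    also have "e * (C + 1) = r / 2" using C by (simp add: e_def field_simps)
    finally show ?thesis .
  qed
  obtain k where k: "i \<in> cube k" using finite_subset_cube[of "{i}"] by auto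
  obtain l where l: "\<And>x. x \<in> X \<Longrightarrow> N (restrict_seq (cube k) (A (restrict_seq (- cube l) x))) \<le> e * N x"
    using LP_decay[OF A e, of k] by blast
  have "(\<lambda>n. op_norm S S A * (\<Sum>j\<in>cube l. norm (w n j))) \<longlonglongrightarrow> op_norm S S A * (\<Sum>j\<in>(cube l :: (int ^ 'n) set). norm (0::'x))"
    by (intro tendsto_mult tendsto_const tendsto_sum tendsto_norm null)
  then have "(\<lambda>n. op_norm S S A * (\<Sum>j\<in>cube l. norm (w n j))) \<longlonglongrightarrow> 0" by simp
  then obtain n0 where n0: "\<And>n. n \<ge> n0 \<Longrightarrow> op_norm S S A * (\<Sum>j\<in>cube l. norm (w n j)) < r / 2"
    using order_tendstoD(2)[of _ 0 sequentially "r / 2"] r by (auto simp: eventually_sequentially)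
  show "\<exists>n0. \<forall>n\<ge>n0. norm (A (w n) i - 0) < r"
  proof (intro exI allI impI)
    fix n assume n: "n0 \<le> n"
    have PX: "restrict_seq (cube l) (w n) \<in> X" "restrict_seq (- cube l) (w n) \<in> X" by (intro restrict_mem w)+
    have "A (w n) = A (restrict_seq (cube l) (w n)) + A (restrict_seq (- cube l) (w n))"
      by (subst bounded_ops_add[OF Ab PX, symmetric]) (simp only: restrict_split)
    then have "A (w n) i = A (restrict_seq (cube l) (w n)) i + restrict_seq (cube k) (A (restrict_seq (- cube l) (w n))) i"
      using k by (simp add: restrict_seq_def)
    then have "norm (A (w n) i) \<le> norm (A (restrict_seq (cube l) (w n)) i)
        + norm (restrict_seq (cube k) (A (restrict_seq (- cube l) (w n))) i)"
      by (metis norm_triangle_ineq)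
    also have "\<dots> \<le> N (A (restrict_seq (cube l) (w n))) + N (restrict_seq (cube k) (A (restrict_seq (- cube l) (w n))))"
      by (intro add_mono coordinate_le restrict_mem AX PX)
    also have "\<dots> \<le> op_norm S S A * N (restrict_seq (cube l) (w n)) + e * N (w n)"
      by (intro add_mono op_norm_bound[OF normed_carrier_S Ab] PX l w)
    also have "\<dots> \<le> op_norm S S A * (\<Sum>j\<in>cube l. norm (w n j)) + e * C"
    proof (intro add_mono mult_left_mono)
      have "N (restrict_seq (cube l) (w n)) \<le> (\<Sum>j\<in>cube l. norm (restrict_seq (cube l) (w n) j))"
        by (rule finite_support(2)[OF finite_cube]) (simp add: restrict_seq_def)
      then show "N (restrict_seq (cube l) (w n)) \<le> (\<Sum>j\<in>cube l. norm (w n j))" by (simp add: restrict_seq_def)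
    qed (use w e op_norm_nonneg[OF normed_carrier_S Ab] in auto)
    also have "\<dots> < r" using n0[OF n] eC by simp
    finally show "norm (A (w n) i - 0) < r" by simp
  qed
qed

text \<open>A functional on \<open>l\<^sup>\<infinity>\<close> may vanish on all finitely supported sequences, so cutting off is useless.
  Suppose that no finitely supported functional qualifies. Then for each \<open>x\<close> in the unit ball the
  equation \<open>A u = x\<close> has approximate solutions of norm at most about \<open>1 / c\<close> on every box outside \<open>cube m\<close>
  (\<open>approximate_solution\<close>). A pointwise limit of them solves it everywhere outside \<open>cube m\<close>, and
  \<open>\<bar>g x\<bar> = \<bar>g (A u)\<bar> \<le> \<parallel>A\<^sup>* g\<parallel> \<parallel>u\<parallel>\<close> is at most about \<open>\<parallel>A\<^sup>* g\<parallel> / c < 1\<close> for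
  all such \<open>x\<close>, which contradicts \<open>\<parallel>g\<parallel> = 1\<close>.\<close>

lemma finite_dual_minimiser_closed:
  assumes A: "A \<in> LP_ops S" and g: "g \<in> imQ' m" "N' g = 1" "N' (adjoint_op S A g) < c"
    and closed: "\<forall>x C. (\<forall>n. N (P_proj n x) \<le> C) \<longrightarrow> x \<in> X"
  shows "\<exists>h\<in>X'. \<exists>l. (\<forall>x\<in>X. h (restrict_seq (cube l - cube m) x) = h x) \<and> N' h = 1 \<and>
    (\<forall>y\<in>X. cmod (h (A y)) \<le> c * N y)"
proof (rule ccontr)
  assume neg: "\<not> ?thesis"
  interpret D: normed_carrier "dual S" by (rule normed_carrier_dual)
  note Ab = LP_bounded[OF A]
  have AX: "x \<in> X \<Longrightarrow> A x \<in> X" for x by (rule bounded_ops_mem[OF Ab])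
  have gX: "g \<in> X'" and gm: "\<And>x. x \<in> X \<Longrightarrow> g (restrict_seq (- cube m) x) = g x" using g by (auto simp: Q'_image)
  define b where "b = N' (adjoint_op S A g)"
  have AgX: "adjoint_op S A g \<in> X'" by (rule adjoint_op_bounded(2)[OF Ab gX])
  have b: "0 \<le> b" "b < c" using D.norm_nonneg[OF AgX] g by (auto simp: b_def)
  have gA: "cmod (g (A y)) \<le> b * N y" if "y \<in> X" for y
    using functional_bound[OF AgX that] that by (simp add: b_def adjoint_op_def)
  have c: "0 < c" using b by simp
  have small: "N' h \<le> 1 / c"
    if h: "h \<in> X'" "\<And>x. x \<in> X \<Longrightarrow> h (restrict_seq (cube l - cube m) x) = h x"
      "\<And>y. y \<in> X \<Longrightarrow> cmod (h (A y)) \<le> N y" for h l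
  proof (rule ccontr)
    assume "\<not> N' h \<le> 1 / c"
    then have Nh: "1 / c < N' h" by simp
    then have Nh0: "0 < N' h" using c by (meson less_trans zero_less_divide_1_iff)
    have ch: "1 \<le> c * N' h" using Nh c by (simp add: field_simps)
    define f where "f = of_real (1 / N' h) *\<^sub>C h"
    have fv: "f y = of_real (1 / N' h) * h y" for y by (simp add: f_def scaleC_fun_def scaleC_complex_def)
    have "\<exists>h\<in>X'. \<exists>l. (\<forall>x\<in>X. h (restrict_seq (cube l - cube m) x) = h x) \<and> N' h = 1 \<and>
      (\<forall>y\<in>X. cmod (h (A y)) \<le> c * N y)"
    proof (intro bexI[of _ f] exI[of _ l] conjI ballI)
      show "f \<in> X'" unfolding f_def by (intro D.scale_mem h)
      show "N' f = 1" unfolding f_def D.norm_scale[OF h(1)] using Nh0 by (simp add: norm_divide)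
      show "f (restrict_seq (cube l - cube m) y) = f y" if "y \<in> X" for y by (simp add: fv h(2)[OF that])
      show "cmod (f (A y)) \<le> c * N y" if y: "y \<in> X" for y
      proof -
        have "cmod (h (A y)) \<le> 1 * N y" using h(3)[OF y] by simp
        also have "\<dots> \<le> c * N' h * N y" by (intro mult_right_mono ch norm_nonneg y)
        finally show ?thesis using Nh0 by (simp add: fv norm_mult norm_divide field_simps)
      qed
    qed
    then show False using neg by blast
  qed
  \<comment> \<open>Slack small enough that \<open>b (1 / c + \<eta>) < 1\<close>.\<close>
  define \<eta> where "\<eta> = (1 - b / c) / (2 * (b + 1))"
  have bc: "b / c < 1" using b c by simp
  have \<eta>: "0 < \<eta>" using bc b by (simp add: \<eta>_def)
  have "b * \<eta> \<le> (b + 1) * \<eta>" using \<eta> by (intro mult_right_mono) auto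
  also have "(b + 1) * \<eta> = (1 - b / c) / 2" using b(1) by (simp add: \<eta>_def field_simps)
  also have "\<dots> < 1 - b / c" using bc by simp
  finally have b\<eta>: "b * \<eta> < 1 - b / c" .
  define r where "r = 1 / c + \<eta>"
  have br: "b * r < 1" using b\<eta> by (simp add: r_def algebra_simps)
  obtain x where x: "x \<in> X" "N x \<le> 1" "b * r < cmod (g x)"
    using functional_norming[OF gX, of "b * r"] g(2) br by auto
  let ?R = "\<lambda>n. restrict_seq (cube n - cube m)"
  have "\<exists>u\<in>X. N u \<le> r \<and> N (?R n x - ?R n (A u)) \<le> \<eta> / Suc n" for n
  proof -
    define T where "T y = ?R n (A y)" for y
    have T: "T \<in> bounded_ops S S"
    proof (rule bounded_opsI[where C = "op_norm S S A"])
      fix y assume y: "y \<in> X"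
      show "N (T y) \<le> op_norm S S A * N y"
        unfolding T_def using restrict_le[OF AX[OF y]] op_norm_bound[OF normed_carrier_S Ab y] by (rule order_trans)
    qed (simp_all add: T_def restrict_mem AX bounded_ops_add[OF Ab] bounded_ops_scale[OF Ab]
        bounded_ops_outside[OF Ab] restrict_add restrict_scale, simp add: restrict_seq_def fun_eq_iff)
    have zX: "?R n x \<in> X" by (intro restrict_mem x)
    have Nz: "N (?R n x) \<le> 1" using restrict_le[OF x(1), of "cube n - cube m"] x(2) by linarith
    have "0 < \<eta> / Suc n" using \<eta> by simp
    then obtain u where u: "u \<in> X" "N u \<le> N (?R n x) / c + \<eta> / Suc n" "N (?R n x - T u) \<le> \<eta> / Suc n"
    proof (rule approximate_solution[OF T zX c])
      fix f assume f: "f \<in> X'" "\<And>y. y \<in> X \<Longrightarrow> cmod (f (T y)) \<le> N y"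
      define h where "h y = (if y \<in> X then f (?R n y) else 0)" for y
      have hX: "h \<in> X'" unfolding h_def by (rule restrict_functional[OF f(1)])
      have "N' h \<le> 1 / c"
        by (rule small[OF hX, of n]) (use f(2) in \<open>auto simp: h_def restrict_mem restrict_restrict AX T_def\<close>)
      then have "N' h * N (?R n x) \<le> 1 / c * N (?R n x)" by (intro mult_right_mono norm_nonneg zX)
      moreover have "f (?R n x) = h (?R n x)" using zX by (simp add: h_def restrict_restrict)
      ultimately show "cmod (f (?R n x)) \<le> N (?R n x) / c" using functional_bound[OF hX zX] by simp
    qed
    have "\<eta> / Suc n \<le> \<eta>" using \<eta> by (simp add: field_simps)
    moreover have "N (?R n x) / c \<le> 1 / c" using Nz c by (simp add: divide_right_mono)
    ultimately have "N u \<le> r" using u(2) by (simp add: r_def)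
    then show ?thesis using u by (auto simp: T_def)
  qed
  then obtain u where u: "\<And>n. u n \<in> X" "\<And>n. N (u n) \<le> r" "\<And>n. N (?R n x - ?R n (A (u n))) \<le> \<eta> / Suc n"
    by metis
  have "compact (cball (0::'x) r)" using finite_dim compact_cball_finite_dim by blast
  moreover have "norm (u n i) \<le> r" for n i using coordinate_le[OF u(1)] u(2) by (rule order_trans)
  ultimately obtain v \<rho> where \<rho>: "strict_mono \<rho>" "\<And>i. (\<lambda>n. u (\<rho> n) i) \<longlonglongrightarrow> v i"
    using bounded_subsequence_pointwise[of r u] by blast
  have Pv: "N (restrict_seq (cube k) v) \<le> r" for k
  proof -
    have fs: "restrict_seq (cube k) y \<in> X" for y :: "int ^ 'n \<Rightarrow> 'x"
      by (rule finite_support(1)[OF finite_cube[of k]]) (simp add: restrict_seq_def)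
    have "N (restrict_seq (cube k) v) \<le> r + (\<Sum>i\<in>cube k. norm (v i - u (\<rho> n) i))" for n
    proof -
      have "N (restrict_seq (cube k) v) \<le> N (restrict_seq (cube k) (u (\<rho> n)))
          + N (restrict_seq (cube k) v - restrict_seq (cube k) (u (\<rho> n)))"
        by (intro norm_le_diff fs)
      also have "N (restrict_seq (cube k) (u (\<rho> n))) \<le> r"
        using restrict_le[OF u(1)] u(2) by (rule order_trans)
      also have "N (restrict_seq (cube k) v - restrict_seq (cube k) (u (\<rho> n)))
          \<le> (\<Sum>i\<in>cube k. norm ((restrict_seq (cube k) v - restrict_seq (cube k) (u (\<rho> n))) i))"
        by (rule finite_support(2)[OF finite_cube]) (simp add: restrict_seq_def)
      finally show ?thesis by (simp add: restrict_seq_def)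
    qed
    moreover have "(\<lambda>n. r + (\<Sum>i\<in>cube k. norm (v i - u (\<rho> n) i))) \<longlonglongrightarrow> r + (\<Sum>i\<in>cube k. norm (v i - v i))"
      by (intro tendsto_add tendsto_const tendsto_sum tendsto_norm tendsto_diff \<rho>)
    ultimately show ?thesis
      using LIMSEQ_le_const[of "\<lambda>n. r + (\<Sum>i\<in>cube k. norm (v i - u (\<rho> n) i))" r] by auto
  qed
  then have vX: "v \<in> X" using closed by (auto simp: P_proj_eq)
  have Nv: "N v \<le> r"
  proof (rule field_le_epsilon)
    fix e :: real assume "0 < e"
    then obtain n where "N v - e < N (P_proj n v)" using norm_approx[OF vX] by blast
    then show "N v \<le> r + e" using Pv[of n] by (simp add: P_proj_eq)
  qed
  have "A v i = x i" if i: "i \<notin> cube m" for i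
  proof -
    have "(\<lambda>n. A (u (\<rho> n) - v) i) \<longlonglongrightarrow> 0"
    proof (rule bounded_pointwise_null_image[OF A])
      show "u (\<rho> n) - v \<in> X" for n by (intro diff_mem u vX)
      show "N (u (\<rho> n) - v) \<le> r + r" for n
        using norm_diff[OF u(1) vX, of "\<rho> n"] u(2)[of "\<rho> n"] Nv by linarith
      show "(\<lambda>n. (u (\<rho> n) - v) j) \<longlonglongrightarrow> 0" for j
        using tendsto_diff[OF \<rho>(2) tendsto_const, of j "v j"] by simp
    qed
    then have "(\<lambda>n. A (u (\<rho> n)) i - A v i) \<longlonglongrightarrow> 0" by (simp add: bounded_ops_diff[OF Ab] u vX)
    then have 1: "(\<lambda>n. A (u (\<rho> n)) i) \<longlonglongrightarrow> A v i" by (simp add: LIM_zero_cancel)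
    obtain k where k: "i \<in> cube k" using finite_subset_cube[of "{i}"] by auto
    have "(\<lambda>n. A (u n) i) \<longlonglongrightarrow> x i"
    proof (rule LIM_zero_cancel, rule Lim_null_comparison)
      have "norm (A (u n) i - x i) \<le> \<eta> / Suc n" if "k \<le> n" for n
      proof -
        have "i \<in> cube n - cube m" using k i cube_mono[OF that] by blast
        then have "norm (A (u n) i - x i) = norm ((?R n x - ?R n (A (u n))) i)"
          by (simp add: restrict_seq_def norm_minus_commute)
        also have "\<dots> \<le> N (?R n x - ?R n (A (u n)))" by (intro coordinate_le diff_mem restrict_mem x AX u)
        finally show ?thesis using u(3)[of n] by linarith
      qed
      then show "\<forall>\<^sub>F n in sequentially. norm (A (u n) i - x i) \<le> \<eta> / Suc n"
        by (intro eventually_sequentiallyI[of k])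
      have "(\<lambda>n. \<eta> * inverse (real (Suc n))) \<longlonglongrightarrow> \<eta> * 0" by (intro tendsto_intros LIMSEQ_inverse_real_of_nat)
      then show "(\<lambda>n. \<eta> / Suc n) \<longlonglongrightarrow> 0" by (simp add: divide_inverse)
    qed
    then have "(\<lambda>n. A (u (\<rho> n)) i) \<longlonglongrightarrow> x i"
      using LIMSEQ_subseq_LIMSEQ[OF _ \<rho>(1)] by (auto simp: o_def)
    with 1 show ?thesis by (rule LIMSEQ_unique)
  qed
  then have "restrict_seq (- cube m) (A v) = restrict_seq (- cube m) x"
    by (auto simp: restrict_seq_def fun_eq_iff)
  then have "g x = g (A v)" using gm[OF x(1)] gm[OF AX[OF vX]] by simp
  then have "cmod (g x) \<le> b * N v" using gA[OF vX] by simp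
  also have "\<dots> \<le> b * r" by (intro mult_left_mono Nv b)
  finally show False using x(3) by simp
qed

lemma finite_dual_minimiser:
  assumes "A \<in> LP_ops S" "g \<in> imQ' m" "N' g = 1" "N' (adjoint_op S A g) < c"
  shows "\<exists>h\<in>X'. \<exists>l. (\<forall>x\<in>X. h (restrict_seq (cube l - cube m) x) = h x) \<and> N' h = 1 \<and>
    (\<forall>y\<in>X. cmod (h (A y)) \<le> c * N y)"
  using vanishing_or_closed finite_dual_minimiser_vanishing[OF assms] finite_dual_minimiser_closed[OF assms]
  by blast

end

context seq_space
begin

section \<open>Gliding humps\<close>

lemma restrict_shell_split:
  assumes "n \<le> n'"
  shows "x = restrict_seq (cube n' - cube n) x + (restrict_seq (cube n) x + restrict_seq (- cube n') (x :: int ^ 'n \<Rightarrow> 'x))"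
proof
  fix i :: "int ^ 'n"
  have "i \<in> cube n \<longrightarrow> i \<in> cube n'" using cube_mono[OF assms] by blast
  then show "x i = (restrict_seq (cube n' - cube n) x + (restrict_seq (cube n) x + restrict_seq (- cube n') x)) i"
    by (auto simp: restrict_seq_def)
qed

text \<open>A vector supported far enough out has an image that is small on \<open>cube n\<close>; since it has finite
  support, its image is also almost contained in a larger box.\<close>

lemma hump:
  assumes A: "A \<in> LP_ops S" and \<eta>: "0 < \<eta>"
    and small: "\<And>m. \<exists>x\<in>Q_proj m ` X. N x = 1 \<and> N (A x) < c"
  shows "\<exists>n'\<ge>n. \<exists>x\<in>X. restrict_seq (cube n' - cube n) x = x \<and> N x = 1 \<and> N (A x) \<le> c \<and>
    N (A x - restrict_seq (cube n' - cube n) (A x)) \<le> \<eta>"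
proof -
  note Ab = LP_bounded[OF A]
  have \<eta>2: "0 < \<eta> / 2" using \<eta> by simp
  obtain m where m: "n \<le> m" "\<And>x. x \<in> X \<Longrightarrow> N (restrict_seq (cube n) (A (restrict_seq (- cube m) x))) \<le> \<eta> / 2 * N x"
    using LP_decay[OF A \<eta>2, of n] by (metis max.cobounded1 max.cobounded2)
  obtain x0 where x0: "x0 \<in> Q_proj m ` X" "N x0 = 1" "N (A x0) < c" using small by blast
  obtain x l where x: "x \<in> X" "restrict_seq (cube l - cube m) x = x" "N x = 1" "N (A x) \<le> c"
    using finite_minimiser[OF A x0] by blast
  obtain n1 where n1: "\<And>k y. k \<ge> n1 \<Longrightarrow> y \<in> X \<Longrightarrow> N (restrict_seq (- cube k) (A (restrict_seq (cube l) y))) \<le> \<eta> / 2 * N y"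
    using LP_decay[OF A \<eta>2, of l] by blast
  define n' where "n' = max n (max l n1)"
  have n': "n \<le> n'" "l \<le> n'" "n1 \<le> n'" by (auto simp: n'_def)
  have xv: "x i = 0" if "i \<notin> cube l - cube m" for i
    using fun_cong[OF x(2), of i] that by (simp add: restrict_seq_def split: if_splits)
  have xl: "restrict_seq (cube l) x = x" by (rule restrict_id) (use xv in auto)
  have xm: "restrict_seq (- cube m) x = x" by (rule restrict_id) (use xv in auto)
  have xn: "restrict_seq (cube n' - cube n) x = x"
    by (rule restrict_id) (use xv cube_mono[OF n'(2)] cube_mono[OF m(1)] in blast)
  have Ax: "A x \<in> X" by (rule bounded_ops_mem[OF Ab x(1)])
  have eq: "A x - restrict_seq (cube n' - cube n) (A x) = restrict_seq (cube n) (A x) + restrict_seq (- cube n') (A x)"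
    using restrict_shell_split[OF n'(1), of "A x"] by (metis add_diff_cancel_left')
  have "N (restrict_seq (cube n) (A x) + restrict_seq (- cube n') (A x)) \<le> N (restrict_seq (cube n) (A x)) + N (restrict_seq (- cube n') (A x))"
    by (intro norm_triangle restrict_mem Ax)
  also have "\<dots> \<le> \<eta> / 2 * 1 + \<eta> / 2 * 1"
    using m(2)[OF x(1)] n1[OF n'(3) x(1)] unfolding xl xm x(3) by (rule add_mono)
  finally have "N (A x - restrict_seq (cube n' - cube n) (A x)) \<le> \<eta>" unfolding eq by simp
  then show ?thesis using n' x xn by blast
qed

lemma shells_disjoint:
  assumes "\<And>k. k \<le> nx k"
  defines "D \<equiv> \<lambda>j. cube ((nx ^^ Suc j) 0) - (cube ((nx ^^ j) 0) :: (int ^ 'n) set)"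
  shows "j \<noteq> k \<Longrightarrow> D j \<inter> D k = {}"
proof -
  have "incseq (\<lambda>j. (nx ^^ j) 0)" by (rule incseq_SucI) (simp add: assms(1))
  then have *: "D j \<inter> D k = {}" if "j < k" for j k
    using that cube_mono[of "(nx ^^ Suc j) 0" "(nx ^^ k) 0"] incseqD[of "\<lambda>j. (nx ^^ j) 0" "Suc j" k]
    unfolding D_def by auto
  show "j \<noteq> k \<Longrightarrow> D j \<inter> D k = {}" using *[of j k] *[of k j] by (auto simp: linorder_neq_iff)
qed

text \<open>Up to an error \<open>M \<eta>\<close>, the sum \<open>\<Sum> g_j(y) A x_j\<close> consists of disjoint blocks, and \<open>\<bar>g_j(y)\<bar>\<close> is at most the
  norm of \<open>y\<close> on the \<open>j\<close>-th shell. So \<open>block_sum_le\<close> gives the constant \<open>c\<close> independently of \<open>M\<close>.\<close>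

lemma hump_system:
  assumes A: "A \<in> LP_ops S" and e: "0 < e"
    and small: "\<And>m. \<exists>x\<in>Q_proj m ` X. N x = 1 \<and> N (A x) < c"
  shows "\<exists>x g. biorthogonal M x g \<and> (\<forall>y\<in>X. N (\<Sum>j<M. g j y *\<^sub>C A (x j)) \<le> (c + e) * N y)"
proof -
  note Ab = LP_bounded[OF A]
  define \<eta> where "\<eta> = e / (M + 1)"
  have \<eta>: "0 < \<eta>" using e by (simp add: \<eta>_def)
  have M\<eta>: "M * \<eta> \<le> e" using e by (simp add: \<eta>_def field_simps)
  have "\<forall>n. \<exists>n' x. n \<le> n' \<and> x \<in> X \<and> restrict_seq (cube n' - cube n) x = x \<and> N x = 1 \<and> N (A x) \<le> c \<and>
    N (A x - restrict_seq (cube n' - cube n) (A x)) \<le> \<eta>"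
    using hump[OF A \<eta> small] by blast
  then obtain nx xx where step: "\<And>n. n \<le> nx n" "\<And>n. xx n \<in> X"
    "\<And>n. restrict_seq (cube (nx n) - cube n) (xx n) = xx n" "\<And>n. N (xx n) = 1" "\<And>n. N (A (xx n)) \<le> c"
    "\<And>n. N (A (xx n) - restrict_seq (cube (nx n) - cube n) (A (xx n))) \<le> \<eta>" by metis
  define x where "x j = xx ((nx ^^ j) 0)" for j
  define D where "D j = cube ((nx ^^ Suc j) 0) - (cube ((nx ^^ j) 0) :: (int ^ 'n) set)" for j
  have x: "x j \<in> X" "restrict_seq (D j) (x j) = x j" "N (x j) = 1" "N (A (x j)) \<le> c"
    "N (A (x j) - restrict_seq (D j) (A (x j))) \<le> \<eta>" for j
    using step by (simp_all add: x_def D_def)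
  have dis: "D j \<inter> D k = {}" if "j \<noteq> k" for j k
    using shells_disjoint[of nx j k] step(1) that by (simp add: D_def)
  have c: "0 \<le> c" using x(4)[of 0] norm_nonneg[OF bounded_ops_mem[OF Ab x(1)[of 0]]] by linarith
  have "\<exists>g\<in>X'. (\<forall>y\<in>X. cmod (g y) \<le> N (restrict_seq (D j) y)) \<and> g (x j) = of_real (N (restrict_seq (D j) (x j)))" for j
    by (rule functional_below_seminorm[where C = 1])
      (simp_all add: restrict_add restrict_scale norm_triangle restrict_mem norm_scale restrict_le x)
  then obtain g where g: "\<And>j. g j \<in> X'" "\<And>j y. y \<in> X \<Longrightarrow> cmod (g j y) \<le> N (restrict_seq (D j) y)"
    "\<And>j. g j (x j) = of_real (N (restrict_seq (D j) (x j)))" by metis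
  have bi: "biorthogonal M x g"
    unfolding biorthogonal_def
  proof (intro conjI allI impI)
    fix i j
    show "g i (x j) = (if i = j then 1 else 0)"
    proof (cases "i = j")
      case True
      then show ?thesis using g(3)[of j] x by simp
    next
      case False
      have "restrict_seq (D i) (x j) = restrict_seq (D i) (restrict_seq (D j) (x j))" using x by simp
      also have "\<dots> = 0" using dis[OF False] by (simp add: restrict_restrict) (simp add: restrict_seq_def fun_eq_iff)
      finally have "cmod (g i (x j)) \<le> 0" using g(2)[OF x(1), of i j] by simp
      then show ?thesis using False by simp
    qed
  qed (use x g in auto)
  have "N (\<Sum>j<M. g j y *\<^sub>C A (x j)) \<le> (c + e) * N y" if y: "y \<in> X" for y
  proof -
    let ?u = "\<lambda>j. g j y *\<^sub>C restrict_seq (D j) (A (x j))"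
    let ?v = "\<lambda>j. g j y *\<^sub>C (A (x j) - restrict_seq (D j) (A (x j)))"
    have AX: "A (x j) \<in> X" for j by (rule bounded_ops_mem[OF Ab x(1)])
    have uX: "?u j \<in> X" and vX: "?v j \<in> X" for j by (intro scale_mem diff_mem restrict_mem AX)+
    have "g j y *\<^sub>C A (x j) = ?u j + ?v j" for j by (simp only: scaleC_add_right[symmetric] add_diff_cancel_left' diff_add_cancel) simp
    then have eq: "(\<Sum>j<M. g j y *\<^sub>C A (x j)) = (\<Sum>j<M. ?u j) + (\<Sum>j<M. ?v j)" by (simp only: sum.distrib)
    have "N ((\<Sum>j<M. ?u j) + (\<Sum>j<M. ?v j)) \<le> N (\<Sum>j<M. ?u j) + N (\<Sum>j<M. ?v j)" by (intro norm_triangle sum_mem uX vX)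
    also have "N (\<Sum>j<M. ?u j) \<le> c * N y"
    proof (rule block_sum_le[where E = D and F = D])
      show "N (?u j) \<le> c * N (restrict_seq (D j) y)" for j
      proof -
        have "N (?u j) = cmod (g j y) * N (restrict_seq (D j) (A (x j)))" by (intro norm_scale restrict_mem AX)
        also have "\<dots> \<le> N (restrict_seq (D j) y) * c"
          using restrict_le[OF AX[of j], of "D j"] x(4)[of j]
          by (intro mult_mono g y norm_nonneg restrict_mem AX) auto
        finally show ?thesis by (simp add: mult.commute)
      qed
      show "?u j i = 0" if "i \<notin> D j" for i j using that by (simp add: scaleC_fun_def restrict_seq_def)
    qed (use c y uX dis in auto)
    also have "N (\<Sum>j<M. ?v j) \<le> (\<Sum>j<M. N (?v j))" by (intro norm_sum vX)
    also have "\<dots> \<le> real (card {..<M}) * (N y * \<eta>)"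
    proof (rule sum_bounded_above)
      fix j
      have "N (?v j) = cmod (g j y) * N (A (x j) - restrict_seq (D j) (A (x j)))"
        by (intro norm_scale diff_mem restrict_mem AX)
      also have "\<dots> \<le> N y * \<eta>"
        using g(2)[OF y, of j] restrict_le[OF y, of "D j"]
        by (intro mult_mono x norm_nonneg y diff_mem restrict_mem AX) auto
      finally show "N (?v j) \<le> N y * \<eta>" .
    qed
    also have "real (card {..<M}) * (N y * \<eta>) \<le> e * N y"
      using mult_right_mono[OF M\<eta> norm_nonneg[OF y]] by (simp add: mult_ac)
    finally show ?thesis unfolding eq distrib_right by simp
  qed
  then show ?thesis using bi by blast
qed

text \<open>The mirror image of \<open>hump\<close>: it is \<open>A\<^sup>* g\<close> that has to be concentrated on the shell. The vector \<open>x\<close>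
  almost norms \<open>g\<close>; exact norming cannot be expected.\<close>

lemma dual_hump:
  assumes A: "A \<in> LP_ops S" and \<eta>: "0 < \<eta>"
    and small: "\<And>m. \<exists>g\<in>imQ' m. N' g = 1 \<and> N' (adjoint_op S A g) < c"
  shows "\<exists>n' g x. n \<le> n' \<and> g \<in> X' \<and> x \<in> X \<and> restrict_seq (cube n' - cube n) x = x \<and> N x \<le> 1 + \<eta> \<and> g x = 1 \<and>
    (\<forall>y\<in>X. cmod (g y) \<le> N (restrict_seq (cube n' - cube n) y)) \<and> (\<forall>y\<in>X. cmod (g (A y)) \<le> c * N y) \<and>
    (\<forall>y\<in>X. cmod (g (A y) - g (A (restrict_seq (cube n' - cube n) y))) \<le> \<eta> * N y)"
proof -
  note Ab = LP_bounded[OF A]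
  have AX: "x \<in> X \<Longrightarrow> A x \<in> X" for x by (rule bounded_ops_mem[OF Ab])
  have \<eta>2: "0 < \<eta> / 2" using \<eta> by simp
  obtain m where m: "n \<le> m" "\<And>x. x \<in> X \<Longrightarrow> N (restrict_seq (- cube m) (A (restrict_seq (cube n) x))) \<le> \<eta> / 2 * N x"
    using LP_decay[OF A \<eta>2, of n] by (metis max.cobounded1 max.cobounded2)
  obtain g0 where g0: "g0 \<in> imQ' m" "N' g0 = 1" "N' (adjoint_op S A g0) < c" using small by blast
  obtain g l where g: "g \<in> X'" "\<And>x. x \<in> X \<Longrightarrow> g (restrict_seq (cube l - cube m) x) = g x" "N' g = 1"
    "\<And>y. y \<in> X \<Longrightarrow> cmod (g (A y)) \<le> c * N y"
    using finite_dual_minimiser[OF A g0] by blast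
  obtain n1 where n1: "\<And>k y. k \<ge> n1 \<Longrightarrow> y \<in> X \<Longrightarrow> N (restrict_seq (cube l) (A (restrict_seq (- cube k) y))) \<le> \<eta> / 2 * N y"
    using LP_decay[OF A \<eta>2, of l] by blast
  define n' where "n' = max n (max l n1)"
  have n': "n \<le> n'" "l \<le> n'" "n1 \<le> n'" by (auto simp: n'_def)
  define D where "D = cube n' - (cube n :: (int ^ 'n) set)"
  have gE: "g (restrict_seq E y) = g y" if y: "y \<in> X" and E: "(cube l - cube m) \<subseteq> E" for y E
  proof -
    have "(cube l - cube m) \<inter> E = cube l - cube m" using E by blast
    then have "g (restrict_seq (cube l - cube m) (restrict_seq E y)) = g (restrict_seq (cube l - cube m) y)"
      by (simp add: restrict_restrict)
    then show ?thesis using g(2)[OF y] g(2)[OF restrict_mem[OF y, of E]] by simp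
  qed
  have gD: "g (restrict_seq D y) = g y" if "y \<in> X" for y
    by (rule gE[OF that]) (use cube_mono[OF n'(2)] cube_mono[OF m(1)] in \<open>auto simp: D_def\<close>)
  have gle: "cmod (g y) \<le> N y" if "y \<in> X" for y using functional_bound[OF g(1) that] g(3) by simp
  have "1 / (1 + \<eta>) < N' g" using g(3) \<eta> by simp
  then obtain x0 where x0: "x0 \<in> X" "N x0 \<le> 1" "1 / (1 + \<eta>) < cmod (g x0)"
    using functional_norming[OF g(1)] by blast
  have gx0: "0 < cmod (g x0)" using x0(3) \<eta> by (smt (verit) zero_less_divide_1_iff)
  define x where "x = (1 / g x0) *\<^sub>C restrict_seq D x0"
  have rX: "restrict_seq D x0 \<in> X" by (intro restrict_mem x0)
  have xX: "x \<in> X" unfolding x_def by (intro scale_mem rX)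
  have "restrict_seq D x = x" by (simp add: x_def restrict_scale restrict_restrict)
  moreover have "N x \<le> 1 + \<eta>"
  proof -
    have "N x = 1 / cmod (g x0) * N (restrict_seq D x0)" unfolding x_def norm_scale[OF rX] by (simp add: norm_divide)
    also have "\<dots> \<le> (1 + \<eta>) * 1"
    proof (rule mult_mono)
      show "1 / cmod (g x0) \<le> 1 + \<eta>" using x0(3) gx0 \<eta> by (simp add: field_simps)
      show "N (restrict_seq D x0) \<le> 1" using restrict_le[OF x0(1), of D] x0(2) by linarith
    qed (use \<eta> norm_nonneg[OF rX] in auto)
    finally show ?thesis by simp
  qed
  moreover have "g x = 1" unfolding x_def functional_scale[OF g(1) rX] gD[OF x0(1)] using gx0 by simp
  moreover have "cmod (g y) \<le> N (restrict_seq D y)" if "y \<in> X" for y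
    using gle[OF restrict_mem[OF that, of D]] gD[OF that] by simp
  moreover have "cmod (g (A y) - g (A (restrict_seq D y))) \<le> \<eta> * N y" if y: "y \<in> X" for y
  proof -
    let ?p = "A (restrict_seq (cube n) y)" and ?q = "A (restrict_seq (- cube n') y)"
    have pX: "?p \<in> X" "?q \<in> X" "A (restrict_seq D y) \<in> X" by (intro AX restrict_mem y)+
    have "A y = A (restrict_seq D y + (restrict_seq (cube n) y + restrict_seq (- cube n') y))"
      using restrict_shell_split[OF n'(1), of y] unfolding D_def by simp
    also have "\<dots> = A (restrict_seq D y) + (?p + ?q)"
      by (simp add: bounded_ops_add[OF Ab] restrict_mem y add_mem)
    finally have "g (A y) - g (A (restrict_seq D y)) = g ?p + g ?q"
      using pX by (simp add: functional_add[OF g(1)] add_mem)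
    also have "\<dots> = g (restrict_seq (- cube m) ?p) + g (restrict_seq (cube l) ?q)"
      using gE[OF pX(1), of "- cube m"] gE[OF pX(2), of "cube l"] by (simp add: Diff_subset Diff_eq)
    finally have eq: "g (A y) - g (A (restrict_seq D y)) = g (restrict_seq (- cube m) ?p) + g (restrict_seq (cube l) ?q)" .
    have "cmod (g (restrict_seq (- cube m) ?p) + g (restrict_seq (cube l) ?q)) \<le> cmod (g (restrict_seq (- cube m) ?p)) + cmod (g (restrict_seq (cube l) ?q))"
      by (rule norm_triangle_ineq)
    also have "\<dots> \<le> N (restrict_seq (- cube m) ?p) + N (restrict_seq (cube l) ?q)"
      by (intro add_mono gle restrict_mem pX)
    also have "\<dots> \<le> \<eta> / 2 * N y + \<eta> / 2 * N y" by (intro add_mono m n1 n' y)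
    finally show ?thesis unfolding eq by simp
  qed
  ultimately show ?thesis using n'(1) g(1,4) xX unfolding D_def by blast
qed

lemma dual_hump_system:
  assumes A: "A \<in> LP_ops S" and e: "0 < e"
    and small: "\<And>m. \<exists>g\<in>imQ' m. N' g = 1 \<and> N' (adjoint_op S A g) < c"
  shows "\<exists>x g. biorthogonal M x g \<and> (\<forall>y\<in>X. N (\<Sum>j<M. g j (A y) *\<^sub>C x j) \<le> (c + e) * N y)"
proof -
  note Ab = LP_bounded[OF A]
  have AX: "x \<in> X \<Longrightarrow> A x \<in> X" for x by (rule bounded_ops_mem[OF Ab])
  interpret D: normed_carrier "dual S" by (rule normed_carrier_dual)
  obtain g0 where g0: "g0 \<in> imQ' 0" "N' (adjoint_op S A g0) < c" using small by blast
  have "0 \<le> N' (adjoint_op S A g0)"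
    by (rule D.norm_nonneg[OF adjoint_op_bounded(2)[OF Ab]]) (use g0 in \<open>auto simp: Q'_image\<close>)
  then have c: "0 \<le> c" using g0 by simp
  \<comment> \<open>Small enough that \<open>(1 + \<eta>) (c + M \<eta>) \<le> c + e\<close>; the factor \<open>1 + \<eta>\<close> bounds the norms of the \<open>x_j\<close>.\<close>
  define \<eta> where "\<eta> = min 1 (e / (c + 2 * M + 1))"
  have \<eta>: "0 < \<eta>" "\<eta> \<le> 1" using e c by (auto simp: \<eta>_def)
  have "\<eta> \<le> e / (c + 2 * M + 1)" by (simp add: \<eta>_def)
  then have "\<eta> * (c + 2 * M + 1) \<le> e" using c by (simp add: field_simps)
  moreover have "\<eta> * (c + 2 * M + 1) = \<eta> * c + 2 * (\<eta> * M) + \<eta>" by (simp add: algebra_simps)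
  moreover have "\<eta> * (\<eta> * M) \<le> 1 * (\<eta> * M)" by (rule mult_right_mono) (use \<eta> in auto)
  moreover have "(1 + \<eta>) * c + M * ((1 + \<eta>) * \<eta>) = c + \<eta> * c + \<eta> * M + \<eta> * (\<eta> * M)"
    by (simp add: algebra_simps)
  ultimately have \<eta>e: "(1 + \<eta>) * c + M * ((1 + \<eta>) * \<eta>) \<le> c + e" using \<eta>(1) by linarith
  obtain nx gg xx where step: "\<And>n. n \<le> nx n" "\<And>n. gg n \<in> X'" "\<And>n. xx n \<in> X"
    "\<And>n. restrict_seq (cube (nx n) - cube n) (xx n) = xx n" "\<And>n. N (xx n) \<le> 1 + \<eta>" "\<And>n. gg n (xx n) = 1"
    "\<And>n. \<forall>y\<in>X. cmod (gg n y) \<le> N (restrict_seq (cube (nx n) - cube n) y)"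
    "\<And>n. \<forall>y\<in>X. cmod (gg n (A y)) \<le> c * N y"
    "\<And>n. \<forall>y\<in>X. cmod (gg n (A y) - gg n (A (restrict_seq (cube (nx n) - cube n) y))) \<le> \<eta> * N y"
    using dual_hump[OF A \<eta>(1) small] by metis
  define x where "x j = xx ((nx ^^ j) 0)" for j
  define g where "g j = gg ((nx ^^ j) 0)" for j
  define D where "D j = cube ((nx ^^ Suc j) 0) - (cube ((nx ^^ j) 0) :: (int ^ 'n) set)" for j
  have x: "x j \<in> X" "restrict_seq (D j) (x j) = x j" "N (x j) \<le> 1 + \<eta>" for j
    using step by (simp_all add: x_def D_def)
  have g: "g j \<in> X'" "g j (x j) = 1" for j
    using step by (simp_all add: x_def g_def)
  have gD: "cmod (g j y) \<le> N (restrict_seq (D j) y)" "cmod (g j (A y)) \<le> c * N y"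
    "cmod (g j (A y) - g j (A (restrict_seq (D j) y))) \<le> \<eta> * N y" if "y \<in> X" for j y
    using step(7-9) that by (simp_all add: g_def D_def)
  have dis: "D j \<inter> D k = {}" if "j \<noteq> k" for j k
    using shells_disjoint[of nx j k] step(1) that by (simp add: D_def)
  have bi: "biorthogonal M x g"
    unfolding biorthogonal_def
  proof (intro conjI allI impI)
    fix i j
    show "g i (x j) = (if i = j then 1 else 0)"
    proof (cases "i = j")
      case True
      then show ?thesis using g by simp
    next
      case False
      have "restrict_seq (D i) (x j) = restrict_seq (D i) (restrict_seq (D j) (x j))" using x by simp
      also have "\<dots> = 0" using dis[OF False] by (simp add: restrict_restrict) (simp add: restrict_seq_def fun_eq_iff)
      finally have "cmod (g i (x j)) \<le> 0" using gD(1)[OF x(1), of i j] by simp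
      then show ?thesis using False by simp
    qed
  qed (use x g in auto)
  have "N (\<Sum>j<M. g j (A y) *\<^sub>C x j) \<le> (c + e) * N y" if y: "y \<in> X" for y
  proof -
    let ?a = "\<lambda>j. g j (A (restrict_seq (D j) y))"
    let ?u = "\<lambda>j. ?a j *\<^sub>C x j" and ?v = "\<lambda>j. (g j (A y) - ?a j) *\<^sub>C x j"
    have uX: "?u j \<in> X" and vX: "?v j \<in> X" for j by (intro scale_mem x)+
    have "g j (A y) *\<^sub>C x j = ?u j + ?v j" for j by (simp only: scaleC_add_left[symmetric]) simp
    then have eq: "(\<Sum>j<M. g j (A y) *\<^sub>C x j) = (\<Sum>j<M. ?u j) + (\<Sum>j<M. ?v j)" by (simp only: sum.distrib)
    have "N ((\<Sum>j<M. ?u j) + (\<Sum>j<M. ?v j)) \<le> N (\<Sum>j<M. ?u j) + N (\<Sum>j<M. ?v j)" by (intro norm_triangle sum_mem uX vX)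
    also have "N (\<Sum>j<M. ?u j) \<le> (1 + \<eta>) * c * N y"
    proof (rule block_sum_le[where E = D and F = D])
      show "N (?u j) \<le> (1 + \<eta>) * c * N (restrict_seq (D j) y)" for j
      proof -
        have "N (?u j) = cmod (?a j) * N (x j)" by (intro norm_scale x)
        also have "\<dots> \<le> (c * N (restrict_seq (D j) y)) * (1 + \<eta>)"
          using c by (intro mult_mono gD x norm_nonneg restrict_mem y mult_nonneg_nonneg) auto
        finally show ?thesis by (simp add: mult_ac)
      qed
      show "?u j i = 0" if "i \<notin> D j" for i j
        using that fun_cong[OF x(2)[of j], of i] by (simp add: scaleC_fun_def restrict_seq_def)
    qed (use c y uX dis \<eta> in auto)
    also have "N (\<Sum>j<M. ?v j) \<le> (\<Sum>j<M. N (?v j))" by (intro norm_sum vX)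
    also have "\<dots> \<le> real (card {..<M}) * ((\<eta> * N y) * (1 + \<eta>))"
    proof (rule sum_bounded_above)
      fix j
      have "N (?v j) = cmod (g j (A y) - ?a j) * N (x j)" by (intro norm_scale x)
      also have "\<dots> \<le> (\<eta> * N y) * (1 + \<eta>)"
        using \<eta> by (intro mult_mono gD x norm_nonneg y mult_nonneg_nonneg) auto
      finally show "N (?v j) \<le> (\<eta> * N y) * (1 + \<eta>)" .
    qed
    also have "real (card {..<M}) * ((\<eta> * N y) * (1 + \<eta>)) = M * ((1 + \<eta>) * \<eta>) * N y"
      by (simp add: mult_ac)
    finally have "N (\<Sum>j<M. g j (A y) *\<^sub>C x j) \<le> ((1 + \<eta>) * c + M * ((1 + \<eta>) * \<eta>)) * N y"
      unfolding eq by (simp only: distrib_right)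
    also have "\<dots> \<le> (c + e) * N y" by (intro mult_right_mono \<eta>e norm_nonneg y)
    finally show ?thesis .
  qed
  then show ?thesis using bi by blast
qed

section \<open>The limits of the Bernstein and approximation numbers\<close>

theorem mu_eq_B_limit_eq_S_limit:
  assumes A: "A \<in> LP_ops S"
  shows "mu S A = B_limit S A" "B_limit S A = S_limit S A"
proof -
  interpret D: normed_carrier "dual S" by (rule normed_carrier_dual)
  note Ab = LP_bounded[OF A]
  have AX: "x \<in> X \<Longrightarrow> A x \<in> X" for x by (rule bounded_ops_mem[OF Ab])
  define A' where "A' = (\<lambda>g. if g \<in> X' then adjoint_op S A g else 0)"
  have A'b: "A' \<in> bounded_ops (dual S) (dual S)" unfolding A'_def by (rule adjoint_op_bounded(1)[OF Ab])
  have A'_eq: "adjoint_op S A g = A' g" if "g \<in> X'" for g using that by (simp add: A'_def)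
  let ?V = "\<lambda>m. Q_proj m ` X"
  define a where "a = lim (\<lambda>m. lower_norm S A (?V m))"
  define a' where "a' = lim (\<lambda>m. lower_norm (dual S) A' (imQ' m))"
  have La: "(\<lambda>m. lower_norm S A (?V m)) \<longlonglongrightarrow> a" "lower_norm S A (?V m) \<le> a" "0 \<le> a" for m
    unfolding a_def
    by (rule lower_norm_limit[where V = ?V, OF Ab subspace_Q Q_subset Q_nontrivial Q_decreasing])+
  have La': "(\<lambda>m. lower_norm (dual S) A' (imQ' m)) \<longlonglongrightarrow> a'" "lower_norm (dual S) A' (imQ' m) \<le> a'" "0 \<le> a'" for m
    unfolding a'_def
    by (rule D.lower_norm_limit[where V = "\<lambda>m. imQ' m", OF A'b subspace_Q' Q'_subset Q'_nontrivial Q'_decreasing])+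
  have cong: "lower_norm (dual S) (adjoint_op S A) (imQ' m) = lower_norm (dual S) A' (imQ' m)" for m
    by (rule D.lower_norm_cong) (use Q'_subset A'_eq in blast)
  have mu: "mu S A = min a a'"
    unfolding mu_def mu_tilde_def mu_tilde_dual_def a_def a'_def cong ..
  have small: "\<exists>x\<in>?V m. N x = 1 \<and> N (A x) < c" if c: "a < c" for c m
  proof -
    obtain x where x: "x \<in> ?V m" "x \<noteq> 0" using Q_nontrivial by blast
    have "lower_norm S A (?V m) < c" using La(2)[of m] c by simp
    from lower_norm_less[OF subspace_Q Q_subset x this] show ?thesis by blast
  qed
  have small': "\<exists>g\<in>imQ' m. N' g = 1 \<and> N' (adjoint_op S A g) < c" if c: "a' < c" for c m
  proof -
    obtain g where g: "g \<in> imQ' m" "g \<noteq> 0" using Q'_nontrivial by blast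
    have "lower_norm (dual S) A' (imQ' m) < c" using La'(2)[of m] c by simp
    then obtain h where h: "h \<in> imQ' m" "N' h = 1" "N' (A' h) < c"
      by (rule D.lower_norm_less[OF subspace_Q' Q'_subset g])
    have "h \<in> X'" using h(1) Q'_subset by blast
    then show ?thesis using h A'_eq by auto
  qed
  have sys: "\<exists>x g. biorthogonal M x g \<and> (\<forall>y\<in>X. N (\<Sum>j<M. g j y *\<^sub>C A (x j)) \<le> (a + e) * N y)" if "0 < e" for e M
    using hump_system[OF A, of "e / 2" "a + e / 2" M] small[of "a + e / 2"] that by (simp add: add.assoc)
  have sys': "\<exists>x g. biorthogonal M x g \<and> (\<forall>y\<in>X. N (\<Sum>j<M. g j (A y) *\<^sub>C x j) \<le> (a' + e) * N y)" if "0 < e" for e M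
    using dual_hump_system[OF A, of "e / 2" "a' + e / 2" M] small'[of "a' + e / 2"] that by (simp add: add.assoc)
  have near: "\<exists>m. a - e < lower_norm S A (?V m)" if "0 < e" for e
    using order_tendstoD(1)[OF La(1), of "a - e"] that by (auto simp: eventually_sequentially)
  have near': "\<exists>m. a' - e < lower_norm (dual S) A' (imQ' m)" if "0 < e" for e
    using order_tendstoD(1)[OF La'(1), of "a' - e"] that by (auto simp: eventually_sequentially)
  have B: "bernstein_number S A \<longlonglongrightarrow> a"
  proof (rule bernstein_number_tendsto[OF refl Ab])
    fix e :: real assume e: "0 < e"
    obtain m where m: "a - e < lower_norm S A (?V m)" using near[OF e] by blast
    obtain d where d: "quotient_dim X (?V m) \<le> enat d" using finite_codim by blast
    have "(a - e) * N x \<le> N (A x)" if x: "x \<in> ?V m" for x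
    proof -
      have "(a - e) * N x \<le> lower_norm S A (?V m) * N x"
        using m x Q_subset by (intro mult_right_mono norm_nonneg) auto
      also have "\<dots> \<le> N (A x)" by (rule lower_norm_bound[OF Ab subspace_Q Q_subset x])
      finally show ?thesis .
    qed
    then show "\<exists>V k. complex_vector.subspace V \<and> V \<subseteq> X \<and> quotient_dim X V \<le> enat k
        \<and> (\<forall>x\<in>V. (a - e) * N x \<le> N (A x))"
      using subspace_Q Q_subset d by blast
  next
    fix e :: real and M :: nat assume e: "0 < e"
    obtain x g where xg: "biorthogonal M x g" "\<And>y. y \<in> X \<Longrightarrow> N (\<Sum>j<M. g j y *\<^sub>C A (x j)) \<le> (a + e) * N y"
      using sys[OF e] by blast
    show "\<exists>B\<subseteq>X. independent_mod {0} B \<and> M \<le> card B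
        \<and> (\<forall>c. N (A (\<Sum>b\<in>B. c b *\<^sub>C b)) \<le> (a + e) * N (\<Sum>b\<in>B. c b *\<^sub>C b))"
      by (rule biorthogonal_right(2)[OF xg(1) Ab _ xg(2)]) (use La e in auto)
  qed
  have B': "bernstein_number (dual S) (adjoint_op S A) \<longlonglongrightarrow> a'"
  proof (rule D.bernstein_number_tendsto[OF A'_eq A'b])
    fix e :: real assume e: "0 < e"
    obtain m where m: "a' - e < lower_norm (dual S) A' (imQ' m)" using near'[OF e] by blast
    obtain d where d: "quotient_dim X' (imQ' m) \<le> enat d" using finite_codim by blast
    have "(a' - e) * N' g \<le> N' (adjoint_op S A g)" if g: "g \<in> imQ' m" for g
    proof -
      have gX: "g \<in> X'" using g Q'_subset by blast
      have "(a' - e) * N' g \<le> lower_norm (dual S) A' (imQ' m) * N' g"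
        using m by (intro mult_right_mono D.norm_nonneg gX) auto
      also have "\<dots> \<le> N' (A' g)" by (rule D.lower_norm_bound[OF A'b subspace_Q' Q'_subset g])
      finally show ?thesis using A'_eq[OF gX] by simp
    qed
    then show "\<exists>V k. complex_vector.subspace V \<and> V \<subseteq> X' \<and> quotient_dim X' V \<le> enat k
        \<and> (\<forall>g\<in>V. (a' - e) * N' g \<le> N' (adjoint_op S A g))"
      using subspace_Q' Q'_subset d by blast
  next
    fix e :: real and M :: nat assume e: "0 < e"
    obtain x g where xg: "biorthogonal M x g" "\<And>y. y \<in> X \<Longrightarrow> N (\<Sum>j<M. g j (A y) *\<^sub>C x j) \<le> (a' + e) * N y"
      using sys'[OF e] by blast
    show "\<exists>B\<subseteq>X'. independent_mod {0} B \<and> M \<le> card B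
        \<and> (\<forall>c. N' (adjoint_op S A (\<Sum>b\<in>B. c b *\<^sub>C b)) \<le> (a' + e) * N' (\<Sum>b\<in>B. c b *\<^sub>C b))"
      by (rule biorthogonal_left(2)[OF xg(1) Ab _ xg(2)]) (use La' e in auto)
  qed
  have R: "right_approx_number S A \<longlonglongrightarrow> a"
  proof (rule right_approx_number_tendsto[OF Ab])
    fix e :: real assume e: "0 < e"
    obtain m where m: "a - e < lower_norm S A (?V m)" using near[OF e] by blast
    obtain d where d: "quotient_dim X (?V m) \<le> enat d" using finite_codim by blast
    have "a - e \<le> op_norm S S (A - F)"
      if F: "F \<in> bounded_ops S S" and big: "enat d < subspace_dim {x \<in> X. F x = 0}" for F
    proof -
      have "enat (Suc d) \<le> subspace_dim {x \<in> X. F x = 0}" using big by (simp add: Suc_ile_eq)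
      then obtain B where B: "B \<subseteq> {x \<in> X. F x = 0}" "independent_mod {0} B" "Suc d \<le> card B"
        by (rule quotient_dim_geE)
      have "enat d < enat (Suc d)" by simp
      with d have qd: "quotient_dim X (?V m) < enat (Suc d)" by (rule le_less_trans)
      have BX: "B \<subseteq> X" using B(1) by blast
      obtain c where c: "(\<Sum>b\<in>B. c b *\<^sub>C b) \<in> ?V m" "(\<Sum>b\<in>B. c b *\<^sub>C b) \<noteq> 0"
        using finite_codim_meets[OF qd BX B(2,3)] by blast
      define z where "z = (\<Sum>b\<in>B. c b *\<^sub>C b)"
      have z: "z \<in> ?V m" "z \<noteq> 0" "z \<in> X" using c Q_subset by (auto simp: z_def)
      have "F z = (\<Sum>b\<in>B. c b *\<^sub>C F b)" unfolding z_def using BX by (intro bounded_ops_linear_sum[OF F]) auto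
      also have "\<dots> = 0" using B(1) by (intro sum.neutral) auto
      finally have "(A - F) z = A z" by simp
      then have "N (A z) \<le> op_norm S S (A - F) * N z"
        using op_norm_bound[OF normed_carrier_S bounded_ops_minus_op[OF normed_carrier_S Ab F] z(3)] by simp
      moreover have "lower_norm S A (?V m) * N z \<le> N (A z)"
        by (rule lower_norm_bound[OF Ab subspace_Q Q_subset z(1)])
      ultimately have "lower_norm S A (?V m) * N z \<le> op_norm S S (A - F) * N z" by simp
      then have "lower_norm S A (?V m) \<le> op_norm S S (A - F)" using norm_pos[OF z(3,2)] by simp
      then show ?thesis using m by simp
    qed
    then show "\<exists>k. \<forall>F\<in>bounded_ops S S. enat k < subspace_dim {x \<in> X. F x = 0} \<longrightarrow> a - e \<le> op_norm S S (A - F)"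
      by blast
  next
    fix e :: real and M :: nat assume e: "0 < e"
    obtain x g where xg: "biorthogonal M x g" "\<And>y. y \<in> X \<Longrightarrow> N (\<Sum>j<M. g j y *\<^sub>C A (x j)) \<le> (a + e) * N y"
      using sys[OF e] by blast
    show "\<exists>F\<in>bounded_ops S S. enat M \<le> subspace_dim {x \<in> X. F x = 0} \<and> op_norm S S (A - F) \<le> a + e"
      by (rule biorthogonal_right(1)[OF xg(1) Ab _ xg(2)]) (use La e in auto)
  qed
  have L: "left_approx_number S A \<longlonglongrightarrow> a'"
  proof (rule left_approx_number_tendsto[OF Ab])
    fix e :: real assume e: "0 < e"
    obtain m where m: "a' - e < lower_norm (dual S) A' (imQ' m)" using near'[OF e] by blast
    obtain d where d: "\<And>W. complex_vector.subspace W \<Longrightarrow> \<forall>x\<in>X. \<exists>w\<in>W. restrict_seq (- cube m) (x - w) = 0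
        \<Longrightarrow> quotient_dim X W \<le> enat d" using finite_codim[of m] by blast
    have "a' - e \<le> op_norm S S (A - F)"
      if F: "F \<in> bounded_ops S S" and big: "enat d < quotient_dim X (F ` X)" for F
    proof (rule ccontr)
      assume "\<not> a' - e \<le> op_norm S S (A - F)"
      define q where "q = op_norm S S (A - F)"
      have AF: "A - F \<in> bounded_ops S S" by (rule bounded_ops_minus_op[OF normed_carrier_S Ab F])
      have q: "0 \<le> q" unfolding q_def by (rule op_norm_nonneg[OF normed_carrier_S AF])
      define \<delta> where "\<delta> = lower_norm (dual S) A' (imQ' m) - q"
      have \<delta>: "0 < \<delta>" using m \<open>\<not> _\<close> by (simp add: \<delta>_def q_def)
      define T where "T = Q_proj m \<circ> F"
      have T: "T \<in> bounded_ops S S" unfolding T_def by (rule Q_comp_bounded[OF F])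
      have FX: "x \<in> X \<Longrightarrow> F x \<in> X" for x by (rule bounded_ops_mem[OF F])
      \<comment> \<open>On functionals that live outside the box, the adjoint of \<open>T\<close> is bounded below by \<open>\<delta>\<close>.\<close>
      have onto: "\<exists>y\<in>X. T y = z" if z: "z \<in> ?V m" for z
      proof (rule exact_solution[OF T subspace_Q Q_subset _ \<delta> _ complete z])
        show "T x \<in> ?V m" if "x \<in> X" for x using FX[OF that] by (simp add: T_def)
        fix z \<eta> assume z: "z \<in> ?V m" and \<eta>: "(0::real) < \<eta>"
        have zX: "z \<in> X" and zm: "Q_proj m z = z" using z unfolding Q_image by (auto simp: Q_proj_eq)
        obtain x where "x \<in> X" "N x \<le> N z / \<delta> + \<eta>" "N (z - T x) \<le> \<eta>"
        proof (rule approximate_solution[OF T zX \<delta> \<eta>])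
          fix g assume g: "g \<in> X'" "\<And>x. x \<in> X \<Longrightarrow> cmod (g (T x)) \<le> N x"
          define h where "h = adjoint_op S (Q_proj m) g"
          have hV: "h \<in> imQ' m" using g by (simp add: h_def)
          have hX: "h \<in> X'" using hV Q'_subset by blast
          have h_apply: "h y = g (Q_proj m y)" if "y \<in> X" for y using that by (simp add: h_def adjoint_op_def)
          have "N' (A' h) \<le> 1 + q * N' h"
          proof (rule functional_norm_le)
            show "0 \<le> 1 + q * N' h" using q D.norm_nonneg[OF hX] by simp
            fix x assume x: "x \<in> X"
            have e1: "A' h x = h (A x)" using x hX by (simp add: A'_def adjoint_op_def)
            have e2: "F x + (A - F) x = A x" by simp
            have eq: "A' h x = h (F x) + h ((A - F) x)"
              using functional_add[OF hX FX[OF x] bounded_ops_mem[OF AF x]] unfolding e1 e2 .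
            have "cmod (h (F x) + h ((A - F) x)) \<le> cmod (h (F x)) + cmod (h ((A - F) x))" by (rule norm_triangle_ineq)
            also have "\<dots> \<le> N x + N' h * (q * N x)"
            proof (rule add_mono)
              show "cmod (h (F x)) \<le> N x" using g(2)[OF x] h_apply[OF FX[OF x]] by (simp add: T_def)
              have "cmod (h ((A - F) x)) \<le> N' h * N ((A - F) x)" by (rule functional_bound[OF hX bounded_ops_mem[OF AF x]])
              also have "\<dots> \<le> N' h * (q * N x)"
                unfolding q_def by (intro mult_left_mono op_norm_bound[OF normed_carrier_S AF x] D.norm_nonneg hX)
              finally show "cmod (h ((A - F) x)) \<le> N' h * (q * N x)" .
            qed
            finally show "cmod (A' h x) \<le> (1 + q * N' h) * N x" unfolding eq by (simp only: algebra_simps)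
          qed
          moreover have "lower_norm (dual S) A' (imQ' m) * N' h \<le> N' (A' h)"
            by (rule D.lower_norm_bound[OF A'b subspace_Q' Q'_subset hV])
          ultimately have "\<delta> * N' h \<le> 1" by (simp add: \<delta>_def algebra_simps)
          then have "N' h \<le> 1 / \<delta>" using \<delta> by (simp add: field_simps)
          then have "N' h * N z \<le> 1 / \<delta> * N z" by (intro mult_right_mono norm_nonneg zX)
          moreover have "g z = h z" using h_apply[OF zX] zm by simp
          ultimately show "cmod (g z) \<le> N z / \<delta>" using functional_bound[OF hX zX] by simp
        qed
        then show "\<exists>x\<in>X. N x \<le> N z / \<delta> + \<eta> \<and> N (z - T x) \<le> \<eta>" by blast
      qed
      have "quotient_dim X (F ` X) \<le> enat d"
      proof (rule d)
        show "complex_vector.subspace (F ` X)"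
          unfolding complex_vector.subspace_def
        proof (intro conjI ballI allI)
          show "0 \<in> F ` X" using bounded_ops_zero[OF F] zero_mem by (metis image_eqI)
          show "u + v \<in> F ` X" if "u \<in> F ` X" "v \<in> F ` X" for u v
            using that by (auto simp: bounded_ops_add[OF F, symmetric] add_mem)
          show "c *\<^sub>C u \<in> F ` X" if "u \<in> F ` X" for u c
            using that by (auto simp: bounded_ops_scale[OF F, symmetric] scale_mem)
        qed
        show "\<forall>x\<in>X. \<exists>w\<in>F ` X. restrict_seq (- cube m) (x - w) = 0"
        proof
          fix x assume x: "x \<in> X"
          obtain y where y: "y \<in> X" "T y = Q_proj m x" using onto[of "Q_proj m x"] x by blast
          then have "restrict_seq (- cube m) (x - F y) = 0" by (simp add: T_def Q_proj_eq restrict_diff)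
          then show "\<exists>w\<in>F ` X. restrict_seq (- cube m) (x - w) = 0" using y by blast
        qed
      qed
      then show False using big by simp
    qed
    then show "\<exists>k. \<forall>F\<in>bounded_ops S S. enat k < quotient_dim X (F ` X) \<longrightarrow> a' - e \<le> op_norm S S (A - F)"
      by blast
  next
    fix e :: real and M :: nat assume e: "0 < e"
    obtain x g where xg: "biorthogonal M x g" "\<And>y. y \<in> X \<Longrightarrow> N (\<Sum>j<M. g j (A y) *\<^sub>C x j) \<le> (a' + e) * N y"
      using sys'[OF e] by blast
    show "\<exists>F\<in>bounded_ops S S. enat M \<le> quotient_dim X (F ` X) \<and> op_norm S S (A - F) \<le> a' + e"
      by (rule biorthogonal_left(1)[OF xg(1) Ab _ xg(2)]) (use La' e in auto)
  qed
  have "B_limit S A = min a a'" unfolding B_limit_def by (rule limI, rule tendsto_min[OF B B'])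
  moreover have "S_limit S A = min a a'" unfolding S_limit_def by (rule limI, rule tendsto_min[OF R L])
  ultimately show "mu S A = B_limit S A" "B_limit S A = S_limit S A" using mu by simp_all
qed

end

section \<open>The spaces \<open>l\<^sup>p\<close>\<close>

text \<open>A Fatou property yields completeness: the tails of a geometrically convergent series are pointwise
  limits of their partial sums, which are bounded by the tails of the geometric series.\<close>

lemma fatou_imp_complete:
  fixes S :: "('x::{complex_normed_vector, banach}, 'n::finite) lattice_seq nspace"
  assumes "normed_carrier S"
    and coord: "\<And>x i. x \<in> carrier_of S \<Longrightarrow> norm (x i) \<le> norm_of S x"
    and fatou: "\<And>w x B. \<lbrakk>\<And>m. w m \<in> carrier_of S; \<And>m. norm_of S (w m) \<le> B; \<And>i. (\<lambda>m. w m i) \<longlonglongrightarrow> x i\<rbrakk>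
      \<Longrightarrow> x \<in> carrier_of S \<and> norm_of S x \<le> B"
    and u: "\<And>j::nat. u j \<in> carrier_of S \<and> norm_of S (u j) \<le> C * (1/2)^j"
  shows "\<exists>s\<in>carrier_of S. (\<lambda>n. norm_of S (s - (\<Sum>j<n. u j))) \<longlonglongrightarrow> 0"
proof -
  interpret normed_carrier S by fact
  have C: "0 \<le> C" using u[of 0] norm_nonneg[of "u 0"] by simp
  define s where "s i = (\<Sum>j. u j i)" for i
  have s: "(\<lambda>m. \<Sum>j<m. u j i) \<longlonglongrightarrow> s i" for i
  proof -
    have le: "norm (u j i) \<le> C * (1/2)^j" for j using coord[of "u j" i] u[of j] by linarith
    have g: "summable (\<lambda>j. C * (1/2)^j)" by (rule summable_mult, rule summable_geometric) simp
    have "summable (\<lambda>j. u j i)" by (rule summable_comparison_test'[OF g, of 0]) (rule le)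
    then show ?thesis unfolding s_def by (rule summable_LIMSEQ)
  qed
  have geom: "(\<Sum>j<m. (1/2::real)^j) \<le> 2" for m
  proof -
    have "(\<Sum>j<m. (1/2::real)^j) = 2 - 2 * (1/2)^m" by (induction m) auto
    then show ?thesis by simp
  qed
  have tail: "s - (\<Sum>j<n. u j) \<in> X \<and> N (s - (\<Sum>j<n. u j)) \<le> (2 * C) * (1/2)^n" for n
  proof (rule fatou)
    show "(\<Sum>j<m. u (j + n)) \<in> X" for m using u by (intro sum_mem) auto
    show "N (\<Sum>j<m. u (j + n)) \<le> (2 * C) * (1/2)^n" for m
    proof -
      have "N (\<Sum>j<m. u (j + n)) \<le> (\<Sum>j<m. N (u (j + n)))" using u by (intro norm_sum) auto
      also have "\<dots> \<le> (\<Sum>j<m. C * (1/2)^n * (1/2)^j)"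
      proof (rule sum_mono)
        fix j show "N (u (j + n)) \<le> C * (1/2)^n * (1/2)^j" using u[of "j + n"] by (simp add: power_add mult_ac)
      qed
      also have "\<dots> = C * (1/2)^n * (\<Sum>j<m. (1/2)^j)" by (simp only: sum_distrib_left)
      also have "\<dots> \<le> C * (1/2)^n * 2" using C by (intro mult_left_mono geom) auto
      finally show ?thesis by (simp add: mult_ac)
    qed
    show "(\<lambda>m. (\<Sum>j<m. u (j + n)) i) \<longlonglongrightarrow> (s - (\<Sum>j<n. u j)) i" for i
    proof -
      have "(\<Sum>j<m. u (j + n) i) = (\<Sum>j<m + n. u j i) - (\<Sum>j<n. u j i)" for m
        by (induction m) (auto simp: algebra_simps)
      moreover have "(\<lambda>m. (\<Sum>j<m + n. u j i) - (\<Sum>j<n. u j i)) \<longlonglongrightarrow> s i - (\<Sum>j<n. u j i)"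
        by (intro tendsto_diff tendsto_const LIMSEQ_ignore_initial_segment s)
      ultimately show ?thesis by (simp add: sum_fun_apply)
    qed
  qed
  show ?thesis
  proof (intro bexI[of _ s])
    show "s \<in> X" using tail[of 0] by simp
    have lim: "(\<lambda>n. (2 * C) * (1/2)^n) \<longlonglongrightarrow> (2 * C) * 0"
      by (intro tendsto_mult tendsto_const LIMSEQ_power_zero) simp
    show "(\<lambda>n. N (s - (\<Sum>j<n. u j))) \<longlonglongrightarrow> 0"
      by (rule tendsto_sandwich[of "\<lambda>_. 0" _ _ "\<lambda>n. (2 * C) * (1/2)^n"])
        (use tail norm_nonneg lim in \<open>auto intro!: always_eventually\<close>)
  qed
qed

lemma sup_norm_upper: "x \<in> bounded_seqs \<Longrightarrow> norm (x i) \<le> sup_norm x"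
  unfolding sup_norm_def bounded_seqs_def by (auto intro: cSUP_upper)

lemma sup_norm_least:
  assumes "\<And>i. norm (x i) \<le> C" shows "x \<in> bounded_seqs" "sup_norm x \<le> C"
proof -
  show "x \<in> bounded_seqs" unfolding bounded_seqs_def by (intro CollectI bdd_aboveI2[of _ _ C] assms)
  show "sup_norm x \<le> C" unfolding sup_norm_def using assms by (intro cSUP_least) auto
qed

lemma bounded_seqs_restrict:
  "restrict_seq (cube n) (x :: ('x::real_normed_vector, 'n::finite) lattice_seq) \<in> bounded_seqs"
proof -
  have "finite ((\<lambda>i. norm (x i)) ` cube n)" by (intro finite_imageI finite_cube)
  then obtain M where "\<And>i. i \<in> cube n \<Longrightarrow> norm (x i) \<le> M"
    by (meson bdd_above_finite bdd_above.E imageI)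
  then have "norm (restrict_seq (cube n) x i) \<le> max 0 M" for i
    by (force simp: restrict_seq_def)
  then show ?thesis by (rule sup_norm_least)
qed

lemma normed_carrier_sup:
  fixes C :: "('x::{complex_normed_vector, banach}, 'n::finite) lattice_seq set"
  assumes C: "C \<subseteq> bounded_seqs" "complex_vector.subspace C"
  shows "normed_carrier \<lparr>carrier_of = C, norm_of = sup_norm\<rparr>"
proof
  show "complex_vector.subspace (carrier_of \<lparr>carrier_of = C, norm_of = sup_norm\<rparr>)" using C by simp
  fix x assume x: "x \<in> carrier_of \<lparr>carrier_of = C, norm_of = sup_norm\<rparr>"
  then have xb: "x \<in> bounded_seqs" using C by auto
  show "norm_of \<lparr>carrier_of = C, norm_of = sup_norm\<rparr> (x + y)
      \<le> norm_of \<lparr>carrier_of = C, norm_of = sup_norm\<rparr> x + norm_of \<lparr>carrier_of = C, norm_of = sup_norm\<rparr> y"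
    if y: "y \<in> carrier_of \<lparr>carrier_of = C, norm_of = sup_norm\<rparr>" for y
  proof -
    have yb: "y \<in> bounded_seqs" using y C by auto
    have "norm ((x + y) i) \<le> sup_norm x + sup_norm y" for i
      using norm_triangle_ineq[of "x i" "y i"] sup_norm_upper[OF xb, of i] sup_norm_upper[OF yb, of i] by simp
    then show ?thesis by (simp add: sup_norm_least)
  qed
  have le: "sup_norm (a *\<^sub>C z) \<le> cmod a * sup_norm z" if z: "z \<in> bounded_seqs" for a and z :: "('x, 'n) lattice_seq"
    by (rule sup_norm_least) (simp add: scaleC_fun_def norm_scaleC mult_left_mono sup_norm_upper[OF z])
  show "norm_of \<lparr>carrier_of = C, norm_of = sup_norm\<rparr> (a *\<^sub>C x)
      = cmod a * norm_of \<lparr>carrier_of = C, norm_of = sup_norm\<rparr> x" for a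
  proof (cases "a = 0")
    case True
    have "sup_norm (0 :: ('x, 'n) lattice_seq) = 0" by (simp add: sup_norm_def)
    then show ?thesis using True by simp
  next
    case False
    have "a *\<^sub>C x \<in> C" using x C(2) by (simp add: complex_vector.subspace_scale)
    then have "a *\<^sub>C x \<in> bounded_seqs" using C by auto
    then have "sup_norm ((1 / a) *\<^sub>C (a *\<^sub>C x)) \<le> cmod (1 / a) * sup_norm (a *\<^sub>C x)" by (rule le)
    moreover have "(1 / a) *\<^sub>C (a *\<^sub>C x) = x" using False by (simp add: scaleC_one)
    ultimately have "cmod a * sup_norm x \<le> sup_norm (a *\<^sub>C x)"
      using False by (simp add: norm_divide field_simps)
    then show ?thesis using le[OF xb, of a] by simp
  qed
  show "0 < norm_of \<lparr>carrier_of = C, norm_of = sup_norm\<rparr> x" if nz: "x \<noteq> 0"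
  proof -
    obtain i where "x i \<noteq> 0" using nz by (auto simp: fun_eq_iff)
    then have "0 < norm (x i)" by simp
    also have "\<dots> \<le> sup_norm x" by (rule sup_norm_upper[OF xb])
    finally show ?thesis by simp
  qed
qed

lemma sup_norm_single: "sup_norm (single_seq i v) = norm v"
proof (rule antisym)
  have b: "norm (single_seq i v j) \<le> norm v" for j by (simp add: single_seq_def)
  show "sup_norm (single_seq i v) \<le> norm v" by (rule sup_norm_least(2)[OF b])
  have m: "single_seq i v \<in> bounded_seqs" by (rule sup_norm_least(1)[OF b])
  show "norm v \<le> sup_norm (single_seq i v)"
    using sup_norm_upper[OF m, of i] by (simp add: single_seq_def)
qed

lemma bounded_seqs_subspace:
  "complex_vector.subspace (bounded_seqs :: ('x::{complex_normed_vector, banach}, 'n::finite) lattice_seq set)"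
  unfolding complex_vector.subspace_def
proof (intro conjI ballI allI)
  show "0 \<in> bounded_seqs" by (rule sup_norm_least(1)[of _ 0]) simp
  show "x + y \<in> bounded_seqs" if x: "x \<in> bounded_seqs" and y: "y \<in> bounded_seqs" for x y :: "('x, 'n) lattice_seq"
  proof (rule sup_norm_least(1))
    show "norm ((x + y) i) \<le> sup_norm x + sup_norm y" for i
      using norm_triangle_ineq[of "x i" "y i"] sup_norm_upper[OF x, of i] sup_norm_upper[OF y, of i] by simp
  qed
  show "a *\<^sub>C x \<in> bounded_seqs" if x: "x \<in> bounded_seqs" for a and x :: "('x, 'n) lattice_seq"
    by (rule sup_norm_least(1)[of _ "cmod a * sup_norm x"])
      (simp add: scaleC_fun_def norm_scaleC mult_left_mono sup_norm_upper[OF x])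
qed

lemma fatou_sup:
  assumes "\<And>m. w m \<in> bounded_seqs" "\<And>m. sup_norm (w m) \<le> B" "\<And>i. (\<lambda>m::nat. w m i) \<longlonglongrightarrow> x i"
  shows "x \<in> bounded_seqs \<and> sup_norm x \<le> B"
proof -
  have "norm (x i) \<le> B" for i
  proof (rule LIMSEQ_le_const2[OF tendsto_norm[OF assms(3)]])
    show "\<exists>n0. \<forall>n\<ge>n0. norm (w n i) \<le> B" using sup_norm_upper[OF assms(1)] assms(2) order_trans by blast
  qed
  then show ?thesis using sup_norm_least[of x B] by blast
qed

text \<open>This covers \<open>l\<^sup>\<infinity>\<close> and \<open>l\<^sup>0\<close>, which are closed ideals of bounded sequences.\<close>

lemma seq_space_sup:
  fixes C :: "('x::{complex_normed_vector, banach}, 'n::finite) lattice_seq set"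
  defines "S \<equiv> \<lparr>carrier_of = C, norm_of = sup_norm\<rparr>"
  assumes C: "C \<subseteq> bounded_seqs" "complex_vector.subspace C"
    and ideal: "\<And>x y. \<lbrakk>x \<in> C; \<And>i. norm (y i) \<le> norm (x i)\<rbrakk> \<Longrightarrow> y \<in> C"
    and single: "\<And>i v. single_seq i v \<in> C"
    and closed: "\<And>u s. \<lbrakk>\<And>n::nat. u n \<in> C; s \<in> bounded_seqs; (\<lambda>n. sup_norm (s - u n)) \<longlonglongrightarrow> 0\<rbrakk> \<Longrightarrow> s \<in> C"
    and alt: "(\<forall>x\<in>C. (\<lambda>n. sup_norm (Q_proj n x)) \<longlonglongrightarrow> 0) \<or> C = bounded_seqs"
    and fin: "\<exists>v::'x. v \<noteq> 0" "\<exists>b::'x set. finite b \<and> complex_vector.span b = UNIV"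
  shows "seq_space S"
proof -
  have S: "carrier_of S = C" "norm_of S = sup_norm" by (simp_all add: S_def)
  interpret normed_carrier S unfolding S_def by (rule normed_carrier_sup[OF C])
  have up: "norm (x i) \<le> sup_norm x" if "x \<in> C" for x i using sup_norm_upper that C(1) by blast
  show ?thesis
  proof
    fix x y :: "('x, 'n) lattice_seq"
    assume x: "x \<in> carrier_of S" and le: "\<And>i. norm (y i) \<le> norm (x i)"
    have "norm (y i) \<le> sup_norm x" for i using le[of i] up[of x i] x by (simp add: S)
    then show "y \<in> carrier_of S \<and> norm_of S y \<le> norm_of S x"
      using ideal[of x y] x le by (simp add: S sup_norm_least)
  next
    show "single_seq i v \<in> carrier_of S" "norm_of S (single_seq i v) = norm v" for i v
      by (simp_all add: S single sup_norm_single)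
  next
    fix x x' y y' :: "('x, 'n) lattice_seq"
    assume m: "x \<in> carrier_of S" "x' \<in> carrier_of S" "y \<in> carrier_of S" "y' \<in> carrier_of S"
      and d: "\<And>i. x i = 0 \<or> x' i = 0" "\<And>i. y i = 0 \<or> y' i = 0"
      and le: "norm_of S x \<le> norm_of S y" "norm_of S x' \<le> norm_of S y'"
    have yy: "y + y' \<in> C" using add_mem[OF m(3,4)] by (simp add: S)
    have "norm (y i) \<le> norm ((y + y') i)" "norm (y' i) \<le> norm ((y + y') i)" for i using d(2)[of i] by auto
    then have "norm (y i) \<le> sup_norm (y + y')" "norm (y' i) \<le> sup_norm (y + y')" for i
      using up[OF yy, of i] order_trans by blast+
    then have "sup_norm y \<le> sup_norm (y + y')" "sup_norm y' \<le> sup_norm (y + y')" by (auto intro: sup_norm_least)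
    then have b: "sup_norm x \<le> sup_norm (y + y')" "sup_norm x' \<le> sup_norm (y + y')" using le by (auto simp: S)
    have "norm ((x + x') i) \<le> sup_norm (y + y')" for i
      using d(1)[of i] up[of x i] up[of x' i] m b by (auto simp: S)
    then show "norm_of S (x + x') \<le> norm_of S (y + y')" by (simp add: S sup_norm_least)
  next
    fix x :: "('x, 'n) lattice_seq" and e :: real
    assume x: "x \<in> carrier_of S" and e: "0 < e"
    have "\<exists>i. sup_norm x - e < norm (x i)"
    proof (rule ccontr)
      assume "\<nexists>i. sup_norm x - e < norm (x i)"
      then have "sup_norm x \<le> sup_norm x - e" by (intro sup_norm_least) (simp add: not_less)
      then show False using e by simp
    qed
    then obtain i where i: "sup_norm x - e < norm (x i)" by blast
    obtain n where n: "i \<in> cube n" using finite_subset_cube[of "{i}"] by auto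
    have "norm (x i) = norm (restrict_seq (cube n) x i)" using n by (simp add: restrict_seq_def)
    also have "\<dots> \<le> sup_norm (restrict_seq (cube n) x)" by (rule sup_norm_upper[OF bounded_seqs_restrict])
    finally show "\<exists>n. norm_of S x - e < norm_of S (P_proj n x)" 
      using i by (intro exI[of _ n]) (simp add: S P_proj_eq)
  next
    fix u D assume u: "\<And>j::nat. u j \<in> carrier_of S \<and> norm_of S (u j) \<le> D * (1/2)^j"
    let ?T = "\<lparr>carrier_of = bounded_seqs, norm_of = sup_norm\<rparr> :: ('x, 'n) lattice_seq nspace"
    have "\<exists>s\<in>carrier_of ?T. (\<lambda>n. norm_of ?T (s - (\<Sum>j<n. u j))) \<longlonglongrightarrow> 0"
    proof (rule fatou_imp_complete)
      show "normed_carrier ?T" by (rule normed_carrier_sup[OF subset_refl bounded_seqs_subspace])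
      show "u j \<in> carrier_of ?T \<and> norm_of ?T (u j) \<le> D * (1/2)^j" for j using u[of j] C(1) by (auto simp: S)
      show "norm (x i) \<le> norm_of ?T x" if "x \<in> carrier_of ?T" for x i using sup_norm_upper that by simp
      show "x \<in> carrier_of ?T \<and> norm_of ?T x \<le> B"
        if "\<And>m. w m \<in> carrier_of ?T" "\<And>m. norm_of ?T (w m) \<le> B" "\<And>i. (\<lambda>m. w m i) \<longlonglongrightarrow> x i" for w x B
        using fatou_sup[of w B x] that by simp
    qed
    then obtain s where s: "s \<in> bounded_seqs" "(\<lambda>n. sup_norm (s - (\<Sum>j<n. u j))) \<longlonglongrightarrow> 0" by auto
    have "s \<in> C"
    proof (rule closed[OF _ s])
      show "(\<Sum>j<n. u j) \<in> C" for n using sum_mem[of "{..<n}" u] u by (simp add: S)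
    qed
    then show "\<exists>s\<in>carrier_of S. (\<lambda>n. norm_of S (s - (\<Sum>j<n. u j))) \<longlonglongrightarrow> 0" using s by (auto simp: S)
  next
    have "x \<in> bounded_seqs" if x: "\<forall>n. sup_norm (P_proj n x) \<le> D" for x :: "('x, 'n) lattice_seq" and D
    proof (rule sup_norm_least(1))
      fix i :: "int ^ 'n"
      obtain n where n: "i \<in> cube n" using finite_subset_cube[of "{i}"] by auto
      have "norm (x i) = norm (restrict_seq (cube n) x i)" using n by (simp add: restrict_seq_def)
      also have "\<dots> \<le> sup_norm (restrict_seq (cube n) x)" by (rule sup_norm_upper[OF bounded_seqs_restrict])
      finally show "norm (x i) \<le> D" using x[rule_format, of n] by (simp add: P_proj_eq)
    qed
    then show "(\<forall>x\<in>carrier_of S. (\<lambda>n. norm_of S (Q_proj n x)) \<longlonglongrightarrow> 0) \<or>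
      (\<forall>x C. (\<forall>n. norm_of S (P_proj n x) \<le> C) \<longrightarrow> x \<in> carrier_of S)"
      using alt by (auto simp: S)
  qed (use fin in auto)
qed

lemma seq_space_lp_infinity:
  assumes "\<exists>v::'x::{complex_normed_vector, banach}. v \<noteq> 0" "\<exists>b::'x set. finite b \<and> complex_vector.span b = UNIV"
  shows "seq_space (lp \<infinity> :: ('x, 'n::finite) lattice_seq nspace)"
proof -
  have "seq_space (\<lparr>carrier_of = bounded_seqs, norm_of = sup_norm\<rparr> :: ('x, 'n) lattice_seq nspace)"
  proof (rule seq_space_sup)
    show "y \<in> bounded_seqs" if "x \<in> bounded_seqs" "\<And>i. norm (y i) \<le> norm (x i)" for x y :: "('x, 'n) lattice_seq"
      using sup_norm_upper[OF that(1)] that(2) by (intro sup_norm_least(1)[of _ "sup_norm x"]) (blast intro: order_trans)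
    show "single_seq i v \<in> bounded_seqs" for i and v :: 'x
      by (rule sup_norm_least(1)[of _ "norm v"]) (simp add: single_seq_def)
  qed (use assms bounded_seqs_subspace in auto)
  then show ?thesis by (simp add: lp_def)
qed

text \<open>The space \<open>l\<^sup>0\<close>, described without approximating sequences.\<close>

definition null_seqs :: "('x::real_normed_vector, 'n::finite) lattice_seq set" where
  "null_seqs = {x. \<forall>e>0. \<exists>F. finite F \<and> (\<forall>i. i \<notin> F \<longrightarrow> norm (x i) \<le> e)}"

lemma null_seqs_bounded: "x \<in> null_seqs \<Longrightarrow> x \<in> bounded_seqs"
proof -
  assume "x \<in> null_seqs"
  then obtain F where F: "finite F" "\<And>i. i \<notin> F \<Longrightarrow> norm (x i) \<le> 1" unfolding null_seqs_def using zero_less_one by blast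
  have "norm (x i) \<le> 1 + (\<Sum>i\<in>F. norm (x i))" for i
  proof (cases "i \<in> F")
    case True
    then have "norm (x i) \<le> (\<Sum>i\<in>F. norm (x i))" using F(1) by (intro member_le_sum) auto
    then show ?thesis by simp
  next
    case False
    then show ?thesis using F(2)[of i] sum_nonneg[of F "\<lambda>i. norm (x i)"] by simp
  qed
  then show ?thesis by (rule sup_norm_least(1))
qed

lemma lp_zero_eq: "lp 0 = (\<lparr>carrier_of = null_seqs, norm_of = sup_norm\<rparr> :: ('x::real_normed_vector, 'n::finite) lattice_seq nspace)"
proof -
  have "{x \<in> bounded_seqs. \<forall>e>0. \<exists>y. finite {i. y i \<noteq> 0} \<and> sup_norm (x - y) < e} = (null_seqs :: ('x, 'n) lattice_seq set)"
  proof (intro set_eqI iffI)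
    fix x :: "('x, 'n) lattice_seq"
    assume x: "x \<in> {x \<in> bounded_seqs. \<forall>e>0. \<exists>y. finite {i. y i \<noteq> 0} \<and> sup_norm (x - y) < e}"
    have "\<exists>F. finite F \<and> (\<forall>i. i \<notin> F \<longrightarrow> norm (x i) \<le> e)" if e: "0 < e" for e
    proof -
      obtain y where y: "finite {i. y i \<noteq> 0}" "sup_norm (x - y) < e" using x e by blast
      have yb: "y \<in> bounded_seqs"
      proof (rule sup_norm_least(1))
        fix i
        show "norm (y i) \<le> (\<Sum>i\<in>{i. y i \<noteq> 0}. norm (y i))"
          using y(1) member_le_sum[of i "{i. y i \<noteq> 0}" "\<lambda>i. norm (y i)"]
          by (cases "y i = 0") (auto intro: sum_nonneg)
      qed
      have "x - y \<in> bounded_seqs"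
      proof (rule sup_norm_least(1))
        fix i
        show "norm ((x - y) i) \<le> sup_norm x + sup_norm y"
          using norm_triangle_ineq4[of "x i" "y i"] sup_norm_upper[of x i] sup_norm_upper[OF yb, of i] x by simp
      qed
      then have "norm ((x - y) i) \<le> e" for i using sup_norm_upper[of "x - y" i] y(2) by simp
      then have "norm (x i) \<le> e" if "i \<notin> {i. y i \<noteq> 0}" for i
        using that by (metis (mono_tags) diff_zero mem_Collect_eq minus_apply)
      then show ?thesis using y(1) by blast
    qed
    then show "x \<in> null_seqs" by (simp add: null_seqs_def)
  next
    fix x :: "('x, 'n) lattice_seq" assume x: "x \<in> null_seqs"
    have "\<exists>y. finite {i. y i \<noteq> 0} \<and> sup_norm (x - y) < e" if e: "0 < e" for e
    proof -
      have "0 < e / 2" using e by simp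
      then obtain F where F: "finite F" "\<forall>i. i \<notin> F \<longrightarrow> norm (x i) \<le> e / 2"
        using x unfolding null_seqs_def by blast
      have "sup_norm (x - restrict_seq F x) \<le> e / 2"
        by (rule sup_norm_least) (use F(2) e in \<open>auto simp: restrict_seq_def\<close>)
      moreover have "finite {i. restrict_seq F x i \<noteq> 0}"
        by (rule finite_subset[OF _ F(1)]) (auto simp: restrict_seq_def)
      ultimately show ?thesis using e by (intro exI[of _ "restrict_seq F x"]) auto
    qed
    then show "x \<in> {x \<in> bounded_seqs. \<forall>e>0. \<exists>y. finite {i. y i \<noteq> 0} \<and> sup_norm (x - y) < e}"
      using null_seqs_bounded[OF x] by blast
  qed
  then show ?thesis by (simp add: lp_def)
qed

lemma null_seqsD:
  assumes "x \<in> null_seqs" "0 < e"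
  obtains F where "finite F" "\<And>i. i \<notin> F \<Longrightarrow> norm (x i) \<le> e"
  using assms unfolding null_seqs_def by blast

lemma null_seqsI:
  assumes "\<And>e. 0 < e \<Longrightarrow> \<exists>F. finite F \<and> (\<forall>i. i \<notin> F \<longrightarrow> norm (x i) \<le> e)"
  shows "x \<in> null_seqs"
  using assms by (simp add: null_seqs_def)

lemma null_seqs_ideal:
  assumes x: "x \<in> null_seqs" and le: "\<And>i. norm (y i) \<le> norm (x i)"
  shows "y \<in> null_seqs"
proof (rule null_seqsI)
  fix e :: real assume "0 < e"
  then obtain F where F: "finite F" "\<And>i. i \<notin> F \<Longrightarrow> norm (x i) \<le> e" using null_seqsD[OF x] by blast
  have "norm (y i) \<le> e" if "i \<notin> F" for i using le[of i] F(2)[OF that] by (rule order_trans)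
  then show "\<exists>F. finite F \<and> (\<forall>i. i \<notin> F \<longrightarrow> norm (y i) \<le> e)" using F(1) by blast
qed

lemma null_seqs_subspace:
  "complex_vector.subspace (null_seqs :: ('x::{complex_normed_vector, banach}, 'n::finite) lattice_seq set)"
  unfolding complex_vector.subspace_def
proof (intro conjI ballI allI)
  show "0 \<in> (null_seqs :: ('x, 'n) lattice_seq set)" by (rule null_seqsI) auto
  fix x y :: "('x, 'n) lattice_seq" and a assume x: "x \<in> null_seqs"
  show "x + y \<in> null_seqs" if y: "y \<in> null_seqs"
  proof (rule null_seqsI)
    fix e :: real assume "0 < e"
    then have e2: "0 < e / 2" by simp
    obtain F where F: "finite F" "\<And>i. i \<notin> F \<Longrightarrow> norm (x i) \<le> e / 2" using null_seqsD[OF x e2] by blast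
    obtain G where G: "finite G" "\<And>i. i \<notin> G \<Longrightarrow> norm (y i) \<le> e / 2" using null_seqsD[OF y e2] by blast
    have "norm ((x + y) i) \<le> e" if i: "i \<notin> F \<union> G" for i
    proof -
      have "norm (x i) \<le> e / 2" "norm (y i) \<le> e / 2" using F(2)[of i] G(2)[of i] i by auto
      then show ?thesis using norm_triangle_ineq[of "x i" "y i"] by simp
    qed
    then show "\<exists>F. finite F \<and> (\<forall>i. i \<notin> F \<longrightarrow> norm ((x + y) i) \<le> e)"
      using F(1) G(1) by (intro exI[of _ "F \<union> G"]) auto
  qed
  show "a *\<^sub>C x \<in> null_seqs"
  proof (rule null_seqsI)
    fix e :: real assume e: "0 < e"
    have a1: "0 < cmod a + 1" by (simp add: add_nonneg_pos)
    then have "0 < e / (cmod a + 1)" using e by simp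
    then obtain F where F: "finite F" "\<And>i. i \<notin> F \<Longrightarrow> norm (x i) \<le> e / (cmod a + 1)"
      using null_seqsD[OF x] by blast
    have "norm ((a *\<^sub>C x) i) \<le> e" if "i \<notin> F" for i
    proof -
      have "norm ((a *\<^sub>C x) i) = cmod a * norm (x i)" by (simp add: scaleC_fun_def norm_scaleC)
      also have "\<dots> \<le> (cmod a + 1) * (e / (cmod a + 1))" using F(2)[OF that] a1 by (intro mult_mono) auto
      also have "\<dots> = e" using a1 by simp
      finally show ?thesis .
    qed
    then show "\<exists>F. finite F \<and> (\<forall>i. i \<notin> F \<longrightarrow> norm ((a *\<^sub>C x) i) \<le> e)" using F(1) by blast
  qed
qed

lemma null_seqs_closed:
  fixes s :: "('x::{complex_normed_vector, banach}, 'n::finite) lattice_seq"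
  assumes u: "\<And>n::nat. u n \<in> null_seqs" and s: "s \<in> bounded_seqs" and lim: "(\<lambda>n. sup_norm (s - u n)) \<longlonglongrightarrow> 0"
  shows "s \<in> null_seqs"
proof (rule null_seqsI)
  fix e :: real assume "0 < e"
  then have e2: "0 < e / 2" by simp
  obtain n where n: "sup_norm (s - u n) < e / 2"
    using order_tendstoD(2)[OF lim e2] by (auto simp: eventually_sequentially)
  obtain F where F: "finite F" "\<And>i. i \<notin> F \<Longrightarrow> norm (u n i) \<le> e / 2" using null_seqsD[OF u e2] by blast
  have sb: "s - u n \<in> bounded_seqs"
    by (rule complex_vector.subspace_diff[OF bounded_seqs_subspace s null_seqs_bounded[OF u]])
  have "norm (s i) \<le> e" if "i \<notin> F" for i
    using norm_triangle_ineq[of "(s - u n) i" "u n i"] sup_norm_upper[OF sb, of i] F(2)[OF that] n by simp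
  then show "\<exists>F. finite F \<and> (\<forall>i. i \<notin> F \<longrightarrow> norm (s i) \<le> e)" using F(1) by blast
qed

lemma null_seqs_vanishing:
  fixes x :: "('x::{complex_normed_vector, banach}, 'n::finite) lattice_seq"
  assumes x: "x \<in> null_seqs"
  shows "(\<lambda>n. sup_norm (Q_proj n x)) \<longlonglongrightarrow> 0"
proof (rule LIMSEQ_I)
  fix r :: real assume r: "0 < r"
  then have r2: "0 < r / 2" by simp
  obtain F where F: "finite F" "\<And>i. i \<notin> F \<Longrightarrow> norm (x i) \<le> r / 2" using null_seqsD[OF x r2] by blast
  obtain n0 where n0: "F \<subseteq> cube n0" using finite_subset_cube[OF F(1)] by blast
  have "norm (sup_norm (Q_proj n x) - 0) < r" if n: "n0 \<le> n" for n
  proof -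
    have b: "norm (Q_proj n x i) \<le> r / 2" for i
    proof (cases "i \<in> cube n")
      case False
      then have "i \<notin> F" using n0 cube_mono[OF n] by blast
      then show ?thesis using F(2) False by (simp add: Q_proj_eq restrict_seq_def)
    qed (use r in \<open>simp add: Q_proj_eq restrict_seq_def\<close>)
    have m: "sup_norm (Q_proj n x) \<le> r / 2" "Q_proj n x \<in> bounded_seqs"
      using sup_norm_least[of "Q_proj n x", OF b] by auto
    have "0 \<le> norm (Q_proj n x undefined)" by simp
    also have "\<dots> \<le> sup_norm (Q_proj n x)" by (rule sup_norm_upper[OF m(2)])
    finally show ?thesis using m(1) r by simp
  qed
  then show "\<exists>n0. \<forall>n\<ge>n0. norm (sup_norm (Q_proj n x) - 0) < r" by blast
qed

lemma seq_space_lp_zero: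
  assumes "\<exists>v::'x::{complex_normed_vector, banach}. v \<noteq> 0" "\<exists>b::'x set. finite b \<and> complex_vector.span b = UNIV"
  shows "seq_space (lp 0 :: ('x, 'n::finite) lattice_seq nspace)"
proof -
  have single: "single_seq i v \<in> null_seqs" for i :: "int ^ 'n" and v :: 'x
    by (rule null_seqsI) (auto intro!: exI[of _ "{i}"] simp: single_seq_def)
  have sub: "(null_seqs :: ('x, 'n) lattice_seq set) \<subseteq> bounded_seqs" by (rule subsetI) (rule null_seqs_bounded)
  show ?thesis
    unfolding lp_zero_eq
    by (rule seq_space_sup[OF sub null_seqs_subspace null_seqs_ideal single null_seqs_closed _ assms])
      (simp_all add: null_seqs_vanishing)
qed

text \<open>At the end point \<open>0\<close>, where the second derivative test behind \<open>powr_convex\<close> breaks down, the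
  inequality reduces to \<open>c\<^sup>r \<le> c\<close> for \<open>0 \<le> c \<le> 1\<close>.\<close>

lemma powr_convex_combination:
  fixes u v t r :: real
  assumes r: "1 \<le> r" and t: "0 \<le> t" "t \<le> 1" and uv: "0 \<le> u" "0 \<le> v"
  shows "(t * u + (1 - t) * v) powr r \<le> t * u powr r + (1 - t) * v powr r"
proof -
  have small: "(c * w) powr r \<le> c * w powr r" if "0 \<le> c" "c \<le> 1" "0 \<le> w" for c w :: real
  proof -
    have "c powr r \<le> c"
      using that(1,2) r powr_mono'[of 1 r c] by (cases "c = 0") auto
    then show ?thesis using that by (simp add: powr_mult mult_right_mono)
  qed
  show ?thesis
  proof (cases "u = 0 \<or> v = 0")
    case True
    then show ?thesis using small[of t u] small[of "1 - t" v] t uv by auto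
  next
    case False
    then show ?thesis
      using convex_onD[OF powr_convex[OF r], of "1 - t" u v] t uv by (simp add: algebra_simps)
  qed
qed

context
  fixes r :: real
  assumes r: "1 \<le> r"
begin

lemma lp_carrier: "x \<in> carrier_of (lp (ereal r)) \<longleftrightarrow> (\<lambda>i. norm (x i) powr r) summable_on UNIV"
  using r by (simp add: lp_def)

lemma lp_norm: "norm_of (lp (ereal r)) x = (\<Sum>\<^sub>\<infinity>i. norm (x i) powr r) powr (1 / r)"
  using r by (simp add: lp_def)

lemma lp_norm_nonneg: "0 \<le> norm_of (lp (ereal r)) x"
  by (simp add: lp_norm)

lemma lp_norm_powr: "norm_of (lp (ereal r)) x powr r = (\<Sum>\<^sub>\<infinity>i. norm (x i) powr r)"
  using r infsum_nonneg[of UNIV "\<lambda>i. norm (x i) powr r"] by (simp add: lp_norm powr_powr)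

lemma powr_le_cancel:
  assumes ab: "0 \<le> a" "0 \<le> b"
  shows "a powr r \<le> b powr r \<longleftrightarrow> a \<le> b"
proof
  assume le: "a powr r \<le> b powr r"
  show "a \<le> b"
  proof (rule ccontr)
    assume "\<not> a \<le> b"
    then have "b powr r < a powr r" using r ab by (intro powr_less_mono2) auto
    then show False using le by simp
  qed
qed (use r ab in \<open>auto intro: powr_mono2\<close>)

text \<open>Membership and norm are characterised by finite sums; triangle inequality, Fatou property and
  approximation by truncations then need no infinite sums.\<close>

lemma lp_norm_le_iff:
  assumes C: "0 \<le> C"
  shows "x \<in> carrier_of (lp (ereal r)) \<and> norm_of (lp (ereal r)) x \<le> C \<longleftrightarrow>
    (\<forall>F. finite F \<longrightarrow> (\<Sum>i\<in>F. norm (x i) powr r) \<le> C powr r)"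
proof (intro iffI allI impI)
  fix F :: "(int ^ 'a) set" assume x: "x \<in> carrier_of (lp (ereal r)) \<and> norm_of (lp (ereal r)) x \<le> C" and F: "finite F"
  have "(\<Sum>i\<in>F. norm (x i) powr r) \<le> (\<Sum>\<^sub>\<infinity>i. norm (x i) powr r)"
    using x F by (intro finite_sum_le_infsum) (auto simp: lp_carrier)
  also have "\<dots> = norm_of (lp (ereal r)) x powr r" by (rule lp_norm_powr[symmetric])
  also have "\<dots> \<le> C powr r" using x C by (simp add: powr_le_cancel lp_norm_nonneg)
  finally show "(\<Sum>i\<in>F. norm (x i) powr r) \<le> C powr r" .
next
  assume b: "\<forall>F. finite F \<longrightarrow> (\<Sum>i\<in>F. norm (x i) powr r) \<le> C powr r"
  have s: "(\<lambda>i. norm (x i) powr r) summable_on UNIV"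
    by (rule nonneg_bdd_above_summable_on) (use b in \<open>auto intro!: bdd_aboveI2\<close>)
  have "(\<Sum>\<^sub>\<infinity>i. norm (x i) powr r) \<le> C powr r" by (rule infsum_le_finite_sums[OF s]) (use b in auto)
  then have "norm_of (lp (ereal r)) x powr r \<le> C powr r" by (simp add: lp_norm_powr)
  then show "x \<in> carrier_of (lp (ereal r)) \<and> norm_of (lp (ereal r)) x \<le> C"
    using s C by (simp add: lp_carrier powr_le_cancel lp_norm_nonneg)
qed

lemma lp_finite_sum_le:
  assumes "x \<in> carrier_of (lp (ereal r))" "finite F"
  shows "(\<Sum>i\<in>F. norm (x i) powr r) \<le> norm_of (lp (ereal r)) x powr r"
  using lp_norm_le_iff[OF lp_norm_nonneg, of x x] assms by blast

lemma lp_coordinate: "x \<in> carrier_of (lp (ereal r)) \<Longrightarrow> norm (x i) \<le> norm_of (lp (ereal r)) x"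
  using lp_finite_sum_le[of x "{i}"] by (simp add: powr_le_cancel lp_norm_nonneg)

lemma lp_solid:
  fixes x y :: "('x::real_normed_vector, 'n::finite) lattice_seq"
  assumes "x \<in> carrier_of (lp (ereal r))" "\<And>i. norm (y i) \<le> norm (x i)"
  shows "y \<in> carrier_of (lp (ereal r)) \<and> norm_of (lp (ereal r)) y \<le> norm_of (lp (ereal r)) x"
  unfolding lp_norm_le_iff[OF lp_norm_nonneg]
proof (intro allI impI)
  fix F :: "(int ^ 'n) set" assume "finite F"
  have "(\<Sum>i\<in>F. norm (y i) powr r) \<le> (\<Sum>i\<in>F. norm (x i) powr r)"
    using assms(2) r by (intro sum_mono powr_mono2) auto
  also have "\<dots> \<le> norm_of (lp (ereal r)) x powr r" by (rule lp_finite_sum_le[OF assms(1) \<open>finite F\<close>])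
  finally show "(\<Sum>i\<in>F. norm (y i) powr r) \<le> norm_of (lp (ereal r)) x powr r" .
qed

lemma lp_scale:
  fixes x :: "('x::{complex_normed_vector, banach}, 'n::finite) lattice_seq"
  shows "x \<in> carrier_of (lp (ereal r)) \<Longrightarrow> a *\<^sub>C x \<in> carrier_of (lp (ereal r))"
    and "norm_of (lp (ereal r)) (a *\<^sub>C x) = cmod a * norm_of (lp (ereal r)) x"
proof -
  have e: "(\<lambda>i. norm ((a *\<^sub>C x) i) powr r) = (\<lambda>i. cmod a powr r * norm (x i) powr r)"
    by (simp add: scaleC_fun_def norm_scaleC powr_mult)
  show "x \<in> carrier_of (lp (ereal r)) \<Longrightarrow> a *\<^sub>C x \<in> carrier_of (lp (ereal r))"
    unfolding lp_carrier e by (rule summable_on_cmult_right)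
  have "norm_of (lp (ereal r)) (a *\<^sub>C x) = (cmod a powr r * (\<Sum>\<^sub>\<infinity>i. norm (x i) powr r)) powr (1 / r)"
    unfolding lp_norm e infsum_cmult_right' ..
  also have "\<dots> = cmod a * norm_of (lp (ereal r)) x"
    using r infsum_nonneg[of UNIV "\<lambda>i. norm (x i) powr r"] by (simp add: lp_norm powr_mult powr_powr)
  finally show "norm_of (lp (ereal r)) (a *\<^sub>C x) = cmod a * norm_of (lp (ereal r)) x" .
qed

lemma lp_norm_pos: "x \<in> carrier_of (lp (ereal r)) \<Longrightarrow> x \<noteq> 0 \<Longrightarrow> 0 < norm_of (lp (ereal r)) x"
proof -
  assume x: "x \<in> carrier_of (lp (ereal r))" "x \<noteq> 0"
  then obtain i where "x i \<noteq> 0" by (auto simp: fun_eq_iff)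
  then show ?thesis using lp_coordinate[OF x(1), of i] by (metis less_le_trans zero_less_norm_iff)
qed

text \<open>Minkowski's inequality: \<open>x + y\<close> is \<open>\<alpha> + \<beta>\<close> times a convex combination of the unit vectors \<open>x / \<alpha>\<close> and
  \<open>y / \<beta>\<close>, and \<open>t\<^sup>r\<close> is convex.\<close>

lemma lp_triangle:
  fixes x y :: "('x::{complex_normed_vector, banach}, 'n::finite) lattice_seq"
  assumes x: "x \<in> carrier_of (lp (ereal r))" and y: "y \<in> carrier_of (lp (ereal r))"
  shows "x + y \<in> carrier_of (lp (ereal r)) \<and>
    norm_of (lp (ereal r)) (x + y) \<le> norm_of (lp (ereal r)) x + norm_of (lp (ereal r)) y"
proof (cases "x = 0 \<or> y = 0")
  case True
  then show ?thesis using x y lp_norm_nonneg[of x] lp_norm_nonneg[of y] by auto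
next
  case False
  define \<alpha> \<beta> where "\<alpha> = norm_of (lp (ereal r)) x" and "\<beta> = norm_of (lp (ereal r)) y"
  have ab: "0 < \<alpha>" "0 < \<beta>" using False lp_norm_pos x y by (auto simp: \<alpha>_def \<beta>_def)
  define t where "t = \<alpha> / (\<alpha> + \<beta>)"
  have t: "0 \<le> t" "t \<le> 1" "1 - t = \<beta> / (\<alpha> + \<beta>)" using ab by (auto simp: t_def field_simps)
  have pt: "norm ((x + y) i) powr r
      \<le> (\<alpha> + \<beta>) powr r * (t / \<alpha> powr r * norm (x i) powr r + (1 - t) / \<beta> powr r * norm (y i) powr r)" for i
  proof -
    have "norm ((x + y) i) \<le> norm (x i) + norm (y i)" using norm_triangle_ineq by simp
    also have "\<dots> = (\<alpha> + \<beta>) * (t * (norm (x i) / \<alpha>) + (1 - t) * (norm (y i) / \<beta>))"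
    proof -
      have "t * (norm (x i) / \<alpha>) = norm (x i) / (\<alpha> + \<beta>)" using ab by (simp add: t_def)
      moreover have "(1 - t) * (norm (y i) / \<beta>) = norm (y i) / (\<alpha> + \<beta>)" using ab by (simp add: t(3))
      ultimately show ?thesis using ab by (simp add: add_divide_distrib[symmetric])
    qed
    finally have "norm ((x + y) i) powr r \<le> ((\<alpha> + \<beta>) * (t * (norm (x i) / \<alpha>) + (1 - t) * (norm (y i) / \<beta>))) powr r"
      using r by (intro powr_mono2) auto
    also have "\<dots> = (\<alpha> + \<beta>) powr r * (t * (norm (x i) / \<alpha>) + (1 - t) * (norm (y i) / \<beta>)) powr r"
      using ab t by (intro powr_mult)
    also have "\<dots> \<le> (\<alpha> + \<beta>) powr r * (t * (norm (x i) / \<alpha>) powr r + (1 - t) * (norm (y i) / \<beta>) powr r)"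
      using ab by (intro mult_left_mono powr_convex_combination r t) auto
    finally show ?thesis using ab by (simp add: powr_divide)
  qed
  have "x + y \<in> carrier_of (lp (ereal r)) \<and> norm_of (lp (ereal r)) (x + y) \<le> \<alpha> + \<beta>"
  proof (subst lp_norm_le_iff, use ab in simp, intro allI impI)
    fix F :: "(int ^ 'n) set" assume F: "finite F"
    have "(\<Sum>i\<in>F. norm ((x + y) i) powr r)
        \<le> (\<Sum>i\<in>F. (\<alpha> + \<beta>) powr r * (t / \<alpha> powr r * norm (x i) powr r + (1 - t) / \<beta> powr r * norm (y i) powr r))"
      by (intro sum_mono pt)
    also have "\<dots> = (\<alpha> + \<beta>) powr r * (t / \<alpha> powr r * (\<Sum>i\<in>F. norm (x i) powr r) + (1 - t) / \<beta> powr r * (\<Sum>i\<in>F. norm (y i) powr r))"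
      by (simp only: sum_distrib_left[symmetric] sum.distrib)
    also have "\<dots> \<le> (\<alpha> + \<beta>) powr r * (t / \<alpha> powr r * \<alpha> powr r + (1 - t) / \<beta> powr r * \<beta> powr r)"
      using lp_finite_sum_le[OF x F] lp_finite_sum_le[OF y F] t ab
      by (intro mult_left_mono add_mono) (auto simp: \<alpha>_def \<beta>_def)
    also have "\<dots> = (\<alpha> + \<beta>) powr r" using ab by simp
    finally show "(\<Sum>i\<in>F. norm ((x + y) i) powr r) \<le> (\<alpha> + \<beta>) powr r" .
  qed
  then show ?thesis by (simp add: \<alpha>_def \<beta>_def)
qed

lemma lp_fatou:
  fixes w :: "nat \<Rightarrow> ('x::{complex_normed_vector, banach}, 'n::finite) lattice_seq"
  assumes "\<And>m. w m \<in> carrier_of (lp (ereal r))" "\<And>m. norm_of (lp (ereal r)) (w m) \<le> B"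
    and lim: "\<And>i. (\<lambda>m. w m i) \<longlonglongrightarrow> x i"
  shows "x \<in> carrier_of (lp (ereal r)) \<and> norm_of (lp (ereal r)) x \<le> B"
proof -
  have B: "0 \<le> B" using lp_norm_nonneg[of "w 0"] assms(2)[of 0] by linarith
  show ?thesis
    unfolding lp_norm_le_iff[OF B]
  proof (intro allI impI)
    fix F :: "(int ^ 'n) set" assume F: "finite F"
    have "(\<lambda>m. \<Sum>i\<in>F. norm (w m i) powr r) \<longlonglongrightarrow> (\<Sum>i\<in>F. norm (x i) powr r)"
      using r by (intro tendsto_sum tendsto_powr' tendsto_norm lim tendsto_const) auto
    moreover have "(\<Sum>i\<in>F. norm (w m i) powr r) \<le> B powr r" for m
      using lp_norm_le_iff[OF B, of "w m"] assms(1,2) F by blast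
    ultimately show "(\<Sum>i\<in>F. norm (x i) powr r) \<le> B powr r" by (intro LIMSEQ_le_const2) auto
  qed
qed

lemma lp_finite_support:
  assumes "finite {i. x i \<noteq> 0}" shows "x \<in> carrier_of (lp (ereal r))"
proof -
  have "(\<lambda>i. norm (x i) powr r) summable_on UNIV \<longleftrightarrow> (\<lambda>i. norm (x i) powr r) summable_on {i. x i \<noteq> 0}"
    by (rule summable_on_cong_neutral) auto
  then show ?thesis using assms by (simp add: lp_carrier)
qed

lemma lp_approx:
  fixes x :: "('x::{complex_normed_vector, banach}, 'n::finite) lattice_seq"
  assumes C: "\<And>n. norm_of (lp (ereal r)) (P_proj n x) \<le> C"
  shows "x \<in> carrier_of (lp (ereal r)) \<and> norm_of (lp (ereal r)) x \<le> C"
proof -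
  have C0: "0 \<le> C" using lp_norm_nonneg[of "P_proj 0 x"] C[of 0] by linarith
  show ?thesis unfolding lp_norm_le_iff[OF C0]
  proof (intro allI impI)
    fix F :: "(int ^ 'n) set" assume F: "finite F"
    obtain n where n: "F \<subseteq> cube n" using finite_subset_cube[OF F] by blast
    have "{i. P_proj n x i \<noteq> 0} \<subseteq> cube n" by (auto simp: P_proj_eq restrict_seq_def)
    then have "finite {i. P_proj n x i \<noteq> 0}" using finite_cube by (rule finite_subset)
    then have "P_proj n x \<in> carrier_of (lp (ereal r))" by (rule lp_finite_support)
    then have "(\<Sum>i\<in>F. norm (P_proj n x i) powr r) \<le> C powr r"
      using C[of n] lp_norm_le_iff[OF C0, of "P_proj n x"] F by blast
    moreover have "(\<Sum>i\<in>F. norm (P_proj n x i) powr r) = (\<Sum>i\<in>F. norm (x i) powr r)"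
      using n by (intro sum.cong) (auto simp: P_proj_eq restrict_seq_def)
    ultimately show "(\<Sum>i\<in>F. norm (x i) powr r) \<le> C powr r" by simp
  qed
qed

lemma lp_disjoint:
  fixes x y :: "('x::{complex_normed_vector, banach}, 'n::finite) lattice_seq"
  assumes "x \<in> carrier_of (lp (ereal r))" "y \<in> carrier_of (lp (ereal r))" "\<And>i. x i = 0 \<or> y i = 0"
  shows "norm_of (lp (ereal r)) (x + y) powr r = norm_of (lp (ereal r)) x powr r + norm_of (lp (ereal r)) y powr r"
proof -
  have "norm ((x + y) i) powr r = norm (x i) powr r + norm (y i) powr r" for i using assms(3)[of i] r by auto
  then have "(\<Sum>\<^sub>\<infinity>i. norm ((x + y) i) powr r) = (\<Sum>\<^sub>\<infinity>i. norm (x i) powr r + norm (y i) powr r)" by simp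
  also have "\<dots> = (\<Sum>\<^sub>\<infinity>i. norm (x i) powr r) + (\<Sum>\<^sub>\<infinity>i. norm (y i) powr r)"
    using assms(1,2) unfolding lp_carrier by (rule infsum_add)
  finally show ?thesis by (simp only: lp_norm_powr)
qed

lemma seq_space_lp_finite:
  assumes "\<exists>v::'x::{complex_normed_vector, banach}. v \<noteq> 0" "\<exists>b::'x set. finite b \<and> complex_vector.span b = UNIV"
  shows "seq_space (lp (ereal r) :: ('x, 'n::finite) lattice_seq nspace)"
proof -
  let ?S = "lp (ereal r) :: ('x, 'n) lattice_seq nspace"
  have nc: "normed_carrier ?S"
  proof
    show "complex_vector.subspace (carrier_of ?S)"
      unfolding complex_vector.subspace_def using lp_triangle lp_scale(1) lp_finite_support[of "0 :: ('x, 'n) lattice_seq"] by auto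
  qed (simp_all add: lp_triangle lp_scale lp_norm_pos)
  interpret normed_carrier ?S by (rule nc)
  show ?thesis
  proof
    show "y \<in> carrier_of ?S \<and> norm_of ?S y \<le> norm_of ?S x"
      if "x \<in> carrier_of ?S" "\<And>i. norm (y i) \<le> norm (x i)" for x y by (rule lp_solid[OF that])
    fix i :: "int ^ 'n" and v :: 'x
    have "{j. single_seq i v j \<noteq> 0} \<subseteq> {i}" by (auto simp: single_seq_def)
    then have "finite {j. single_seq i v j \<noteq> 0}" by (rule finite_subset) simp
    then show sm: "single_seq i v \<in> carrier_of ?S" by (rule lp_finite_support)
    have "(\<Sum>\<^sub>\<infinity>j. norm (single_seq i v j) powr r) = (\<Sum>\<^sub>\<infinity>j\<in>{i}. norm (single_seq i v j) powr r)"
      by (rule infsum_cong_neutral) (auto simp: single_seq_def)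
    then have "norm_of ?S (single_seq i v) powr r = norm v powr r" by (simp add: lp_norm_powr) (simp add: single_seq_def)
    then show "norm_of ?S (single_seq i v) = norm v"
      using powr_le_cancel[of "norm_of ?S (single_seq i v)" "norm v"] powr_le_cancel[of "norm v" "norm_of ?S (single_seq i v)"]
      by (simp add: lp_norm_nonneg)
  next
    fix x x' y y' :: "('x, 'n) lattice_seq"
    assume m: "x \<in> carrier_of ?S" "x' \<in> carrier_of ?S" "y \<in> carrier_of ?S" "y' \<in> carrier_of ?S"
      and d: "\<And>i. x i = 0 \<or> x' i = 0" "\<And>i. y i = 0 \<or> y' i = 0"
      and le: "norm_of ?S x \<le> norm_of ?S y" "norm_of ?S x' \<le> norm_of ?S y'"
    have "norm_of ?S (x + x') powr r \<le> norm_of ?S (y + y') powr r"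
      unfolding lp_disjoint[OF m(1,2) d(1)] lp_disjoint[OF m(3,4) d(2)]
      using le by (intro add_mono) (simp_all add: powr_le_cancel lp_norm_nonneg)
    then show "norm_of ?S (x + x') \<le> norm_of ?S (y + y')" by (simp add: powr_le_cancel lp_norm_nonneg)
  next
    fix x :: "('x, 'n) lattice_seq" and e :: real
    assume "x \<in> carrier_of ?S" and e: "0 < e"
    show "\<exists>n. norm_of ?S x - e < norm_of ?S (P_proj n x)"
    proof (rule ccontr)
      assume "\<nexists>n. norm_of ?S x - e < norm_of ?S (P_proj n x)"
      then have "norm_of ?S x \<le> norm_of ?S x - e" using lp_approx[of x "norm_of ?S x - e"] by (simp add: not_less)
      then show False using e by simp
    qed
  next
    show "\<exists>s\<in>carrier_of ?S. (\<lambda>n. norm_of ?S (s - (\<Sum>j<n. u j))) \<longlonglongrightarrow> 0"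
      if "\<And>j::nat. u j \<in> carrier_of ?S \<and> norm_of ?S (u j) \<le> C * (1/2)^j" for u C
      by (rule fatou_imp_complete[OF nc lp_coordinate lp_fatou that])
  next
    show "(\<forall>x\<in>carrier_of ?S. (\<lambda>n. norm_of ?S (Q_proj n x)) \<longlonglongrightarrow> 0) \<or>
      (\<forall>x C. (\<forall>n. norm_of ?S (P_proj n x) \<le> C) \<longrightarrow> x \<in> carrier_of ?S)"
      using lp_approx by blast
  qed (use assms in auto)
qed

end

theorem theorem5p28:
  fixes p :: ereal
    and A :: "('x::{complex_normed_vector, banach}, 'n::finite) lattice_seq \<Rightarrow> ('x, 'n) lattice_seq"
  assumes exponent: "p = 0 \<or> 1 \<le> p"
    and X_nontrivial: "\<exists>x::'x. x \<noteq> 0"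
    and X_finite_dim: "\<exists>b::'x set. finite b \<and> complex_vector.span b = UNIV"
    and A_LP: "A \<in> LP_ops (lp p)"
  shows "mu (lp p) A = B_limit (lp p) A \<and> B_limit (lp p) A = S_limit (lp p) A"
proof -
  have "seq_space (lp p :: ('x, 'n) lattice_seq nspace)"
  proof (cases p)
    case (real r)
    then show ?thesis
      using exponent seq_space_lp_finite[of r, OF _ X_nontrivial X_finite_dim]
        seq_space_lp_zero[OF X_nontrivial X_finite_dim] by (auto simp: zero_ereal_def[symmetric])
  next
    case PInf
    then show ?thesis using seq_space_lp_infinity[OF X_nontrivial X_finite_dim] by simp
  next
    case MInf
    then show ?thesis using exponent by simp
  qed
  then interpret seq_space "lp p :: ('x, 'n) lattice_seq nspace" .
  show ?thesis using mu_eq_B_limit_eq_S_limit[OF A_LP] by blast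
qed

end
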